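(* The problem \textsc{Restricted-GridCircuit-SAT}, i.e. \textsc{Grid-Embedded Circuit Satisfiability} restricted to grid-embedded Boolean circuits all of whose blocks are conjunction, disjunction, fixed-value or selector blocks, is $\mathbf{NP}$-complete.
   Context: A grid-embedded Boolean circuit $C$ is an $n\times n$ grid of cells with coordinates $(i,j)$, $0\le i,j\le n-1$ (indices mod $n$), each cell carrying a block. A block at $(i,j)$ receives a north input $s_N$ (the south output of the block at $(i-1,j)$) and a west input $s_W$ (the east output of the block at $(i,j-1)$), and produces an east output $g_E(s_N,s_W)$ and a south output $g_S(s_N,s_W)$. Block types: conjunction ($g_E=g_S=s_N\wedge s_W$); disjunction ($g_E=g_S=s_N\vee s_W$); crossing ($g_E=s_W$, $g_S=s_N$); fixed-value ($g_E=g_S=0$); signal-multiplier (either $g_E=g_S=s_N$ or $g_E=g_S=s_W$); selector (ignores its inputs; either an east-selector with $g_E=1,g_S=0$ or a south-selector with $g_E=0,g_S=1$). Every cell $(i,j)$ with $i=0$ or $j=0$ carries a fixed-value block. If $v_1,\dots,v_s$ are the selector blocks, a truth-assignment is $u\in\{0,1\}^s$ making $v_i$ an east-selector if $u_i=1$ and a south-selector if $u_i=0$. Given $u$, outputs of all blocks are computed in order of increasing $i+j$; $C(u)_v$ denotes the value (output) of block $v$. \textsc{Grid-Embedded Circuit Satisfiability}: given $C$ and a block $v$, decide whether some truth-assignment $u$ has $C(u)_v=1$. *)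

theory Defs
  imports Main "HOL-Computational_Algebra.Polynomial"
begin

section \<open>Polynomial time, NP and NP-completeness\<close>

text \<open>
  Deterministic Turing machines with an arbitrary fixed number of two-way infinite tapes.
  A machine has states \<open>0, \<dots>, num_states\<close>, where \<open>0\<close> is the initial state and
  \<open>num_states\<close> is the only halting state, and tape symbols \<open>0, \<dots>, num_symbols - 1\<close>,
  where \<open>0\<close> is the blank and \<open>1\<close>, \<open>2\<close> stand for the bits 0 and 1.
  The transition function maps a state and the list of scanned symbols (one per tape) to the
  new state and, for each tape, the symbol written and the head movement.
\<close>

datatype move = Move_Left | Stay | Move_Right

record tm =
  num_tapes :: nat
  num_states :: nat
  num_symbols :: nat
  trans :: "nat \<Rightarrow> nat list \<Rightarrow> nat \<times> (nat \<times> move) list"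

text \<open>On the arguments constrained here, which are finitely many, the transition function is a
  finite table; its values elsewhere never influence a computation.\<close>

definition valid_tm :: "tm \<Rightarrow> bool" where
  "valid_tm M \<longleftrightarrow> num_tapes M \<ge> 1 \<and> num_symbols M \<ge> 3 \<and>
     (\<forall>q < num_states M. \<forall>xs. length xs = num_tapes M \<and> set xs \<subseteq> {..<num_symbols M} \<longrightarrow>
        fst (trans M q xs) \<le> num_states M \<and>
        length (snd (trans M q xs)) = num_tapes M \<and>
        fst ` set (snd (trans M q xs)) \<subseteq> {..<num_symbols M})"

type_synonym tape = "(int \<Rightarrow> nat) \<times> int"
type_synonym config = "nat \<times> tape list"

fun scanned :: "tape \<Rightarrow> nat" where
  "scanned (c, p) = c p"

fun act :: "nat \<times> move \<Rightarrow> tape \<Rightarrow> tape" where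
  "act (w, m) (c, p) =
     (c(p := w), case m of Move_Left \<Rightarrow> p - 1 | Stay \<Rightarrow> p | Move_Right \<Rightarrow> p + 1)"

definition step :: "tm \<Rightarrow> config \<Rightarrow> config" where
  "step M cf = (case cf of (q, ts) \<Rightarrow>
     if q < num_states M
     then let (q', as) = trans M q (map scanned ts) in (q', map2 act as ts)
     else (q, ts))"

definition bit_symbol :: "bool \<Rightarrow> nat" where
  "bit_symbol b = (if b then 2 else 1)"

definition word_tape :: "bool list \<Rightarrow> int \<Rightarrow> nat" where
  "word_tape x p = (if 0 \<le> p \<and> nat p < length x then bit_symbol (x ! nat p) else 0)"

definition init_config :: "tm \<Rightarrow> bool list \<Rightarrow> config" where
  "init_config M x = (0, (word_tape x, 0) # replicate (num_tapes M - 1) (\<lambda>_. 0, 0))"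

text \<open>The output is read off the last tape, from position \<open>0\<close> up to the first blank.\<close>

definition tape_output :: "tape \<Rightarrow> bool list \<Rightarrow> bool" where
  "tape_output t y \<longleftrightarrow>
     (\<forall>k < length y. fst t (int k) = bit_symbol (y ! k)) \<and> fst t (int (length y)) = 0"

definition halts_with :: "tm \<Rightarrow> bool list \<Rightarrow> nat \<Rightarrow> bool list \<Rightarrow> bool" where
  "halts_with M x t y \<longleftrightarrow>
     (case (step M ^^ t) (init_config M x) of
        (q, ts) \<Rightarrow> q = num_states M \<and> tape_output (last ts) y)"

definition poly_time_computable :: "(bool list \<Rightarrow> bool list) \<Rightarrow> bool" where
  "poly_time_computable f \<longleftrightarrow>
     (\<exists>M. \<exists>p :: nat poly. valid_tm M \<and>
        (\<forall>x. \<exists>t \<le> poly p (length x). halts_with M x t (f x)))"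

text \<open>A self-delimiting code of pairs: every bit of the first word is preceded by the bit 1,
  and the bit 0 marks its end.\<close>

definition pair_word :: "bool list \<Rightarrow> bool list \<Rightarrow> bool list" where
  "pair_word x u = concat (map (\<lambda>b. [True, b]) x) @ [False] @ u"

text \<open>NP in its verifier form: certificates of polynomially bounded length, checked in
  deterministic polynomial time.\<close>

definition NP :: "bool list set set" where
  "NP = {L. \<exists>V. \<exists>p :: nat poly. poly_time_computable V \<and>
      (\<forall>x. x \<in> L \<longleftrightarrow> (\<exists>u. length u \<le> poly p (length x) \<and> V (pair_word x u) = [True]))}"

definition poly_time_reducible :: "bool list set \<Rightarrow> bool list set \<Rightarrow> bool"
    (infix \<open>\<le>\<^sub>p\<close> 50) where
  "L \<le>\<^sub>p L' \<longleftrightarrow> (\<exists>f. poly_time_computable f \<and> (\<forall>x. x \<in> L \<longleftrightarrow> f x \<in> L'))"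

definition NP_complete :: "bool list set \<Rightarrow> bool" where
  "NP_complete L \<longleftrightarrow> L \<in> NP \<and> (\<forall>L' \<in> NP. L' \<le>\<^sub>p L)"


section \<open>Grid-embedded Boolean circuits\<close>

text \<open>The two variants of signal multipliers copy the north and the west input, respectively.\<close>

datatype block =
  Conjunction | Disjunction | Crossing | Fixed_Value | Multiplier_N | Multiplier_W | Selector

text \<open>The pair \<open>(g\<^sub>E, g\<^sub>S)\<close> of outputs. The Boolean argument \<open>e\<close> only matters for selectors:
  it says whether the block is an east-selector (rather than a south-selector).\<close>

fun block_output :: "block \<Rightarrow> bool \<Rightarrow> bool \<Rightarrow> bool \<Rightarrow> bool \<times> bool" where
  "block_output Conjunction e s\<^sub>N s\<^sub>W = (s\<^sub>N \<and> s\<^sub>W, s\<^sub>N \<and> s\<^sub>W)"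
| "block_output Disjunction e s\<^sub>N s\<^sub>W = (s\<^sub>N \<or> s\<^sub>W, s\<^sub>N \<or> s\<^sub>W)"
| "block_output Crossing e s\<^sub>N s\<^sub>W = (s\<^sub>W, s\<^sub>N)"
| "block_output Fixed_Value e s\<^sub>N s\<^sub>W = (False, False)"
| "block_output Multiplier_N e s\<^sub>N s\<^sub>W = (s\<^sub>N, s\<^sub>N)"
| "block_output Multiplier_W e s\<^sub>N s\<^sub>W = (s\<^sub>W, s\<^sub>W)"
| "block_output Selector e s\<^sub>N s\<^sub>W = (e, \<not> e)"

text \<open>Only the blocks at coordinates below \<open>grid_size\<close> are meaningful.\<close>

record grid_circuit =
  grid_size :: nat
  block_at :: "nat \<Rightarrow> nat \<Rightarrow> block"

definition grid_embedded :: "grid_circuit \<Rightarrow> bool" where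
  "grid_embedded C \<longleftrightarrow>
     (\<forall>i < grid_size C. \<forall>j < grid_size C. i = 0 \<or> j = 0 \<longrightarrow> block_at C i j = Fixed_Value)"

text \<open>Truth-assignments are indexed by the cells of the selectors; the values at the other cells
  are irrelevant.\<close>

type_synonym assignment = "nat \<times> nat \<Rightarrow> bool"

text \<open>The inputs that wrap around the grid reach only cells of row or column 0, whose fixed-value
  blocks ignore them, so they are replaced by \<open>False\<close> in the recursion; see
  \<open>outputs_mod\<close> below.\<close>

fun outputs :: "grid_circuit \<Rightarrow> assignment \<Rightarrow> nat \<Rightarrow> nat \<Rightarrow> bool \<times> bool" where
  "outputs C u i j = block_output (block_at C i j) (u (i, j))
     (if i = 0 then False else snd (outputs C u (i - 1) j))
     (if j = 0 then False else fst (outputs C u i (j - 1)))"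

declare outputs.simps [simp del]

lemma outputs_mod:
  assumes "grid_embedded C" "i < grid_size C" "j < grid_size C"
  shows "outputs C u i j = block_output (block_at C i j) (u (i, j))
     (snd (outputs C u ((i + grid_size C - 1) mod grid_size C) j))
     (fst (outputs C u i ((j + grid_size C - 1) mod grid_size C)))"
proof (cases "i = 0 \<or> j = 0")
  case True
  then have "block_at C i j = Fixed_Value"
    using assms by (auto simp: grid_embedded_def)
  then show ?thesis by (simp add: outputs.simps[of C u i j])
next
  case False
  have pred_mod: "(k + grid_size C - 1) mod grid_size C = k - 1" if "k \<noteq> 0" "k < grid_size C" for k
  proof -
    have "k + grid_size C - 1 = (k - 1) + grid_size C" using that by simp
    then have "(k + grid_size C - 1) mod grid_size C = (k - 1) mod grid_size C"
      by (metis mod_add_self2)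
    also have "\<dots> = k - 1" using that by (intro mod_less) simp
    finally show ?thesis .
  qed
  show ?thesis
    using False assms pred_mod[of i] pred_mod[of j] by (simp add: outputs.simps[of C u i j])
qed

text \<open>The value of a block is its east output. For all blocks but crossings and selectors the two
  outputs agree. The east output of a selector is its truth value under the assignment; with the
  south output instead, a query for a selector would have the same answer.\<close>

definition block_value :: "grid_circuit \<Rightarrow> assignment \<Rightarrow> nat \<times> nat \<Rightarrow> bool" where
  "block_value C u v = fst (outputs C u (fst v) (snd v))"


section \<open>The decision problems\<close>

fun block_code :: "block \<Rightarrow> bool list" where
  "block_code Conjunction = [False, False, False]"
| "block_code Disjunction = [False, False, True]"
| "block_code Crossing = [False, True, False]"
| "block_code Fixed_Value = [False, True, True]"
| "block_code Multiplier_N = [True, False, False]"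
| "block_code Multiplier_W = [True, False, True]"
| "block_code Selector = [True, True, False]"

text \<open>The size of the grid and the coordinates of the queried block in unary, followed by the
  codes of the blocks row by row. Unary numbers are harmless since the code contains all
  blocks of the grid anyway.\<close>

definition instance_code :: "grid_circuit \<Rightarrow> nat \<times> nat \<Rightarrow> bool list" where
  "instance_code C v =
     replicate (grid_size C) True @ [False] @
     replicate (fst v) True @ [False] @
     replicate (snd v) True @ [False] @
     concat (map (\<lambda>(i, j). block_code (block_at C i j))
       (List.product [0..<grid_size C] [0..<grid_size C]))"

definition grid_circuit_sat_instance :: "grid_circuit \<Rightarrow> nat \<times> nat \<Rightarrow> bool" where
  "grid_circuit_sat_instance C v \<longleftrightarrow> grid_embedded C \<and> fst v < grid_size C \<and> snd v < grid_size C"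

definition Grid_Circuit_SAT :: "bool list set" where
  "Grid_Circuit_SAT = {instance_code C v | C v.
     grid_circuit_sat_instance C v \<and> (\<exists>u. block_value C u v)}"

definition restricted_circuit :: "grid_circuit \<Rightarrow> bool" where
  "restricted_circuit C \<longleftrightarrow> (\<forall>i < grid_size C. \<forall>j < grid_size C.
     block_at C i j \<in> {Conjunction, Disjunction, Fixed_Value, Selector})"

definition Restricted_Grid_Circuit_SAT :: "bool list set" where
  "Restricted_Grid_Circuit_SAT = {instance_code C v | C v.
     grid_circuit_sat_instance C v \<and> restricted_circuit C \<and> (\<exists>u. block_value C u v)}"

text \<open>The code determines the circuit and the queried block.\<close>

lemma replicate_True_append_eq:
  "replicate a True @ False # xs = replicate b True @ False # ys \<longleftrightarrow> a = b \<and> xs = ys"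
proof (induction a arbitrary: b)
  case 0
  show ?case by (cases b) auto
next
  case (Suc a)
  then show ?case by (cases b) auto
qed

lemma concat_block_codes_inject:
  assumes "concat (map (\<lambda>z. block_code (f z)) zs) = concat (map (\<lambda>z. block_code (g z)) zs)"
    and "z \<in> set zs"
  shows "f z = g z"
  using assms
proof (induction zs)
  case Nil
  then show ?case by simp
next
  case (Cons a zs)
  have len: "length (block_code b) = 3" for b by (cases b) auto
  have inj: "b = c" if "block_code b = block_code c" for b c
    using that by (cases b; cases c) auto
  from Cons.prems(1) have "block_code (f a) = block_code (g a)"
    and "concat (map (\<lambda>z. block_code (f z)) zs) = concat (map (\<lambda>z. block_code (g z)) zs)"
    by (auto simp: len)
  with Cons inj show ?case by auto
qed

lemma instance_code_inject:
  assumes "instance_code C v = instance_code C' v'"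
  shows "grid_size C = grid_size C'" "v = v'"
    and "\<And>i j. i < grid_size C \<Longrightarrow> j < grid_size C \<Longrightarrow> block_at C i j = block_at C' i j"
proof -
  let ?blocks = "\<lambda>C. concat (map (\<lambda>z. block_code (block_at C (fst z) (snd z)))
       (List.product [0..<grid_size C] [0..<grid_size C]))"
  have eqs: "grid_size C = grid_size C' \<and> fst v = fst v' \<and> snd v = snd v' \<and> ?blocks C = ?blocks C'"
    using assms by (auto simp add: instance_code_def replicate_True_append_eq case_prod_unfold)
  then show d: "grid_size C = grid_size C'" and "v = v'" by (auto simp: prod_eq_iff)
  show "block_at C i j = block_at C' i j" if "i < grid_size C" "j < grid_size C" for i j
    using concat_block_codes_inject[of "\<lambda>z. block_at C (fst z) (snd z)"
        "List.product [0..<grid_size C] [0..<grid_size C]" "\<lambda>z. block_at C' (fst z) (snd z)" "(i, j)"]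
      eqs that unfolding d by auto
qed

end

theory Submission
  imports Defs "HOL-Library.Countable"
begin

text \<open>
  Membership: a certificate lists the outputs of all cells, so that only local conditions remain
  to be checked. Both these conditions and the bits of the instance that hardness requires are
  given by functions that are built with a bounded sum from addition, truncated subtraction and
  access to the input word. Such a function can be evaluated by nested counting loops, in
  polynomial time when numbers are kept in unary.

  Hardness: the computation of a verifier on an unknown certificate is described by clauses. All
  but those for the certificate and the acceptance condition are Horn clauses, hence they force the
  facts that hold for the actual computation, and the facts of an accepting computation satisfy
  everything. A formula becomes a grid in which the rows carry literals and the columns carry the
  disjunctions of clauses. Rows must cross columns without crossing blocks: selectors guess the two
  outgoing signals, and a monotone planar check makes sure that no outgoing signal exceeds the
  incoming one. As the grid is monotone in the outputs of its selectors, wrong guesses do no harm.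
\<close>

section \<open>Programs on counters\<close>

text \<open>The restricted blocks offer neither a crossing nor a negation nor a plain wire, and
  their only constant is 0. Wires and branchings are disjunctions whose other input is 0. A selector
  is the only source of a 1 and of complementary signals, but it ignores its inputs: it cannot copy
  a signal, only guess it. What saves the construction is that satisfiability needs correctness in
  one direction for all guesses (a signal may get lost, but none may arise) and exactness for one
  choice of guesses only. The one-sided condition involves a guess and its complement, and the
  complement is at hand as the other output of the selector. On the side of running times, verifier
  and reduction are instances of one statement: a word whose length and bits are elementary
  functions of the input is computable in polynomial time. This is why codes, facts and clauses are
  all addressed by arithmetic on positions and digits, and why an arbitrary machine enters the
  reduction only through finite tables.\<close>

datatype instr =
    Act nat "nat option" move
  | Branch nat "nat set" nat
  | Back nat
  | Forward nat

text \<open>Tapes are indexed by all naturals, so that code can name fresh ones without a global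
  bound; \<open>tm_of\<close> cuts off at \<open>L\<close>. Forward jumps are clipped to
  \<open>length c\<close>, which will be the halting state, so validity of the machine puts no
  condition on jump distances.\<close>

fun exec :: "instr list \<Rightarrow> nat \<times> (nat \<Rightarrow> tape) \<Rightarrow> nat \<times>
    (nat \<Rightarrow> tape)" where
  "exec c (q, T) = (if q < length c then
     (case c ! q of
        Act j w m \<Rightarrow> (Suc q, T(j := act (case w of None \<Rightarrow> scanned (T j) | Some a
            \<Rightarrow> a, m) (T j)))
      | Branch j A n \<Rightarrow> (if scanned (T j) \<in> A then Suc q else min (q + n) (length c), T)
      | Back n \<Rightarrow> (q - n, T)
      | Forward n \<Rightarrow> (min (q + n) (length c), T))
     else (q, T))"

declare exec.simps [simp del]

section \<open>From programs to Turing machines\<close>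

fun wf_instr :: "nat \<Rightarrow> instr \<Rightarrow> bool" where
  "wf_instr L (Act j w m) \<longleftrightarrow> j < L \<and> (\<forall>a \<in> set_option w. a < 3)"
| "wf_instr L (Branch j A n) \<longleftrightarrow> j < L"
| "wf_instr L (Back n) \<longleftrightarrow> True"
| "wf_instr L (Forward n) \<longleftrightarrow> True"

lemma wf_instr_mono: "wf_instr L i \<Longrightarrow> L \<le> L' \<Longrightarrow> wf_instr L' i"
  by (cases i) auto

text \<open>The program counter is the state, so running off the end of the program is halting.
  Three symbols suffice: the blank and the two bit symbols, of which 1 is also the mark used by
  counters.\<close>

definition tm_of :: "instr list \<Rightarrow> nat \<Rightarrow> tm" where
  "tm_of c L = \<lparr>num_tapes = L, num_states = length c, num_symbols = 3,
     trans = (\<lambda>q xs. case c ! q of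
        Act j w m \<Rightarrow> (Suc q, map (\<lambda>i. if i = j
            then (case w of None \<Rightarrow> xs ! i | Some a \<Rightarrow> a, m) else (xs ! i, Stay))
                [0..<L])
      | Branch j A n \<Rightarrow> (if xs ! j \<in> A then Suc q else min (q + n) (length c),
          map (\<lambda>i. (xs ! i, Stay)) [0..<L])
      | Back n \<Rightarrow> (q - n, map (\<lambda>i. (xs ! i, Stay)) [0..<L])
      | Forward n \<Rightarrow> (min (q + n) (length c), map (\<lambda>i. (xs ! i, Stay)) [0..<L]))\<rparr>"

lemma valid_tm_of:
  assumes "\<forall>i \<in> set c. wf_instr L i" "L \<ge> 1"
  shows "valid_tm (tm_of c L)"
proof -
  have "fst (trans (tm_of c L) q xs) \<le> length c \<and> length (snd (trans (tm_of c L) q xs)) = L \<and>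
        fst ` set (snd (trans (tm_of c L) q xs)) \<subseteq> {..<3}"
    if q: "q < length c" and xs: "length xs = L" "set xs \<subseteq> {..<3}" for q xs
  proof -
    have wf: "wf_instr L (c ! q)" using assms q by simp
    have nth: "xs ! i < 3" if "i < L" for i
      using xs that by (metis lessThan_iff nth_mem subsetD)
    show ?thesis
      using wf q nth by (cases "c ! q") (auto simp: tm_of_def split: option.splits)
  qed
  then show ?thesis using assms by (simp add: valid_tm_def) (simp add: tm_of_def)
qed

lemma act_scanned_Stay [simp]: "act (scanned t, Stay) t = t"
  by (cases t) auto

lemma step_tm_of:
  assumes "\<forall>i \<in> set c. wf_instr L i"
  shows "step (tm_of c L) (q, map T [0..<L]) =
    (fst (exec c (q, T)), map (snd (exec c (q, T))) [0..<L])"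
proof (cases "q < length c")
  case True
  have wf: "wf_instr L (c ! q)" using assms True by simp
  show ?thesis
    using wf True
    by (cases "c ! q") (auto simp: step_def tm_of_def exec.simps intro!: nth_equalityI split: option.splits)
next
  case False
  then show ?thesis by (simp add: step_def tm_of_def exec.simps)
qed

lemma steps_tm_of:
  assumes "\<forall>i \<in> set c. wf_instr L i"
  shows "(step (tm_of c L) ^^ n) (q, map T [0..<L]) =
    (fst ((exec c ^^ n) (q, T)), map (snd ((exec c ^^ n) (q, T))) [0..<L])"
  by (induction n) (simp_all add: step_tm_of[OF assms])

text \<open>Jumps are relative, so that a piece of code can be run at every place of a larger
    program.\<close>

definition runs :: "instr list \<Rightarrow> (nat \<Rightarrow> tape) \<Rightarrow> nat \<Rightarrow>
    (nat \<Rightarrow> tape) \<Rightarrow> bool" where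
  "runs c T n T' \<longleftrightarrow> (\<forall>pre post.
     (exec (pre @ c @ post) ^^ n) (length pre, T) = (length pre + length c, T'))"

lemma runs_Nil [simp]: "runs [] T 0 T"
  by (simp add: runs_def)

lemma runs_append:
  assumes "runs c T n T'" "runs d T' m T''"
  shows "runs (c @ d) T (n + m) T''"
  unfolding runs_def
proof (intro allI)
  fix pre post
  have "(exec (pre @ c @ d @ post) ^^ n) (length pre, T) = (length pre + length c, T')"
    using assms(1) unfolding runs_def by blast
  moreover have "(exec ((pre @ c) @ d @ post) ^^ m) (length (pre @ c), T') =
      (length (pre @ c) + length d, T'')"
    using assms(2) unfolding runs_def by blast
  ultimately show "(exec (pre @ (c @ d) @ post) ^^ (n + m)) (length pre, T) =
      (length pre + length (c @ d), T'')"
    by (simp add: add.commute[of n] funpow_add)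
qed

lemma runs_Act:
  "runs [Act j w m] T 1 (T(j := act (case w of None \<Rightarrow> scanned (T j) | Some a \<Rightarrow>
      a, m) (T j)))"
  by (simp add: runs_def exec.simps)

text \<open>The exit distance skips the body and the closing \<open>Back\<close>, whose own distance
  leads to the \<open>Branch\<close> again. A round costs these two steps beyond its body.\<close>

definition loop :: "nat \<Rightarrow> nat set \<Rightarrow> instr list \<Rightarrow> instr list" where
  "loop j A c = [Branch j A (length c + 2)] @ c @ [Back (length c + 1)]"

lemma runs_loop_exit: "scanned (T j) \<notin> A \<Longrightarrow> runs (loop j A c) T 1 T"
  by (simp add: runs_def exec.simps loop_def)

lemma runs_loop:
  assumes "scanned (T j) \<in> A" "runs c T n T'" "runs (loop j A c) T' m T''"
  shows "runs (loop j A c) T (n + m + 2) T''"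
  unfolding runs_def
proof (intro allI)
  fix pre post
  let ?P = "pre @ loop j A c @ post"
  have 1: "exec ?P (length pre, T) = (Suc (length pre), T)"
    using assms(1) by (simp add: exec.simps loop_def)
  have "(exec ((pre @ [Branch j A (length c + 2)]) @ c @ ([Back (length c + 1)] @ post)) ^^ n)
      (length (pre @ [Branch j A (length c + 2)]), T) =
      (length (pre @ [Branch j A (length c + 2)]) + length c, T')"
    using assms(2) unfolding runs_def by blast
  then have 2: "(exec ?P ^^ n) (Suc (length pre), T) = (Suc (length pre + length c), T')"
    by (simp add: loop_def)
  have 3: "exec ?P (Suc (length pre + length c), T') = (length pre, T')"
    by (simp add: exec.simps loop_def nth_append)
  have 4: "(exec ?P ^^ m) (length pre, T') = (length pre + length (loop j A c), T'')"
    using assms(3) unfolding runs_def by blast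
  have "n + m + 2 = m + Suc (n + Suc 0)" by simp
  then have "(exec ?P ^^ (n + m + 2)) (length pre, T) =
     (exec ?P ^^ m) (exec ?P ((exec ?P ^^ n) (exec ?P (length pre, T))))"
    by (simp only: funpow_add funpow.simps o_apply id_apply)
  then show "(exec ?P ^^ (n + m + 2)) (length pre, T) = (length pre + length (loop j A c), T'')"
    by (simp only: 1 2 3 4)
qed

definition cond :: "nat \<Rightarrow> nat set \<Rightarrow> instr list \<Rightarrow> instr list
    \<Rightarrow> instr list" where
  "cond j A c d = [Branch j A (length c + 2)] @ c @ [Forward (length d + 1)] @ d"

lemma runs_cond_True:
  assumes "scanned (T j) \<in> A" "runs c T n T'"
  shows "runs (cond j A c d) T (n + 2) T'"
  unfolding runs_def
proof (intro allI)
  fix pre post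
  let ?P = "pre @ cond j A c d @ post"
  have 1: "exec ?P (length pre, T) = (Suc (length pre), T)"
    using assms(1) by (simp add: exec.simps cond_def)
  have "(exec ((pre @ [Branch j A (length c + 2)]) @ c @ ([Forward (length d + 1)] @ d @ post)) ^^ n)
      (length (pre @ [Branch j A (length c + 2)]), T) =
      (length (pre @ [Branch j A (length c + 2)]) + length c, T')"
    using assms(2) unfolding runs_def by blast
  then have 2: "(exec ?P ^^ n) (Suc (length pre), T) = (Suc (length pre + length c), T')"
    by (simp add: cond_def)
  have 3: "exec ?P (Suc (length pre + length c), T') = (length pre + length (cond j A c d), T')"
    by (simp add: exec.simps cond_def nth_append)
  have "n + 2 = Suc (n + Suc 0)" by simp
  then have "(exec ?P ^^ (n + 2)) (length pre, T) =
     exec ?P ((exec ?P ^^ n) (exec ?P (length pre, T)))"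
    by (simp only: funpow_add funpow.simps o_apply id_apply)
  then show "(exec ?P ^^ (n + 2)) (length pre, T) = (length pre + length (cond j A c d), T')"
    by (simp only: 1 2 3)
qed

lemma runs_cond_False:
  assumes "scanned (T j) \<notin> A" "runs d T n T'"
  shows "runs (cond j A c d) T (n + 1) T'"
  unfolding runs_def
proof (intro allI)
  fix pre post
  let ?P = "pre @ cond j A c d @ post" and ?b = "[Branch j A (length c + 2)] @ c @ [Forward (length d + 1)]"
  have 1: "exec ?P (length pre, T) = (length pre + length ?b, T)"
    using assms(1) by (simp add: exec.simps cond_def)
  have "(exec ((pre @ ?b) @ d @ post) ^^ n) (length (pre @ ?b), T) = (length (pre @ ?b) + length d, T')"
    using assms(2) unfolding runs_def by blast
  then have 2: "(exec ?P ^^ n) (length pre + length ?b, T) = (length pre + length (cond j A c d), T')"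
    by (simp add: cond_def)
  have "(exec ?P ^^ (n + Suc 0)) (length pre, T) = (exec ?P ^^ n) (exec ?P (length pre, T))"
    by (simp only: funpow_add funpow.simps o_apply id_apply)
  then show "(exec ?P ^^ (n + 1)) (length pre, T) = (length pre + length (cond j A c d), T')"
    using 2 by (simp only: 1 One_nat_def)
qed

text \<open>A counter is a tape with a block of ones at the positions from 1 up to the head, so that the
  scanned symbol tells whether it is zero.\<close>

definition ctr :: "nat \<Rightarrow> tape" where
  "ctr n = (\<lambda>p. if 1 \<le> p \<and> p \<le> int n then 1 else 0, int n)"

lemma scanned_ctr [simp]: "scanned (ctr n) = (if n = 0 then 0 else 1)"
  by (simp add: ctr_def)

section \<open>Counters and counting loops\<close>

definition incr :: "nat \<Rightarrow> instr list" where
  "incr j = [Act j None Move_Right, Act j (Some 1) Stay]"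

definition decr :: "nat \<Rightarrow> instr list" where
  "decr j = [Act j (Some 0) Move_Left]"

lemma runs_inc: "T j = ctr n \<Longrightarrow> runs (incr j) T 2 (T(j := ctr (Suc n)))"
proof -
  assume j: "T j = ctr n"
  have "T(j := ctr (Suc n)) = (T(j := act (scanned (T j), Move_Right) (T j)))
      (j := act (1, Stay) (act (scanned (T j), Move_Right) (T j)))"
    by (auto simp: j ctr_def fun_eq_iff)
  then show ?thesis
    using runs_append[OF runs_Act[of j None Move_Right T] runs_Act[of j "Some 1" Stay]]
    by (simp add: incr_def numeral_2_eq_2 del: scanned_ctr)
qed

lemma runs_dec: "T j = ctr (Suc n) \<Longrightarrow> runs (decr j) T 1 (T(j := ctr n))"
proof -
  assume j: "T j = ctr (Suc n)"
  have "T(j := ctr n) = T(j := act (0, Move_Left) (T j))"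
    by (auto simp: j ctr_def fun_eq_iff)
  then show ?thesis
    using runs_Act[of j "Some 0" Move_Left T] by (simp add: decr_def)
qed

text \<open>\<open>S i\<close> describes all tapes after \<open>i\<close> rounds. The induction
  descends from the exit, because \<open>runs_loop\<close> adds a round in front of a run of the
  loop.\<close>

lemma runs_while:
  assumes enter: "\<And>i. i < n \<Longrightarrow> scanned (S i j) \<in> A" and exit: "scanned (S n j)
      \<notin> A"
    and body: "\<And>i. i < n \<Longrightarrow> \<exists>t \<le> B. runs c (S i) t (S (Suc i))"
  shows "\<exists>t \<le> n * (B + 2) + 1. runs (loop j A c) (S 0) t (S n)"
proof -
  have "\<exists>t \<le> (n - i) * (B + 2) + 1. runs (loop j A c) (S i) t (S n)" if "i \<le> n" for i
    using that
  proof (induction rule: inc_induct)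
    case base
    have "runs (loop j A c) (S n) 1 (S n)"
      by (rule runs_loop_exit) (rule exit)
    then show ?case by auto
  next
    case (step i)
    obtain t where t: "t \<le> B" "runs c (S i) t (S (Suc i))"
      using body step by blast
    obtain t' where t': "t' \<le> (n - Suc i) * (B + 2) + 1" "runs (loop j A c) (S (Suc i)) t' (S n)"
      using step by blast
    have "runs (loop j A c) (S i) (t + t' + 2) (S n)"
      using step enter by (intro runs_loop[OF _ t(2) t'(2)]) simp
    moreover have "t + t' + 2 \<le> (n - i) * (B + 2) + 1"
    proof -
      have "n - i = Suc (n - Suc i)" using step by simp
      then have "(n - i) * (B + 2) = (n - Suc i) * (B + 2) + B + 2" by simp
      then show ?thesis using t(1) t'(1) by linarith
    qed
    ultimately show ?case by blast
  qed
  from this[of 0] show ?thesis by simp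
qed

text \<open>The decrement comes before the body, hence the body starts with \<open>n - Suc i\<close>
  in the counter and has to preserve it.\<close>

lemma runs_for:
  assumes ctr: "\<And>i. i \<le> n \<Longrightarrow> S i j = ctr (n - i)"
    and body: "\<And>i. i < n \<Longrightarrow> \<exists>t \<le> B. runs c ((S i)(j := ctr (n - Suc
        i))) t (S (Suc i))"
  shows "\<exists>t \<le> n * (B + 3) + 1. runs (loop j {1} (decr j @ c)) (S 0) t (S n)"
proof -
  have "\<exists>t \<le> n * (Suc B + 2) + 1. runs (loop j {1} (decr j @ c)) (S 0) t (S n)"
  proof (rule runs_while)
    fix i assume i: "i < n"
    then obtain t where t: "t \<le> B" "runs c ((S i)(j := ctr (n - Suc i))) t (S (Suc i))"
      using body by blast
    have "S i j = ctr (Suc (n - Suc i))" using ctr[of i] i by (simp add: Suc_diff_Suc)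
    from runs_append[OF runs_dec[of "S i", OF this] t(2)] t(1)
    show "\<exists>t \<le> Suc B. runs (decr j @ c) (S i) t (S (Suc i))" by force
  qed (simp_all add: ctr)
  then show ?thesis by (simp add: numeral_3_eq_3)
qed

section \<open>Elementary functions of words and counters\<close>

type_synonym state = "bool list \<times> (nat \<Rightarrow> nat)"

definition push :: "nat \<Rightarrow> state \<Rightarrow> state" where
  "push i s = (fst s, case_nat i (snd s))"

text \<open>The variables of a function are de Bruijn indices into the second component of the state; the
  bounded sum binds variable 0.\<close>

inductive elem_fun :: "(state \<Rightarrow> nat) \<Rightarrow> bool" where
  Var: "elem_fun (\<lambda>s. snd s n)"
| One: "elem_fun (\<lambda>s. 1)"
| Len: "elem_fun (\<lambda>s. length (fst s))"
| Bit: "elem_fun f \<Longrightarrow> elem_fun (\<lambda>s. of_bool (f s < length (fst s) \<and> fst s !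
    f s))"
| Add: "elem_fun f \<Longrightarrow> elem_fun g \<Longrightarrow> elem_fun (\<lambda>s. f s + g s)"
| Diff: "elem_fun f \<Longrightarrow> elem_fun g \<Longrightarrow> elem_fun (\<lambda>s. f s - g s)"
| Sum: "elem_fun f \<Longrightarrow> elem_fun g \<Longrightarrow> elem_fun (\<lambda>s. \<Sum>i<f s. g
    (push i s))"

lemma poly_mono_nat: "m \<le> n \<Longrightarrow> poly p m \<le> poly p n" for p :: "nat poly"
  by (induction p) (auto intro!: add_mono mult_mono)

text \<open>The code adds the value to a counter; registers are tapes, \<open>r\<close> assigns them to
    the variables,
  and those from \<open>k\<close> on are free for auxiliary use. The polynomial bounds value and
      time.\<close>

definition adds :: "nat \<Rightarrow> nat \<Rightarrow> (nat \<Rightarrow> nat) \<Rightarrow> nat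
    \<Rightarrow> nat poly \<Rightarrow> (state \<Rightarrow> nat) \<Rightarrow> instr list
    \<Rightarrow> bool" where
  "adds k K r dst p f c \<longleftrightarrow> (\<forall>i \<in> set c. wf_instr (k + K) i) \<and>
     (\<forall>x \<rho> m T v. T 0 = (word_tape x, 0) \<longrightarrow> length x \<le> m
         \<longrightarrow> (\<forall>n. \<rho> n \<le> m) \<longrightarrow>
        (\<forall>n. T (r n) = ctr (\<rho> n)) \<longrightarrow> T dst = ctr v \<longrightarrow>
            (\<forall>j. k \<le> j \<and> j < k + K \<longrightarrow> T j = ctr 0) \<longrightarrow>
        (\<exists>t \<le> poly p m. runs c T t (T(dst := ctr (v + f (x, \<rho>))))))"

text \<open>The quantification over \<open>k\<close>, \<open>dst\<close> and \<open>r\<close> allows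
  the code to be placed in any register layout, as the induction over \<open>elem_fun\<close>
  requires; \<open>K\<close> and \<open>p\<close> are the same for all layouts. Tape 0 is kept for
  the input, and \<open>dst\<close> differs from the variables so that they survive. The bound on
  values is carried along because values become numbers of rounds.\<close>

definition evaluable :: "nat \<Rightarrow> nat poly \<Rightarrow> (state \<Rightarrow> nat)
    \<Rightarrow> bool" where
  "evaluable K p f \<longleftrightarrow> (\<forall>x \<rho> m. length x \<le> m \<longrightarrow>
      (\<forall>n. \<rho> n \<le> m) \<longrightarrow> f (x, \<rho>) \<le> poly p m) \<and>
     (\<forall>k dst r. 0 < dst \<and> dst < k \<and> (\<forall>n. 0 < r n \<and> r n < k \<and> r n
         \<noteq> dst) \<longrightarrow> (\<exists>c. adds k K r dst p f c))"

lemma evaluable_le: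
  "evaluable K p f \<Longrightarrow> length x \<le> m \<Longrightarrow> (\<And>n. \<rho> n \<le> m)
      \<Longrightarrow> f (x, \<rho>) \<le> poly p m"
  by (simp add: evaluable_def)

lemma evaluable_code:
  assumes "evaluable K p f" "0 < dst" "dst < k" "\<And>n. 0 < r n \<and> r n < k \<and> r n \<noteq> dst"
  obtains c where "adds k K r dst p f c"
  using assms unfolding evaluable_def by blast

lemma evaluableI:
  assumes "\<And>x \<rho> m. length x \<le> m \<Longrightarrow> (\<And>n. \<rho> n \<le> m)
      \<Longrightarrow> f (x, \<rho>) \<le> poly p m"
    and "\<And>k dst r. 0 < dst \<Longrightarrow> dst < k \<Longrightarrow> (\<And>n. 0 < r n)
        \<Longrightarrow> (\<And>n. r n < k) \<Longrightarrow> (\<And>n. r n \<noteq> dst) \<Longrightarrow>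
      \<exists>c. adds k K r dst p f c"
  shows "evaluable K p f"
  using assms unfolding evaluable_def by simp

lemma addsI:
  assumes "\<forall>i \<in> set c. wf_instr (k + K) i"
    and "\<And>x \<rho> m T v. T 0 = (word_tape x, 0) \<Longrightarrow> length x \<le> m
        \<Longrightarrow> (\<And>n. \<rho> n \<le> m) \<Longrightarrow>
        (\<And>n. T (r n) = ctr (\<rho> n)) \<Longrightarrow> T dst = ctr v \<Longrightarrow> (\<And>j.
            k \<le> j \<Longrightarrow> j < k + K \<Longrightarrow> T j = ctr 0) \<Longrightarrow>
        \<exists>t \<le> poly p m. runs c T t (T(dst := ctr (v + f (x, \<rho>))))"
  shows "adds k K r dst p f c"
  using assms unfolding adds_def by simp

lemma adds_wf: "adds k K r dst p f c \<Longrightarrow> k + K \<le> L \<Longrightarrow> i \<in> set c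
    \<Longrightarrow> wf_instr L i"
  unfolding adds_def using wf_instr_mono by blast

lemma addsD:
  assumes "adds k K r dst p f c" "T 0 = (word_tape x, 0)" "length x \<le> m" "\<And>n. \<rho> n \<le> m"
    "\<And>n. T (r n) = ctr (\<rho> n)" "T dst = ctr v" "\<And>j. k \<le> j \<Longrightarrow> j < k + K
        \<Longrightarrow> T j = ctr 0"
  obtains t where "t \<le> poly p m" "runs c T t (T(dst := ctr (v + f (x, \<rho>))))"
  using assms unfolding adds_def by blast

lemma wf_simps [simp]:
  "wf_instr L (Act j None m) \<longleftrightarrow> j < L"
  "(\<forall>i \<in> set (incr j). wf_instr L i) \<longleftrightarrow> j < L"
  "(\<forall>i \<in> set (decr j). wf_instr L i) \<longleftrightarrow> j < L"
  "(\<forall>i \<in> set (loop j A c). wf_instr L i) \<longleftrightarrow> j < L \<and> (\<forall>i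
      \<in> set c. wf_instr L i)"
  "(\<forall>i \<in> set (cond j A c d). wf_instr L i) \<longleftrightarrow>
     j < L \<and> (\<forall>i \<in> set c. wf_instr L i) \<and> (\<forall>i \<in> set d. wf_instr L i)"
  by (auto simp: incr_def decr_def loop_def cond_def)

lemma runs_inc': "T j = ctr n \<Longrightarrow> T' = T(j := ctr (Suc n)) \<Longrightarrow> runs (incr
    j) T 2 T'"
  using runs_inc by simp

section \<open>Code for each constructor of elementary functions\<close>

lemma runs_clear:
  assumes "T j = ctr n"
  shows "\<exists>t \<le> n * 3 + 1. runs (loop j {1} (decr j)) T t (T(j := ctr 0))"
proof -
  define S where "S i = T(j := ctr (n - i))" for i
  have "\<exists>t \<le> n * (0 + 3) + 1. runs (loop j {1} (decr j @ [])) (S 0) t (S n)"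
  proof (rule runs_for)
    show "\<exists>t\<le>0. runs [] ((S i)(j := ctr (n - Suc i))) t (S (Suc i))" for i
      by (rule exI[of _ 0]) (simp add: S_def)
  qed (simp add: S_def)
  then show ?thesis using assms by (simp add: S_def fun_upd_idem)
qed

lemma runs_move:
  assumes "T j = ctr n" "T k = ctr v" "j \<noteq> k"
  shows "\<exists>t \<le> n * 5 + 1. runs (loop j {1} (decr j @ incr k)) T t (T(j := ctr 0, k := ctr (v
      + n)))"
proof -
  define S where "S i = T(j := ctr (n - i), k := ctr (v + i))" for i
  have "\<exists>t \<le> n * (2 + 3) + 1. runs (loop j {1} (decr j @ incr k)) (S 0) t (S n)"
  proof (rule runs_for)
    show "\<exists>t\<le>2. runs (incr k) ((S i)(j := ctr (n - Suc i))) t (S (Suc i))" for i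
      using assms by (intro exI[of _ 2] conjI runs_inc'[of _ _ "v + i"])
        (auto simp: S_def fun_eq_iff)
  qed (use assms in \<open>simp add: S_def\<close>)
  moreover have "S 0 = T" using assms by (auto simp: S_def fun_eq_iff)
  ultimately show ?thesis by (simp add: S_def)
qed

lemma runs_move2:
  assumes "T j = ctr n" "T k = ctr v" "T l = ctr w" "j \<noteq> k" "j \<noteq> l" "k \<noteq> l"
  shows "\<exists>t \<le> n * 7 + 1. runs (loop j {1} (decr j @ incr k @ incr l)) T t
    (T(j := ctr 0, k := ctr (v + n), l := ctr (w + n)))"
proof -
  define S where "S i = T(j := ctr (n - i), k := ctr (v + i), l := ctr (w + i))" for i
  have "\<exists>t \<le> n * (4 + 3) + 1. runs (loop j {1} (decr j @ incr k @ incr l)) (S 0) t (S n)"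
  proof (rule runs_for)
    fix i
    let ?T = "(S i)(j := ctr (n - Suc i))"
    have "runs (incr k @ incr l) ?T (2 + 2) (S (Suc i))"
      using assms by (intro runs_append[of _ _ _ "?T(k := ctr (v + Suc i))"]
          runs_inc'[of _ _ "v + i"] runs_inc'[of _ _ "w + i"])
        (auto simp: S_def fun_eq_iff)
    then show "\<exists>t\<le>4. runs (incr k @ incr l) ?T t (S (Suc i))" by fastforce
  qed (use assms in \<open>simp add: S_def\<close>)
  moreover have "S 0 = T" using assms by (auto simp: S_def fun_eq_iff)
  ultimately show ?thesis by (simp add: S_def)
qed

text \<open>A loop that reads a counter empties it. So the value goes to the target and to a scratch
  counter at once, and the scratch counter then restores the variable; the two loops take at most
  \<open>7 * m + 1\<close> and \<open>5 * m + 1\<close> steps.\<close>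

lemma evaluable_Var: "evaluable 1 [:2, 12:] (\<lambda>s. snd s n)"
proof (rule evaluableI)
  fix x :: "bool list" and \<rho> :: "nat \<Rightarrow> nat" and m
  assume "\<And>n. \<rho> n \<le> m"
  from this[of n] show "snd (x, \<rho>) n \<le> poly [:2, 12:] m" by simp
next
  fix k dst :: nat and r :: "nat \<Rightarrow> nat"
  assume r: "0 < dst" "dst < k" "\<And>n. 0 < r n" "\<And>n. r n < k" "\<And>n. r n \<noteq> dst"
  let ?c = "loop (r n) {1} (decr (r n) @ incr k @ incr dst) @ loop k {1} (decr k @ incr (r n))"
  have "adds k 1 r dst [:2, 12:] (\<lambda>s. snd s n) ?c"
  proof (rule addsI)
    show "\<forall>i\<in>set ?c. wf_instr (k + 1) i"
      using r by (simp add: ball_Un less_Suc_eq)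
  next
    fix x \<rho> m and T :: "nat \<Rightarrow> tape" and v
    assume T: "\<And>n. \<rho> n \<le> m" "\<And>n. T (r n) = ctr (\<rho> n)" "T dst = ctr v"
      "\<And>j. k \<le> j \<Longrightarrow> j < k + 1 \<Longrightarrow> T j = ctr 0"
    have k: "T k = ctr 0" "k \<noteq> dst" "r n \<noteq> k" using r(2) r(4)[of n] T(4)[of k] by auto
    let ?T = "T(r n := ctr 0, k := ctr (\<rho> n), dst := ctr (v + \<rho> n))"
    obtain t where t: "t \<le> \<rho> n * 7 + 1" "runs (loop (r n) {1} (decr (r n) @ incr k @ incr
        dst)) T t ?T"
      using runs_move2[of T "r n" "\<rho> n" k 0 dst v] T r k by auto
    obtain t' where t': "t' \<le> \<rho> n * 5 + 1" "runs (loop k {1} (decr k @ incr (r n))) ?T t'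
       (?T(k := ctr 0, r n := ctr (0 + \<rho> n)))"
      using runs_move[of ?T k "\<rho> n" "r n" 0] T r k by auto
    have "?T(k := ctr 0, r n := ctr (0 + \<rho> n)) = T(dst := ctr (v + \<rho> n))"
      using T r k by (auto simp: fun_eq_iff)
    with runs_append[OF t(2) t'(2)] have "runs ?c T (t + t') (T(dst := ctr (v + snd (x, \<rho>) n)))"
      by simp
    moreover have "t + t' \<le> poly [:2, 12:] m" using t(1) t'(1) T(1)[of n] by simp
    ultimately show "\<exists>t\<le>poly [:2, 12:] m. runs ?c T t (T(dst := ctr (v + snd (x, \<rho>)
        n)))" by blast
  qed
  then show "\<exists>c. adds k 1 r dst [:2, 12:] (\<lambda>s. snd s n) c" by blast
qed

lemma evaluable_One: "evaluable 0 [:2:] (\<lambda>s. 1)"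
proof (rule evaluableI)
  fix k dst :: nat and r :: "nat \<Rightarrow> nat"
  assume "0 < dst" "dst < k"
  then have "adds k 0 r dst [:2:] (\<lambda>s. 1) (incr dst)"
    using runs_inc by (intro addsI) auto
  then show "\<exists>c. adds k 0 r dst [:2:] (\<lambda>s. 1) c" by blast
qed simp

lemma evaluable_Add:
  assumes f: "evaluable K1 p1 f" and g: "evaluable K2 p2 g"
  shows "evaluable (K1 + K2) (p1 + p2) (\<lambda>s. f s + g s)"
proof (rule evaluableI)
  show "length x \<le> m \<Longrightarrow> (\<And>n. \<rho> n \<le> m) \<Longrightarrow> f (x, \<rho>)
      + g (x, \<rho>) \<le> poly (p1 + p2) m" for x \<rho> m
    using evaluable_le[OF f, of x m \<rho>] evaluable_le[OF g, of x m \<rho>] by simp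
next
  fix k dst :: nat and r :: "nat \<Rightarrow> nat"
  assume r: "0 < dst" "dst < k" "\<And>n. 0 < r n" "\<And>n. r n < k" "\<And>n. r n \<noteq> dst"
  obtain c where c: "adds k K1 r dst p1 f c" using evaluable_code[OF f] r by metis
  obtain d where d: "adds k K2 r dst p2 g d" using evaluable_code[OF g] r by metis
  have "adds k (K1 + K2) r dst (p1 + p2) (\<lambda>s. f s + g s) (c @ d)"
  proof (rule addsI)
    show "\<forall>i\<in>set (c @ d). wf_instr (k + (K1 + K2)) i"
      using adds_wf[OF c, of "k + (K1 + K2)"] adds_wf[OF d, of "k + (K1 + K2)"] by auto
    fix x \<rho> m and T :: "nat \<Rightarrow> tape" and v
    assume T: "T 0 = (word_tape x, 0)" "length x \<le> m" "\<And>n. \<rho> n \<le> m" "\<And>n. T (r n)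
        = ctr (\<rho> n)"
      "T dst = ctr v" "\<And>j. k \<le> j \<Longrightarrow> j < k + (K1 + K2) \<Longrightarrow> T j = ctr 0"
    let ?T = "T(dst := ctr (v + f (x, \<rho>)))"
    obtain t where t: "t \<le> poly p1 m" "runs c T t ?T"
      using addsD[OF c, of T x m \<rho> v] T by auto
    obtain t' where t': "t' \<le> poly p2 m" "runs d ?T t' (?T(dst := ctr (v + f (x, \<rho>) + g (x,
        \<rho>))))"
      using addsD[OF d, of ?T x m \<rho> "v + f (x, \<rho>)"] T r by auto
    from runs_append[OF t(2) t'(2)] t(1) t'(1)
    show "\<exists>t\<le>poly (p1 + p2) m. runs (c @ d) T t (T(dst := ctr (v + (f (x, \<rho>) + g (x,
        \<rho>)))))"
      by (intro exI[of _ "t + t'"]) (simp add: add.assoc)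
  qed
  then show "\<exists>c. adds k (K1 + K2) r dst (p1 + p2) (\<lambda>s. f s + g s) c" by blast
qed

text \<open>Both values go to scratch counters. Each unit of the second removes a unit of the first
  as long as there is one, which is truncated subtraction.\<close>

lemma evaluable_Diff:
  assumes f: "evaluable K1 p1 f" and g: "evaluable K2 p2 g"
  shows "evaluable (2 + K1 + K2) (smult 6 p1 + smult 7 p2 + [:2:]) (\<lambda>s. f s - g s)"
    (is "evaluable ?K ?p _")
proof (rule evaluableI)
  show "length x \<le> m \<Longrightarrow> (\<And>n. \<rho> n \<le> m) \<Longrightarrow> f (x, \<rho>)
      - g (x, \<rho>) \<le> poly ?p m" for x \<rho> m
    using evaluable_le[OF f, of x m \<rho>] by simp
next
  fix k dst :: nat and r :: "nat \<Rightarrow> nat"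
  assume r: "0 < dst" "dst < k" "\<And>n. 0 < r n" "\<And>n. r n < k" "\<And>n. r n \<noteq> dst"
  have r2: "r n < k + 2" "r n \<noteq> k" "r n \<noteq> Suc k" for n using r(4)[of n] by auto
  obtain c where c: "adds (k + 2) K1 r k p1 f c"
    using evaluable_code[OF f, of k "k + 2" r] r r2 by auto
  obtain d where d: "adds (k + 2) K2 r (k + 1) p2 g d"
    using evaluable_code[OF g, of "k + 1" "k + 2" r] r r2 by auto
  let ?l = "loop (k + 1) {1} (decr (k + 1) @ cond k {1} (decr k) [])"
  let ?c = "c @ d @ ?l @ loop k {1} (decr k @ incr dst)"
  have "adds k ?K r dst ?p (\<lambda>s. f s - g s) ?c"
  proof (rule addsI)
    show "\<forall>i\<in>set ?c. wf_instr (k + ?K) i"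
      using adds_wf[OF c, of "k + ?K"] adds_wf[OF d, of "k + ?K"] r by (simp add: ball_Un)
    fix x \<rho> m and T :: "nat \<Rightarrow> tape" and v
    assume T: "T 0 = (word_tape x, 0)" "length x \<le> m" "\<And>n. \<rho> n \<le> m" "\<And>n. T (r n)
        = ctr (\<rho> n)"
      "T dst = ctr v" "\<And>j. k \<le> j \<Longrightarrow> j < k + ?K \<Longrightarrow> T j = ctr 0"
    have k: "T k = ctr 0" "T (k + 1) = ctr 0" using T(6)[of k] T(6)[of "k + 1"] by auto
    define A where "A = f (x, \<rho>)"
    define B where "B = g (x, \<rho>)"
    have AB: "A \<le> poly p1 m" "B \<le> poly p2 m"
      using evaluable_le[OF f, of x m \<rho>] evaluable_le[OF g, of x m \<rho>] T by (auto simp: A_def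
          B_def)
    obtain t1 where t1: "t1 \<le> poly p1 m" "runs c T t1 (T(k := ctr A))"
      using addsD[OF c, of T x m \<rho> 0] T k by (auto simp: A_def)
    obtain t2 where t2: "t2 \<le> poly p2 m" "runs d (T(k := ctr A)) t2 (T(k := ctr A, k + 1 := ctr B))"
      using addsD[OF d, of "T(k := ctr A)" x m \<rho> 0] T k r r2 by (auto simp: B_def)
    define S where "S i = T(k := ctr (A - i), k + 1 := ctr (B - i))" for i
    have "\<exists>t \<le> B * (3 + 3) + 1. runs ?l (S 0) t (S B)"
    proof (rule runs_for)
      fix i
      let ?T = "(S i)(k + 1 := ctr (B - Suc i))"
      show "\<exists>t\<le>3. runs (cond k {1} (decr k) []) ?T t (S (Suc i))"
      proof (cases "A - i = 0")
        case True
        then have "?T = S (Suc i)" by (auto simp: S_def)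
        with True runs_cond_False[of ?T k "{1}" "[]" 0 ?T "decr k"]
        show ?thesis by (intro exI[of _ 1]) (simp add: S_def)
      next
        case False
        then have "A - i = Suc (A - Suc i)" by simp
        then have "runs (decr k) ?T 1 (?T(k := ctr (A - Suc i)))"
          by (intro runs_dec) (simp add: S_def)
        moreover have "?T(k := ctr (A - Suc i)) = S (Suc i)" by (auto simp: S_def)
        ultimately have "runs (cond k {1} (decr k) []) ?T (1 + 2) (S (Suc i))"
          using False by (intro runs_cond_True) (auto simp: S_def)
        then show ?thesis by (intro exI[of _ "1 + 2"]) simp
      qed
    qed (simp add: S_def)
    then obtain t3 where t3: "t3 \<le> B * 6 + 1" "runs ?l (S 0) t3 (S B)" by auto
    obtain t4 where t4: "t4 \<le> (A - B) * 5 + 1" "runs (loop k {1} (decr k @ incr dst)) (S B) t4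
        ((S B)(k := ctr 0, dst := ctr (v + (A - B))))"
      using runs_move[of "S B" k "A - B" dst v] T r by (auto simp: S_def)
    have "(S B)(k := ctr 0, dst := ctr (v + (A - B))) = T(dst := ctr (v + (A - B)))"
      using k by (auto simp: S_def fun_eq_iff)
    then have "runs ?c T (t1 + (t2 + (t3 + t4))) (T(dst := ctr (v + (f (x, \<rho>) - g (x, \<rho>)))))"
      using t2(2) t3(2) t4(2)
      by (intro runs_append[OF t1(2)] runs_append) (auto simp: S_def A_def B_def)
    moreover have "t1 + (t2 + (t3 + t4)) \<le> poly ?p m"
      using t1(1) t2(1) t3(1) t4(1) AB by simp
    ultimately show "\<exists>t\<le>poly ?p m. runs ?c T t (T(dst := ctr (v + (f (x, \<rho>) - g (x,
        \<rho>)))))" by blast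
  qed
  then show "\<exists>c. adds k ?K r dst ?p (\<lambda>s. f s - g s) c" by blast
qed

lemma runs_forth:
  assumes "T 0 = (w, p)" "T' = T(0 := (w, p + 1))"
  shows "runs [Act 0 None Move_Right] T 1 T'"
  using runs_Act[of 0 None Move_Right T] assms by simp

lemma runs_back:
  assumes "T 0 = (w, p)" "T' = T(0 := (w, p - 1))"
  shows "runs [Act 0 None Move_Left] T 1 T'"
  using runs_Act[of 0 None Move_Left T] assms by simp

lemma runs_return:
  assumes "T 0 = (w, int n)" "T k = ctr n" "k \<noteq> 0"
  shows "\<exists>t \<le> n * 4 + 1. runs (loop k {1} (decr k @ [Act 0 None Move_Left])) T t (T(0 :=
      (w, 0), k := ctr 0))"
proof -
  define S where "S i = T(0 := (w, int (n - i)), k := ctr (n - i))" for i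
  have "\<exists>t \<le> n * (1 + 3) + 1. runs (loop k {1} (decr k @ [Act 0 None Move_Left])) (S 0) t (S n)"
  proof (rule runs_for)
    fix i assume "i < n"
    then show "\<exists>t\<le>1. runs [Act 0 None Move_Left] ((S i)(k := ctr (n - Suc i))) t (S (Suc i))"
      using assms by (intro exI[of _ 1] conjI runs_back[of _ w "int (n - i)"])
        (auto simp: S_def fun_eq_iff)
  qed (use assms in \<open>simp add: S_def\<close>)
  moreover have "S 0 = T" using assms by (auto simp: S_def fun_eq_iff)
  ultimately show ?thesis by (simp add: S_def)
qed

text \<open>The head of the input tape must return to 0, so its steps to the right are also counted
  in a scratch counter that governs the way back.\<close>

lemma evaluable_Len: "evaluable 1 [:2, 11:] (\<lambda>s. length (fst s))"
proof (rule evaluableI)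
  show "length x \<le> m \<Longrightarrow> length (fst (x, \<rho>)) \<le> poly [:2, 11:] m" for x
      \<rho> m by simp
next
  fix k dst :: nat and r :: "nat \<Rightarrow> nat"
  assume r: "0 < dst" "dst < k" "\<And>n. 0 < r n" "\<And>n. r n < k" "\<And>n. r n \<noteq> dst"
  let ?l1 = "loop 0 {1, 2} ([Act 0 None Move_Right] @ incr k @ incr dst)"
  let ?l2 = "loop k {1} (decr k @ [Act 0 None Move_Left])"
  have "adds k 1 r dst [:2, 11:] (\<lambda>s. length (fst s)) (?l1 @ ?l2)"
  proof (rule addsI)
    show "\<forall>i\<in>set (?l1 @ ?l2). wf_instr (k + 1) i" using r by (simp add: ball_Un)
    fix x \<rho> m and T :: "nat \<Rightarrow> tape" and v
    assume T: "T 0 = (word_tape x, 0)" "length x \<le> m" "T dst = ctr v"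
      "\<And>j. k \<le> j \<Longrightarrow> j < k + 1 \<Longrightarrow> T j = ctr 0"
    have k: "T k = ctr 0" using T(4)[of k] by simp
    define S where "S i = T(0 := (word_tape x, int i), k := ctr i, dst := ctr (v + i))" for i
    have "\<exists>t \<le> length x * (5 + 2) + 1. runs ?l1 (S 0) t (S (length x))"
    proof (rule runs_while)
      fix i assume "i < length x"
      then show "scanned (S i 0) \<in> {1, 2}" using r by (simp add: S_def word_tape_def bit_symbol_def)
      have "runs ([Act 0 None Move_Right] @ incr k @ incr dst) (S i) (1 + (2 + 2)) (S (Suc i))"
        using r by (intro runs_append[of _ _ _ "(S i)(0 := (word_tape x, int i + 1))"]
          runs_append[of _ _ _ "(S i)(0 := (word_tape x, int i + 1), k := ctr (Suc i))"]
          runs_forth[of _ "word_tape x" "int i"] runs_inc'[of _ _ i] runs_inc'[of _ _ "v + i"])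
          (auto simp: S_def fun_eq_iff)
      then show "\<exists>t\<le>5. runs ([Act 0 None Move_Right] @ incr k @ incr dst) (S i) t (S (Suc i))"
        by (intro exI[of _ 5]) simp
    next
      show "scanned (S (length x) 0) \<notin> {1, 2}" using r by (simp add: S_def word_tape_def)
    qed
    then obtain t where t: "t \<le> length x * 7 + 1" "runs ?l1 T t (S (length x))"
      using T k by (auto simp: S_def fun_upd_idem)
    obtain t' where t': "t' \<le> length x * 4 + 1" "runs ?l2 (S (length x)) t'
        ((S (length x))(0 := (word_tape x, 0), k := ctr 0))"
      using runs_return[of "S (length x)" "word_tape x" "length x" k] r by (auto simp: S_def)
    have "(S (length x))(0 := (word_tape x, 0), k := ctr 0) = T(dst := ctr (v + length (fst (x, \<rho>))))"
      using T k r by (auto simp: S_def fun_eq_iff)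
    with runs_append[OF t(2) t'(2)] t(1) t'(1) T(2)
    show "\<exists>t\<le>poly [:2, 11:] m. runs (?l1 @ ?l2) T t (T(dst := ctr (v + length (fst (x,
        \<rho>)))))"
      by (intro exI[of _ "t + t'"]) simp
  qed
  then show "\<exists>c. adds k 1 r dst [:2, 11:] (\<lambda>s. length (fst s)) c" by blast
qed

text \<open>The head walks to the indexed position and back. An index beyond the word leads to a
  blank, which fails the test for the symbol 2 just as the guard of the bit demands.\<close>

lemma evaluable_Bit:
  assumes f: "evaluable K p f"
  shows "evaluable (2 + K) (smult 11 p + [:6:]) (\<lambda>s. of_bool (f s < length (fst s) \<and> fst s
      ! f s))"
    (is "evaluable ?K ?p ?g")
proof (rule evaluableI)
  show "?g (x, \<rho>) \<le> poly ?p m" for x \<rho> m by simp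
next
  fix k dst :: nat and r :: "nat \<Rightarrow> nat"
  assume r: "0 < dst" "dst < k" "\<And>n. 0 < r n" "\<And>n. r n < k" "\<And>n. r n \<noteq> dst"
  have r2: "r n < k + 2" "r n \<noteq> k" for n using r(4)[of n] by auto
  obtain c where c: "adds (k + 2) K r k p f c"
    using evaluable_code[OF f, of k "k + 2" r] r r2 by auto
  let ?l1 = "loop k {1} (decr k @ incr (k + 1) @ [Act 0 None Move_Right])"
  let ?l2 = "loop (k + 1) {1} (decr (k + 1) @ [Act 0 None Move_Left])"
  let ?d = "cond 0 {2} (incr dst) []"
  let ?c = "c @ ?l1 @ ?d @ ?l2"
  have "adds k ?K r dst ?p ?g ?c"
  proof (rule addsI)
    show "\<forall>i\<in>set ?c. wf_instr (k + ?K) i"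
      using adds_wf[OF c, of "k + ?K"] r by (simp add: ball_Un)
    fix x \<rho> m and T :: "nat \<Rightarrow> tape" and v
    assume T: "T 0 = (word_tape x, 0)" "length x \<le> m" "\<And>n. \<rho> n \<le> m" "\<And>n. T (r n)
        = ctr (\<rho> n)"
      "T dst = ctr v" "\<And>j. k \<le> j \<Longrightarrow> j < k + ?K \<Longrightarrow> T j = ctr 0"
    have k: "T k = ctr 0" "T (k + 1) = ctr 0" using T(6)[of k] T(6)[of "k + 1"] by auto
    define A where "A = f (x, \<rho>)"
    have A: "A \<le> poly p m"
      using evaluable_le[OF f, of x m \<rho>] T by (auto simp: A_def)
    obtain t1 where t1: "t1 \<le> poly p m" "runs c T t1 (T(k := ctr A))"
      using addsD[OF c, of T x m \<rho> 0] T k by (auto simp: A_def)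
    define S where "S i = T(k := ctr (A - i), k + 1 := ctr i, 0 := (word_tape x, int i))" for i
    have "\<exists>t \<le> A * (3 + 3) + 1. runs ?l1 (S 0) t (S A)"
    proof (rule runs_for)
      fix i
      let ?T = "(S i)(k := ctr (A - Suc i))"
      have "runs (incr (k + 1) @ [Act 0 None Move_Right]) ?T (2 + 1) (S (Suc i))"
        using r by (intro runs_append[of _ _ _ "?T(k + 1 := ctr (Suc i))"]
          runs_forth[of _ "word_tape x" "int i"] runs_inc'[of _ _ i])
          (auto simp: S_def fun_eq_iff)
      then show "\<exists>t\<le>3. runs (incr (k + 1) @ [Act 0 None Move_Right]) ?T t (S (Suc i))"
        by (intro exI[of _ 3]) simp
    qed (use r in \<open>simp add: S_def\<close>)
    moreover have "S 0 = T(k := ctr A)" using T k r by (auto simp: S_def fun_eq_iff)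
    ultimately obtain t2 where t2: "t2 \<le> A * 6 + 1" "runs ?l1 (T(k := ctr A)) t2 (S A)" by auto
    let ?b = "A < length x \<and> x ! A"
    let ?T = "(S A)(dst := ctr (v + of_bool ?b))"
    have "\<exists>t\<le>4. runs ?d (S A) t ?T"
    proof (cases ?b)
      case True
      have "runs (incr dst) (S A) 2 ?T"
        using True T r by (intro runs_inc'[of _ _ v]) (auto simp: S_def)
      then have "runs ?d (S A) (2 + 2) ?T"
        using True r by (intro runs_cond_True) (auto simp: S_def word_tape_def bit_symbol_def)
      then show ?thesis by (intro exI[of _ 4]) simp
    next
      case False
      have "?T = S A" using False T r by (auto simp: S_def fun_eq_iff)
      moreover have "runs ?d (S A) (0 + 1) (S A)"
        using False r by (intro runs_cond_False) (auto simp: S_def word_tape_def bit_symbol_def)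
      ultimately show ?thesis by (intro exI[of _ 1]) simp
    qed
    then obtain t3 where t3: "t3 \<le> 4" "runs ?d (S A) t3 ?T" by blast
    obtain t4 where t4: "t4 \<le> A * 4 + 1" "runs ?l2 ?T t4 (?T(0 := (word_tape x, 0), k + 1 := ctr 0))"
      using runs_return[of ?T "word_tape x" A "k + 1"] r by (auto simp: S_def)
    have "?T(0 := (word_tape x, 0), k + 1 := ctr 0) = T(dst := ctr (v + ?g (x, \<rho>)))"
      using k T r by (auto simp: S_def A_def fun_eq_iff)
    with t4 have "runs ?c T (t1 + (t2 + (t3 + t4))) (T(dst := ctr (v + ?g (x, \<rho>))))"
      using t3(2) by (intro runs_append[OF t1(2)] runs_append[OF t2(2)] runs_append) auto
    moreover have "t1 + (t2 + (t3 + t4)) \<le> poly ?p m"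
      using t1(1) t2(1) t3(1) t4(1) A by simp
    ultimately show "\<exists>t\<le>poly ?p m. runs ?c T t (T(dst := ctr (v + ?g (x, \<rho>))))" by blast
  qed
  then show "\<exists>c. adds k ?K r dst ?p ?g c" by blast
qed

text \<open>One counter runs down with the rounds while another, registered as variable 0, runs up
  as the summation index. The index is below \<open>poly p1 m\<close>, so inside the body the common
  bound on word and variables grows from \<open>m\<close> to \<open>poly p1 m + m\<close>; hence the
  composition in \<open>q\<close>. The nesting depth is fixed for each function, so the bounds stay
  polynomial.\<close>

lemma evaluable_Sum:
  assumes f: "evaluable K1 p1 f" and g: "evaluable K2 p2 g"
  defines "q \<equiv> p2 \<circ>\<^sub>p (p1 + [:0, 1:])"
  shows "evaluable (2 + K1 + K2) (p1 + p1 * (q + [:8:]) + [:2:]) (\<lambda>s. \<Sum>i<f s. g (push i s))"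
    (is "evaluable ?K ?p ?h")
proof (rule evaluableI)
  fix x :: "bool list" and \<rho> :: "nat \<Rightarrow> nat" and m
  assume m: "length x \<le> m" "\<And>n. \<rho> n \<le> m"
  have f': "f (x, \<rho>) \<le> poly p1 m" using evaluable_le[OF f] m by blast
  have "g (push i (x, \<rho>)) \<le> poly q m" if i: "i < f (x, \<rho>)" for i
  proof -
    have "g (x, case_nat i \<rho>) \<le> poly p2 (poly p1 m + m)"
    proof (rule evaluable_le[OF g])
      show "length x \<le> poly p1 m + m" using m(1) by linarith
      show "case_nat i \<rho> n \<le> poly p1 m + m" for n
      proof (cases n)
        case 0 then show ?thesis using i f' by simp
      next
        case (Suc k) then show ?thesis using m(2)[of k] by simp
      qed
    qed
    then show ?thesis by (simp add: push_def q_def poly_pcompose)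
  qed
  then have "?h (x, \<rho>) \<le> of_nat (card {..<f (x, \<rho>)}) * poly q m"
    by (intro sum_bounded_above) simp
  then have "?h (x, \<rho>) \<le> f (x, \<rho>) * poly q m" by simp
  also have "\<dots> \<le> poly p1 m * poly q m" using f' by simp
  finally show "?h (x, \<rho>) \<le> poly ?p m" by (simp add: algebra_simps)
next
  fix k dst :: nat and r :: "nat \<Rightarrow> nat"
  assume r: "0 < dst" "dst < k" "\<And>n. 0 < r n" "\<And>n. r n < k" "\<And>n. r n \<noteq> dst"
  have r2: "r n < k + 2" "r n \<noteq> k" "r n \<noteq> Suc k" for n using r(4)[of n] by auto
  obtain c where c: "adds (k + 2) K1 r k p1 f c"
    using evaluable_code[OF f, of k "k + 2" r] r r2 by auto
  obtain d where d: "adds (k + 2) K2 (case_nat (k + 1) r) dst p2 g d"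
  proof (rule evaluable_code[OF g, of dst "k + 2" "case_nat (k + 1) r"])
    show "0 < case_nat (k + 1) r n \<and> case_nat (k + 1) r n < k + 2 \<and> case_nat (k + 1) r n
        \<noteq> dst" for n
      using r r2 by (cases n) auto
  qed (use r in simp_all)
  let ?l1 = "loop k {1} (decr k @ d @ incr (k + 1))"
  let ?l2 = "loop (k + 1) {1} (decr (k + 1))"
  let ?c = "c @ ?l1 @ ?l2"
  have "adds k ?K r dst ?p ?h ?c"
  proof (rule addsI)
    show "\<forall>i\<in>set ?c. wf_instr (k + ?K) i"
      using adds_wf[OF c, of "k + ?K"] adds_wf[OF d, of "k + ?K"] r by (simp add: ball_Un)
    fix x \<rho> m and T :: "nat \<Rightarrow> tape" and v
    assume T: "T 0 = (word_tape x, 0)" "length x \<le> m" "\<And>n. \<rho> n \<le> m" "\<And>n. T (r n)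
        = ctr (\<rho> n)"
      "T dst = ctr v" "\<And>j. k \<le> j \<Longrightarrow> j < k + ?K \<Longrightarrow> T j = ctr 0"
    have k: "T k = ctr 0" "T (k + 1) = ctr 0" using T(6)[of k] T(6)[of "k + 1"] by auto
    define A where "A = f (x, \<rho>)"
    have A: "A \<le> poly p1 m"
      using evaluable_le[OF f, of x m \<rho>] T by (auto simp: A_def)
    obtain t1 where t1: "t1 \<le> poly p1 m" "runs c T t1 (T(k := ctr A))"
      using addsD[OF c, of T x m \<rho> 0] T k by (auto simp: A_def)
    define G where "G i = (\<Sum>i<i. g (push i (x, \<rho>)))" for i
    define S where "S i = T(k := ctr (A - i), k + 1 := ctr i, dst := ctr (v + G i))" for i
    have "\<exists>t \<le> A * ((poly q m + 2) + 3) + 1. runs ?l1 (S 0) t (S A)"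
    proof (rule runs_for)
      fix i assume i: "i < A"
      let ?T = "(S i)(k := ctr (A - Suc i))"
      have Tr: "?T (case_nat (k + 1) r n) = ctr (case_nat i \<rho> n)" for n
        using T(4) r r2 by (simp add: S_def split: nat.split)
      have "\<exists>t\<le>poly p2 (poly p1 m + m). runs d ?T t (?T(dst := ctr (v + G i + g (x,
          case_nat i \<rho>))))"
      proof (rule addsD[OF d, of ?T x "poly p1 m + m" "case_nat i \<rho>" "v + G i"])
        show "case_nat i \<rho> n \<le> poly p1 m + m" for n
          using T(3)[of "n - 1"] i A by (cases n) auto
      qed (use T r Tr in \<open>auto simp: S_def\<close>)
      then obtain t where t: "t \<le> poly q m" "runs d ?T t (?T(dst := ctr (v + G (Suc i))))"
        by (auto simp: G_def q_def poly_pcompose push_def add.assoc)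
      have "runs (d @ incr (k + 1)) ?T (t + 2) (S (Suc i))"
        using r by (intro runs_append[OF t(2)] runs_inc'[of _ _ i]) (auto simp: S_def fun_eq_iff)
      then show "\<exists>t\<le>poly q m + 2. runs (d @ incr (k + 1)) ?T t (S (Suc i))"
        using t(1) by (intro exI[of _ "t + 2"]) simp
    qed (use r in \<open>simp add: S_def\<close>)
    moreover have "S 0 = T(k := ctr A)" using T k r by (auto simp: S_def G_def fun_eq_iff)
    ultimately obtain t2 where t2: "t2 \<le> A * (poly q m + 5) + 1" "runs ?l1 (T(k := ctr A)) t2 (S A)"
      by (auto simp: ac_simps)
    obtain t3 where t3: "t3 \<le> A * 3 + 1" "runs ?l2 (S A) t3 ((S A)(k + 1 := ctr 0))"
      using runs_clear[of "S A" "k + 1" A] r by (auto simp: S_def)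
    have "(S A)(k + 1 := ctr 0) = T(dst := ctr (v + ?h (x, \<rho>)))"
      using k T r by (auto simp: S_def A_def G_def fun_eq_iff)
    with t3 have "runs ?c T (t1 + (t2 + t3)) (T(dst := ctr (v + ?h (x, \<rho>))))"
      by (intro runs_append[OF t1(2)] runs_append[OF t2(2)]) auto
    moreover have "t1 + (t2 + t3) \<le> poly ?p m"
    proof -
      have "A * (poly q m + 8) \<le> poly p1 m * (poly q m + 8)" using A by simp
      then show ?thesis using t1(1) t2(1) t3(1) by (simp add: algebra_simps)
    qed
    ultimately show "\<exists>t\<le>poly ?p m. runs ?c T t (T(dst := ctr (v + ?h (x, \<rho>))))" by blast
  qed
  then show "\<exists>c. adds k ?K r dst ?p ?h c" by blast
qed

lemma elem_fun_evaluable: "elem_fun f \<Longrightarrow> \<exists>K p. evaluable K p f"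
proof (induction rule: elem_fun.induct)
  case (Var n) show ?case by (intro exI) (rule evaluable_Var)
next
  case One show ?case by (intro exI) (rule evaluable_One)
next
  case Len show ?case by (intro exI) (rule evaluable_Len)
next
  case (Bit f) then show ?case by (elim exE) (intro exI, erule evaluable_Bit)
next
  case (Add f g) then show ?case by (elim exE) (intro exI, erule evaluable_Add)
next
  case (Diff f g) then show ?case by (elim exE) (intro exI, erule evaluable_Diff)
next
  case (Sum f g) then show ?case by (elim exE) (intro exI, erule evaluable_Sum)
qed

section \<open>Printing a word bit by bit\<close>

lemma runs_emit:
  assumes "T j = (word_tape (take i y), int i)" "i < length y"
    and "T' = T(j := (word_tape (take (Suc i) y), int (Suc i)))"
  shows "runs [Act j (Some (bit_symbol (y ! i))) Move_Right] T 1 T'"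
proof -
  have w: "(word_tape (take i y))(int i := bit_symbol (y ! i)) = word_tape (take (Suc i) y)"
    using assms(2) by (auto simp: fun_eq_iff word_tape_def)
  have "T' = T(j := act (bit_symbol (y ! i), Move_Right) (T j))"
    using w by (simp add: assms(1,3) add.commute)
  then show ?thesis
    using runs_Act[of j "Some (bit_symbol (y ! i))" Move_Right T] by simp
qed

text \<open>A single loop counts the position, evaluates the bit and prints it. All variables but
  the first are mapped to one register that stays 0, and the output tape has the largest number
  because outputs are read off the last tape.\<close>

lemma elem_fun_poly_time_computable:
  assumes f: "elem_fun f" and g: "elem_fun g"
  shows "poly_time_computable
    (\<lambda>x. map (\<lambda>i. g (x, (\<lambda>_. 0)(0 := i)) \<noteq> 0) [0..<f (x, \<lambda>_. 0)])"
proof -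
  obtain K1 p1 where f: "evaluable K1 p1 f" using elem_fun_evaluable[OF f] by blast
  obtain K2 p2 where g: "evaluable K2 p2 g" using elem_fun_evaluable[OF g] by blast
  text \<open>Registers: a zero, the argument of \<open>g\<close>, the number of remaining symbols, the
      value of \<open>g\<close>.\<close>
  define r where "r = (\<lambda>n :: nat. if n = 0 then 2 else 1 :: nat)"
  obtain c where c: "adds 5 K1 (\<lambda>_. 1) 3 p1 f c"
    using evaluable_code[OF f, of 3 5 "\<lambda>_. 1"] by auto
  obtain d where d: "adds 5 K2 r 4 p2 g d"
  proof (rule evaluable_code[OF g, of 4 5 r])
    show "0 < r n \<and> r n < 5 \<and> r n \<noteq> 4" for n by (simp add: r_def)
  qed simp_all
  define out where "out = 5 + K1 + K2"
  let ?b = "\<lambda>b. [Act out (Some (bit_symbol b)) Move_Right]"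
  let ?body = "d @ cond 4 {1} (?b True) (?b False) @ loop 4 {1} (decr 4) @ incr 2"
  let ?l = "loop 3 {1} (decr 3 @ ?body)"
  let ?c = "c @ ?l"
  let ?M = "tm_of ?c (Suc out)"
  define q where "q = p2 \<circ>\<^sub>p (p1 + [:0, 1:])"
  let ?p = "p1 + p1 * (smult 4 q + [:9:]) + [:1:]"
  have wf: "\<forall>i \<in> set ?c. wf_instr (Suc out) i"
    using adds_wf[OF c, of "Suc out"] adds_wf[OF d, of "Suc out"]
    by (simp add: ball_Un out_def bit_symbol_def)
  have "\<exists>t \<le> poly ?p (length x). halts_with ?M x t (map (\<lambda>i. g (x, (\<lambda>_.
      0)(0 := i)) \<noteq> 0) [0..<f (x, \<lambda>_. 0)])"
    for x
  proof -
    let ?m = "length x"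
    define A where "A = f (x, \<lambda>_. 0)"
    define B where "B i = g (x, (\<lambda>_. 0)(0 := i))" for i
    define y where "y = map (\<lambda>i. B i \<noteq> 0) [0..<A]"
    have A: "A \<le> poly p1 ?m" using evaluable_le[OF f, of x ?m "\<lambda>_. 0"] by (simp add: A_def)
    have B: "B i \<le> poly q ?m" if "i < A" for i
      using evaluable_le[OF g, of x "poly p1 ?m + ?m" "(\<lambda>_. 0)(0 := i)"] A that
      by (simp add: B_def q_def poly_pcompose)
    define T where "T = (\<lambda>j :: nat. if j = 0 then (word_tape x, 0) else ctr 0)"
    obtain t1 where t1: "t1 \<le> poly p1 ?m" "runs c T t1 (T(3 := ctr A))"
      using addsD[OF c, of T x ?m "\<lambda>_. 0" 0] by (auto simp: T_def A_def)
    define S where "S i = T(2 := ctr i, 3 := ctr (A - i), out := (word_tape (take i y), int i))" for i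
    have [simp]: "out \<noteq> 0" "out \<noteq> 1" "out \<noteq> 2" "out \<noteq> 3" "out \<noteq> 4"
        by (auto simp: out_def)
    have [simp]: "Suc 0 \<noteq> out" "0 \<noteq> out" "2 \<noteq> out" "3 \<noteq> out" "4 \<noteq>
        out" by (auto simp: out_def)
    have "\<exists>t \<le> A * ((4 * poly q ?m + 6) + 3) + 1. runs ?l (S 0) t (S A)"
    proof (rule runs_for)
      fix i assume i: "i < A"
      let ?T = "(S i)(3 := ctr (A - Suc i))"
      have yi: "i < length y" "y ! i \<longleftrightarrow> B i \<noteq> 0" using i by (simp_all add: y_def)
      have "\<exists>t\<le>poly p2 (poly p1 ?m + ?m). runs d ?T t (?T(4 := ctr (0 + g (x, (\<lambda>_.
          0)(0 := i)))))"
      proof (rule addsD[OF d, of ?T x "poly p1 ?m + ?m" "(\<lambda>_. 0)(0 := i)" 0])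
        show "?T j = ctr 0" if "5 \<le> j" "j < 5 + K2" for j
          using that by (auto simp: S_def T_def out_def)
      qed (use i A in \<open>auto simp: S_def T_def r_def\<close>)
      then obtain t where t: "t \<le> poly q ?m" "runs d ?T t (?T(4 := ctr (B i)))"
        by (auto simp: q_def poly_pcompose B_def)
      let ?T1 = "?T(4 := ctr (B i))"
      let ?T2 = "?T1(out := (word_tape (take (Suc i) y), int (Suc i)))"
      have e: "runs (?b (y ! i)) ?T1 1 ?T2"
        using yi(1) by (intro runs_emit) (auto simp: S_def)
      have "\<exists>t' \<le> 3. runs (cond 4 {1} (?b True) (?b False)) ?T1 t' ?T2"
      proof (cases "B i = 0")
        case True
        then have "runs (cond 4 {1} (?b True) (?b False)) ?T1 (1 + 1) ?T2"
          using e yi(2) by (intro runs_cond_False) auto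
        then show ?thesis by (intro exI[of _ "1 + 1"]) simp
      next
        case False
        then have "runs (cond 4 {1} (?b True) (?b False)) ?T1 (1 + 2) ?T2"
          using e yi(2) by (intro runs_cond_True) auto
        then show ?thesis by (intro exI[of _ "1 + 2"]) simp
      qed
      then obtain t' where t': "t' \<le> 3" "runs (cond 4 {1} (?b True) (?b False)) ?T1 t' ?T2" by blast
      obtain t'' where t'': "t'' \<le> B i * 3 + 1" "runs (loop 4 {1} (decr 4)) ?T2 t'' (?T2(4 := ctr 0))"
        using runs_clear[of ?T2 4 "B i"] by auto
      have "runs (incr 2) (?T2(4 := ctr 0)) 2 (S (Suc i))"
        by (intro runs_inc'[of _ _ i]) (auto simp: S_def T_def fun_eq_iff)
      then have "runs ?body ?T (t + (t' + (t'' + 2))) (S (Suc i))"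
        by (intro runs_append[OF t(2)] runs_append[OF t'(2)] runs_append[OF t''(2)])
      moreover have "t + (t' + (t'' + 2)) \<le> 4 * poly q ?m + 6"
        using t(1) t'(1) t''(1) B[OF i] by simp
      ultimately show "\<exists>t\<le>4 * poly q ?m + 6. runs ?body ?T t (S (Suc i))" by blast
    qed (simp add: S_def)
    \<comment> \<open>A blank tape with its head at 0 is \<open>ctr 0\<close> and also the tape of
      the empty word, so the output tape needs no preparation.\<close>
    moreover have "S 0 = T(3 := ctr A)"
      by (auto simp: S_def T_def fun_eq_iff ctr_def word_tape_def)
    ultimately obtain t2 where t2: "t2 \<le> A * (4 * poly q ?m + 9) + 1" "runs ?l (T(3 := ctr A)) t2 (S A)"
      by (auto simp: ac_simps)
    have "runs ?c T (t1 + t2) (S A)" by (rule runs_append[OF t1(2) t2(2)])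
    from this[unfolded runs_def, rule_format, of "[]" "[]"]
    have ex: "(exec ?c ^^ (t1 + t2)) (0, T) = (length ?c, S A)" by simp
    have init: "init_config ?M x = (0, map T [0..<Suc out])"
      by (auto simp: init_config_def tm_of_def T_def ctr_def nth_Cons' fun_eq_iff simp del: upt_Suc
          intro!: nth_equalityI)
    have "halts_with ?M x (t1 + t2) y"
      unfolding halts_with_def init steps_tm_of[OF wf] ex
      by (auto simp: tm_of_def tape_output_def S_def word_tape_def y_def)
    moreover have "t1 + t2 \<le> poly ?p ?m"
    proof -
      have "A * (4 * poly q ?m + 9) \<le> poly p1 ?m * (4 * poly q ?m + 9)" using A by (rule mult_le_mono1)
      then show ?thesis using t1(1) t2(1) by (simp add: algebra_simps)
    qed
    moreover have "y = map (\<lambda>i. g (x, (\<lambda>_. 0)(0 := i)) \<noteq> 0) [0..<f (x,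
        \<lambda>_. 0)]"
      by (simp add: y_def A_def B_def)
    ultimately show ?thesis by auto
  qed
  moreover have "valid_tm ?M" by (rule valid_tm_of[OF wf]) simp
  ultimately show ?thesis unfolding poly_time_computable_def by blast
qed

section \<open>Closure properties of elementary functions and predicates\<close>

lemma elem_fun_rename: "elem_fun f \<Longrightarrow> elem_fun (\<lambda>s. f (fst s, snd s \<circ> \<pi>))"
proof (induction arbitrary: \<pi> rule: elem_fun.induct)
  case (Var n)
  show ?case using elem_fun.Var[of "\<pi> n"] by simp
next
  case One
  show ?case by (rule elem_fun.One)
next
  case Len
  show ?case using elem_fun.Len by simp
next
  case (Bit f)
  show ?case using elem_fun.Bit[OF Bit.IH[of \<pi>]] by simp
next
  case (Add f g)
  show ?case using elem_fun.Add[OF Add.IH] .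
next
  case (Diff f g)
  show ?case using elem_fun.Diff[OF Diff.IH] .
next
  case (Sum f g)
  \<comment> \<open>Below the binder of a sum, variable 0 stays fixed and the others are renamed one
    place higher.\<close>
  define \<pi>' where "\<pi>' = case_nat 0 (Suc \<circ> \<pi>)"
  have "push i (fst s, snd s \<circ> \<pi>) = (fst (push i s), snd (push i s) \<circ> \<pi>')" for i s
    by (auto simp: push_def \<pi>'_def fun_eq_iff split: nat.split)
  then show ?case using elem_fun.Sum[OF Sum.IH(1)[of \<pi>] Sum.IH(2)[of \<pi>']] by (simp only:)
qed

text \<open>The body of a bounded sum may use the bound variable as \<open>bound_var s\<close> and the
    enclosing state as
  \<open>outer s\<close>.\<close>

definition bound_var :: "state \<Rightarrow> nat" where "bound_var s = snd s 0"

definition outer :: "state \<Rightarrow> state" where "outer s = (fst s, snd s \<circ> Suc)"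

lemma outer_push [simp]: "outer (push i s) = s"
  by (simp add: outer_def push_def comp_def)

lemma bound_var_push [simp]: "bound_var (push i s) = i"
  by (simp add: bound_var_def push_def)

lemma fst_outer: "fst (outer s) = fst s"
  by (simp add: outer_def)

lemma elem_fun_outer: "elem_fun f \<Longrightarrow> elem_fun (\<lambda>s. f (outer s))"
  unfolding outer_def by (rule elem_fun_rename)

lemma elem_fun_bound_var: "elem_fun (\<lambda>s. bound_var s)"
  unfolding bound_var_def by (rule elem_fun.Var)

text \<open>With the body as a term in \<open>outer s\<close> and \<open>bound_var s\<close>,
  introduction rules can descend below the binder; what refers to the enclosing state is then
  settled by \<open>elem_fun_outer\<close>.\<close>

lemma elem_fun_sum: "elem_fun f \<Longrightarrow> elem_fun (\<lambda>s. g (outer s) (bound_var s))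
    \<Longrightarrow> elem_fun (\<lambda>s. \<Sum>i<f s. g s i)"
  using elem_fun.Sum[of f "\<lambda>s. g (outer s) (bound_var s)"] by simp

lemma elem_fun_const: "elem_fun (\<lambda>s. n)"
proof (induction n)
  case 0
  show ?case using elem_fun.Diff[OF elem_fun.One elem_fun.One] by simp
next
  case (Suc n)
  show ?case using elem_fun.Add[OF elem_fun.One Suc] by simp
qed

lemma E_Suc: "elem_fun f \<Longrightarrow> elem_fun (\<lambda>s. Suc (f s))"
  using elem_fun.Add[OF elem_fun.One, of f] by simp

lemma elem_fun_mult: "elem_fun f \<Longrightarrow> elem_fun g \<Longrightarrow> elem_fun (\<lambda>s. f
    s * g s)"
  using elem_fun_sum[of f "\<lambda>s i. g s", OF _ elem_fun_outer] by simp

lemma elem_fun_power: "elem_fun f \<Longrightarrow> elem_fun (\<lambda>s. f s ^ n)"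
proof (induction n)
  case 0
  show ?case using elem_fun.One by simp
next
  case (Suc n)
  show ?case using elem_fun_mult[OF Suc.prems Suc.IH] Suc.prems by simp
qed

lemma elem_fun_poly:
  assumes "elem_fun f"
  shows "elem_fun (\<lambda>s. poly p (f s))"
proof (induction p)
  case 0
  show ?case using elem_fun_const[of 0] by simp
next
  case (pCons a p)
  show ?case using elem_fun.Add[OF elem_fun_const[of a] elem_fun_mult[OF assms pCons.IH]] by simp
qed

definition elem_pred :: "(state \<Rightarrow> bool) \<Rightarrow> bool" where
  "elem_pred P \<longleftrightarrow> elem_fun (\<lambda>s. of_bool (P s))"

lemma elem_pred_outer: "elem_pred P \<Longrightarrow> elem_pred (\<lambda>s. P (outer s))"
  unfolding elem_pred_def by (rule elem_fun_outer)

lemma elem_pred_const: "elem_pred (\<lambda>s. b)"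
  unfolding elem_pred_def by (rule elem_fun_const)

lemma elem_pred_not: "elem_pred P \<Longrightarrow> elem_pred (\<lambda>s. \<not> P s)"
proof -
  have "(\<lambda>s. of_bool (\<not> P s)) = (\<lambda>s. 1 - of_bool (P s) :: nat)" by auto
  then show "elem_pred P \<Longrightarrow> ?thesis" by (simp only: elem_pred_def elem_fun.Diff elem_fun.One)
qed

lemma elem_pred_conj: "elem_pred P \<Longrightarrow> elem_pred Q \<Longrightarrow> elem_pred
    (\<lambda>s. P s \<and> Q s)"
  unfolding elem_pred_def of_bool_conj by (rule elem_fun_mult)

lemma elem_pred_disj: "elem_pred P \<Longrightarrow> elem_pred Q \<Longrightarrow> elem_pred
    (\<lambda>s. P s \<or> Q s)"
  using elem_pred_not[OF elem_pred_conj[OF elem_pred_not elem_pred_not, of P Q]] by simp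

lemma elem_pred_imp: "elem_pred P \<Longrightarrow> elem_pred Q \<Longrightarrow> elem_pred
    (\<lambda>s. P s \<longrightarrow> Q s)"
  unfolding imp_conv_disj by (intro elem_pred_disj elem_pred_not)

lemma elem_pred_iff: "elem_pred P \<Longrightarrow> elem_pred Q \<Longrightarrow> elem_pred
    (\<lambda>s. P s \<longleftrightarrow> Q s)"
  unfolding iff_conv_conj_imp by (intro elem_pred_conj elem_pred_imp)

lemma elem_pred_le: "elem_fun f \<Longrightarrow> elem_fun g \<Longrightarrow> elem_pred (\<lambda>s. f
    s \<le> g s)"
proof -
  assume "elem_fun f" "elem_fun g"
  then have "elem_fun (\<lambda>s. 1 - (f s - g s))" by (intro elem_fun.Diff elem_fun.One)
  moreover have "(\<lambda>s. 1 - (f s - g s)) = (\<lambda>s. of_bool (f s \<le> g s))" by auto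
  ultimately show ?thesis by (simp add: elem_pred_def)
qed

lemma elem_pred_less: "elem_fun f \<Longrightarrow> elem_fun g \<Longrightarrow> elem_pred (\<lambda>s.
    f s < g s)"
  using elem_pred_not[OF elem_pred_le, of g f] by (simp add: not_le)

lemma elem_pred_eq: "elem_fun f \<Longrightarrow> elem_fun g \<Longrightarrow> elem_pred (\<lambda>s. f
    s = g s)"
  unfolding eq_iff by (intro elem_pred_conj elem_pred_le)

lemma elem_pred_ex: "elem_fun f \<Longrightarrow> elem_pred (\<lambda>s. P (outer s) (bound_var s))
    \<Longrightarrow> elem_pred (\<lambda>s. \<exists>i<f s. P s i)"
proof -
  assume f: "elem_fun f" and P: "elem_pred (\<lambda>s. P (outer s) (bound_var s))"
  have "elem_pred (\<lambda>s. 1 \<le> (\<Sum>i<f s. of_bool (P s i) :: nat))"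
    using P by (intro elem_pred_le elem_fun.One elem_fun_sum f) (simp add: elem_pred_def)
  moreover have "1 \<le> (\<Sum>i<f s. of_bool (P s i) :: nat) \<longleftrightarrow> (\<exists>i<f s. P
      s i)" for s
  proof -
    have "(\<Sum>i<f s. of_bool (P s i) :: nat) = 0 \<longleftrightarrow> (\<forall>i<f s. \<not> P s i)"
      by (subst sum_eq_0_iff) auto
    moreover have "1 \<le> m \<longleftrightarrow> m \<noteq> 0" for m :: nat by linarith
    ultimately show ?thesis by blast
  qed
  ultimately show ?thesis by (simp only:)
qed

lemma elem_pred_all: "elem_fun f \<Longrightarrow> elem_pred (\<lambda>s. P (outer s) (bound_var s))
    \<Longrightarrow> elem_pred (\<lambda>s. \<forall>i<f s. P s i)"
  using elem_pred_not[OF elem_pred_ex[of f "\<lambda>s i. \<not> P s i", OF _ elem_pred_not]] by simp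

lemma elem_fun_if: "elem_pred P \<Longrightarrow> elem_fun f \<Longrightarrow> elem_fun g
    \<Longrightarrow> elem_fun (\<lambda>s. if P s then f s else g s)"
proof -
  assume P: "elem_pred P" and "elem_fun f" "elem_fun g"
  then have "elem_fun (\<lambda>s. of_bool (P s) * f s + of_bool (\<not> P s) * g s)"
    using elem_pred_not[OF P] by (intro elem_fun.Add elem_fun_mult) (simp_all add: elem_pred_def)
  moreover have "(\<lambda>s. of_bool (P s) * f s + of_bool (\<not> P s) * g s) = (\<lambda>s. if P s
      then f s else g s)"
    by auto
  ultimately show ?thesis by simp
qed

lemma elem_pred_if: "elem_pred P \<Longrightarrow> elem_pred Q \<Longrightarrow> elem_pred R
    \<Longrightarrow> elem_pred (\<lambda>s. if P s then Q s else R s)"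
  unfolding if_bool_eq_conj by (intro elem_pred_conj elem_pred_imp elem_pred_not)

lemma elem_fun_of_bool: "elem_pred P \<Longrightarrow> elem_fun (\<lambda>s. of_bool (P s))"
  by (simp add: elem_pred_def)

definition word_bit :: "bool list \<Rightarrow> nat \<Rightarrow> bool" where
  "word_bit x i \<longleftrightarrow> i < length x \<and> x ! i"

lemma elem_pred_bit: "elem_fun f \<Longrightarrow> elem_pred (\<lambda>s. word_bit (fst s) (f s))"
  unfolding elem_pred_def word_bit_def by (rule elem_fun.Bit)

text \<open>The quotient counts the positive multiples of \<open>b\<close> up to \<open>a\<close>,
  which a bounded sum can do. The guard \<open>0 < b\<close> yields the value 0 for division by
  0.\<close>

lemma div_eq_sum: "a div b = (\<Sum>i<a. of_bool (0 < b \<and> (i + 1) * b \<le> a))" for a b :: nat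
proof (cases "b = 0")
  case False
  have "{..<a} \<inter> {i. (i + 1) * b \<le> a} = {..<a div b}"
  proof -
    have "(i + 1) * b \<le> a \<longleftrightarrow> i < a div b" for i
      using False less_eq_div_iff_mult_less_eq[of b "i + 1" a] by auto
    moreover have "i < a" if "i < a div b" for i using that div_le_dividend[of a b] by linarith
    ultimately show ?thesis by auto
  qed
  then have "a div b = card ({..<a} \<inter> {i. (i + 1) * b \<le> a})" by simp
  also have "\<dots> = (\<Sum>i<a. of_bool ((i + 1) * b \<le> a))" by (simp add: sum.If_cases of_bool_def)
  finally show ?thesis using False by simp
qed simp

lemma elem_fun_div: "elem_fun f \<Longrightarrow> elem_fun g \<Longrightarrow> elem_fun (\<lambda>s. f
    s div g s)"
  unfolding div_eq_sum
  by (assumption | rule elem_fun_sum elem_fun_of_bool elem_pred_conj elem_pred_less elem_pred_le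
      elem_fun_mult elem_fun.Add elem_fun_bound_var elem_fun_const | rule elem_fun_outer)+

lemma elem_fun_mod: "elem_fun f \<Longrightarrow> elem_fun g \<Longrightarrow> elem_fun (\<lambda>s. f
    s mod g s)"
  using elem_fun.Diff[OF _ elem_fun_mult[OF elem_fun_div], of f f g g] by (simp add: minus_div_mult_eq_mod)

text \<open>Distinguishing finitely many arguments makes any \<open>h\<close> elementary on an
  initial segment, whatever \<open>h\<close> is. The transition function of a machine and the tiles
  of the grid enter in this way.\<close>

lemma elem_fun_table: "elem_fun f \<Longrightarrow> elem_fun (\<lambda>s. if f s < n then h (f s) else 0)"
proof (induction n)
  case 0
  show ?case using elem_fun_const[of 0] by simp
next
  case (Suc n)
  have "elem_fun (\<lambda>s. if f s = n then h n else if f s < n then h (f s) else 0)"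
    by (rule elem_fun_if[OF elem_pred_eq[OF Suc.prems elem_fun_const] elem_fun_const Suc.IH[OF Suc.prems]])
  moreover have "(\<lambda>s. if f s = n then h n else if f s < n then h (f s) else 0) =
      (\<lambda>s. if f s < Suc n then h (f s) else 0)"
    by (auto simp: less_Suc_eq)
  ultimately show ?case by simp
qed

lemmas elem_intros = elem_fun_const elem_pred_const elem_fun_bound_var elem_fun.Len elem_fun.Add
    elem_fun.Diff E_Suc elem_fun_mult elem_fun_div elem_fun_mod elem_fun_power elem_fun_poly
  elem_fun_sum elem_fun_if elem_fun_of_bool elem_pred_not elem_pred_conj elem_pred_disj elem_pred_imp
      elem_pred_iff elem_pred_le elem_pred_less elem_pred_eq elem_pred_ex elem_pred_all elem_pred_if
      elem_pred_bit

section \<open>Membership in NP\<close>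

lemma nth_concat_uniform:
  assumes "\<And>x. x \<in> set xs \<Longrightarrow> length (g x) = m" "k < m * length xs"
  shows "concat (map g xs) ! k = g (xs ! (k div m)) ! (k mod m)"
  using assms
proof (induction xs arbitrary: k)
  case (Cons x xs)
  have "m > 0" using Cons.prems(2) by (cases m) auto
  show ?case
  proof (cases "k < m")
    case True
    then show ?thesis using Cons.prems(1)[of x] by (simp add: nth_append)
  next
    case False
    then have "concat (map g xs) ! (k - m) = g (xs ! ((k - m) div m)) ! ((k - m) mod m)"
      using Cons.prems by (intro Cons.IH) auto
    moreover have "k div m = Suc ((k - m) div m)" "k mod m = (k - m) mod m"
      using False \<open>m > 0\<close> by (auto simp: le_div_geq le_mod_geq)
    ultimately show ?thesis using False Cons.prems(1)[of x] by (simp add: nth_append)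
  qed
qed simp

lemma length_block_code [simp]: "length (block_code b) = 3"
  by (cases b) auto

lemma length_concat_uniform:
  "(\<And>x. x \<in> set xs \<Longrightarrow> length (g x) = m) \<Longrightarrow> length (concat (map g
      xs)) = m * length xs"
  by (induction xs) auto

section \<open>The instance code by positions\<close>

definition header_length :: "nat \<Rightarrow> nat \<Rightarrow> nat \<Rightarrow> nat" where
  "header_length N a b = N + a + b + 3"

text \<open>The three excluded positions are the zeros that end the unary numbers; behind them every
  block takes three bits. This positional form serves both to recognise codes and to generate
  them.\<close>

definition code_symbol :: "nat \<Rightarrow> nat \<Rightarrow> nat \<Rightarrow> (nat \<Rightarrow> nat
    \<Rightarrow> block) \<Rightarrow> nat \<Rightarrow> bool" where
  "code_symbol N a b B k = (if k < header_length N a b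
     then k \<noteq> N \<and> k \<noteq> N + a + 1 \<and> k \<noteq> N + a + b + 2
     else let l = k - header_length N a b in block_code (B (l div 3 div N) (l div 3 mod N)) ! (l mod 3))"

lemma instance_code_eq_map:
  "instance_code C (a, b) =
    map (code_symbol (grid_size C) a b (block_at C)) [0..<header_length (grid_size C) a b + 3 *
        (grid_size C * grid_size C)]"
proof -
  define N where "N = grid_size C"
  let ?zs = "List.product [0..<N] [0..<N]" and ?f = "\<lambda>(i, j). block_code (block_at C i j)"
  have len: "length (concat (map ?f ?zs)) = 3 * (N * N)"
    by (subst length_concat_uniform) auto
  have nth: "concat (map ?f ?zs) ! k = block_code (block_at C (k div 3 div N) (k div 3 mod N)) ! (k mod 3)"
    if "k < 3 * (N * N)" for k
  proof -
    have k: "k div 3 < N * N" using that by (simp add: less_mult_imp_div_less)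
    then have "0 < N" by (cases N) auto
    then have "k div 3 div N < N" "k div 3 mod N < N" using k by (auto simp: less_mult_imp_div_less)
    then have "?zs ! (k div 3) = (k div 3 div N, k div 3 mod N)"
      using k by (subst product_nth) auto
    then show ?thesis using that by (subst nth_concat_uniform[where m = 3]) auto
  qed
  define H where "H = replicate N True @ [False] @ replicate a True @ [False] @ replicate b True @ [False]"
  have H: "length H = header_length N a b"
    "k < length H \<Longrightarrow> H ! k \<longleftrightarrow> k \<noteq> N \<and> k \<noteq> N + a +
        1 \<and> k \<noteq> N + a + b + 2" for k
    by (auto simp: H_def header_length_def nth_append nth_Cons' not_less)
  have "instance_code C (a, b) = H @ concat (map ?f ?zs)"
    by (simp add: instance_code_def N_def H_def)
  also have "\<dots> = map (code_symbol N a b (block_at C)) [0..<header_length N a b + 3 * (N * N)]"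
  proof (rule nth_equalityI)
    fix k assume "k < length (H @ concat (map ?f ?zs))"
    then have k: "k < header_length N a b + 3 * (N * N)" by (simp add: len H)
    show "(H @ concat (map ?f ?zs)) ! k =
      map (code_symbol N a b (block_at C)) [0..<header_length N a b + 3 * (N * N)] ! k"
      using k H nth[of "k - header_length N a b"] by (simp add: code_symbol_def nth_append Let_def)
  qed (simp add: len H)
  finally show ?thesis by (simp add: N_def)
qed

lemma length_pair_word: "length (pair_word x u) = 2 * length x + 1 + length u"
  by (induction x) (auto simp: pair_word_def)

lemma pair_word_Cons: "pair_word (b # x) u = True # b # pair_word x u"
  by (simp add: pair_word_def)

lemma pair_word_nth:
  assumes "k < length x"
  shows "pair_word x u ! (2 * k)" "pair_word x u ! (2 * k + 1) = x ! k"
  using assms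
proof (induction x arbitrary: k)
  case (Cons b x)
  { case 1 then show ?case using Cons.IH(1)[of "k - 1"] by (cases k) (auto simp: pair_word_Cons) }
  { case 2 then show ?case using Cons.IH(2)[of "k - 1"] by (cases k) (auto simp: pair_word_Cons) }
qed simp_all

lemma pair_word_nth_end:
  "\<not> pair_word x u ! (2 * length x)" "pair_word x u ! (2 * length x + 1 + l) = u ! l"
proof (induction x)
  case Nil
  { case 1 show ?case by (simp add: pair_word_def) }
  { case 2 show ?case by (simp add: pair_word_def) }
qed (simp_all add: pair_word_Cons)

lemma word_bit_pair_word:
  "k < length x \<Longrightarrow> word_bit (pair_word x u) (2 * k)"
  "k < length x \<Longrightarrow> word_bit (pair_word x u) (2 * k + 1) = word_bit x k"
  "\<not> word_bit (pair_word x u) (2 * length x)"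
  "word_bit (pair_word x u) (2 * length x + 1 + l) = word_bit u l"
  using pair_word_nth[of k x u] pair_word_nth_end[of x u] by (auto simp: word_bit_def length_pair_word)

section \<open>Local checks of a certificate\<close>

definition coded_block :: "bool \<Rightarrow> bool \<Rightarrow> bool \<Rightarrow> block" where
  "coded_block c\<^sub>0 c\<^sub>1 c\<^sub>2 = (if c\<^sub>0 then Selector else if c\<^sub>1 then
      Fixed_Value
     else if c\<^sub>2 then Disjunction else Conjunction)"

definition cell_no :: "nat \<Rightarrow> nat \<Rightarrow> nat \<Rightarrow> nat" where
  "cell_no N i j = i * N + j"

text \<open>\<open>X\<close> reads the instance and \<open>U\<close> the certificate, which stores
  the east output of a cell at an even position and the south output right behind it. The first
  conjunct admits exactly the codes 110, 000, 001 and 011 of the four allowed blocks. A selector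
  must merely have complementary outputs; its two bits record the truth-assignment.\<close>

definition cell_ok :: "(nat \<Rightarrow> bool) \<Rightarrow> nat \<Rightarrow> (nat \<Rightarrow>
    bool) \<Rightarrow> nat \<Rightarrow> nat \<Rightarrow> nat \<Rightarrow> bool" where
  "cell_ok X l U N i j \<longleftrightarrow>
     (X l \<and> X (l + 1) \<and> \<not> X (l + 2) \<or> \<not> X l \<and> (X (l + 1) \<longrightarrow>
         X (l + 2))) \<and>
     (i = 0 \<or> j = 0 \<longrightarrow> \<not> X l \<and> X (l + 1)) \<and>
     (let N_in = i \<noteq> 0 \<and> U (2 * cell_no N (i - 1) j + 1); W_in = j \<noteq> 0 \<and> U (2 *
         cell_no N i (j - 1));
          E_out = U (2 * cell_no N i j); S_out = U (2 * cell_no N i j + 1)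
      in if X l then S_out = (\<not> E_out)
         else E_out = (\<not> X (l + 1) \<and> (if X (l + 2) then N_in \<or> W_in else N_in \<and>
             W_in)) \<and> S_out = E_out)"

definition checks :: "nat \<Rightarrow> (nat \<Rightarrow> bool) \<Rightarrow> (nat \<Rightarrow> bool)
    \<Rightarrow> nat \<Rightarrow> nat \<Rightarrow> nat \<Rightarrow> bool" where
  "checks n X U N a b \<longleftrightarrow> n = header_length N a b + 3 * (N * N) \<and> a < N \<and> b
      < N \<and>
     (\<forall>k<header_length N a b. X k = (k \<noteq> N \<and> k \<noteq> N + a + 1 \<and> k \<noteq>
         N + a + b + 2)) \<and>
     (\<forall>i<N. \<forall>j<N. cell_ok X (header_length N a b + 3 * cell_no N i j) U N i j) \<and>
     U (2 * cell_no N a b)"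

lemma cell_no_less: "i < N \<Longrightarrow> j < N \<Longrightarrow> cell_no N i j < N * N"
  using mult_le_mono1[of "Suc i" N N] by (simp add: cell_no_def)

lemma cell_no_div_mod: "j < N \<Longrightarrow> cell_no N i j div N = i" "j < N \<Longrightarrow>
    cell_no N i j mod N = j"
  by (simp_all add: cell_no_def)

lemma cell_ok_output:
  assumes "cell_ok X l U N i j"
  shows "block_output (coded_block (X l) (X (l + 1)) (X (l + 2))) (U (2 * cell_no N i j))
     (i \<noteq> 0 \<and> U (2 * cell_no N (i - 1) j + 1)) (j \<noteq> 0 \<and> U (2 * cell_no N i (j -
         1))) =
     (U (2 * cell_no N i j), U (2 * cell_no N i j + 1))"
  using assms by (cases "X l"; cases "X (l + 1)"; cases "X (l + 2)") (simp_all add: cell_ok_def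
      coded_block_def Let_def)

text \<open>The circuit is decoded from the bits of \<open>x\<close>, and the truth-assignment is
  the claimed east output of each cell.\<close>

lemma checks_sound:
  assumes "checks (length x) (word_bit x) U N a b"
  shows "x \<in> Restricted_Grid_Circuit_SAT"
proof -
  let ?h = "header_length N a b"
  define B where "B i j = (let l = ?h + 3 * cell_no N i j in coded_block (word_bit x l) (word_bit x (l
      + 1)) (word_bit x (l + 2)))" for i j
  define C where "C = \<lparr>grid_size = N, block_at = B\<rparr>"
  define e where "e = (\<lambda>(i, j). U (2 * cell_no N i j))"
  have n: "length x = ?h + 3 * (N * N)" and ab: "a < N" "b < N"
    and hd: "\<And>k. k < ?h \<Longrightarrow> word_bit x k = (k \<noteq> N \<and> k \<noteq> N + a + 1
        \<and> k \<noteq> N + a + b + 2)"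
    and ok: "\<And>i j. i < N \<Longrightarrow> j < N \<Longrightarrow> cell_ok (word_bit x) (?h + 3 *
        cell_no N i j) U N i j"
    and v: "U (2 * cell_no N a b)"
    using assms by (auto simp: checks_def)
  have x: "x = instance_code C (a, b)"
  proof -
    have "x ! k = code_symbol N a b B k" if k: "k < length x" for k
    proof (cases "k < ?h")
      case True
      then show ?thesis using hd[of k] k by (simp add: code_symbol_def word_bit_def)
    next
      case False
      define l where "l = k - ?h"
      define i where "i = l div 3 div N"
      define j where "j = l div 3 mod N"
      have "l < N * N * 3" using k n False by (simp add: l_def)
      then have l: "l div 3 < N * N" by (rule less_mult_imp_div_less)
      then have "0 < N" by (cases N) auto
      then have ij: "i < N" "j < N" using l by (auto simp: i_def j_def less_mult_imp_div_less)
      have l3: "l div 3 = cell_no N i j" by (simp add: i_def j_def cell_no_def)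
      have kk: "k = ?h + 3 * cell_no N i j + l mod 3"
        using False l3[symmetric] by (simp add: l_def)
      have "block_code (B i j) ! (l mod 3) = word_bit x k"
      proof -
        have "l mod 3 = 0 \<or> l mod 3 = 1 \<or> l mod 3 = 2" by linarith
        then show ?thesis
          using ok[OF ij] by (elim disjE) (auto simp: kk B_def coded_block_def cell_ok_def Let_def)
      qed
      then show ?thesis
        using False k by (simp add: code_symbol_def Let_def l_def i_def j_def word_bit_def)
    qed
    then show ?thesis
      unfolding instance_code_eq_map by (intro nth_equalityI) (auto simp: C_def n)
  qed
  \<comment> \<open>Once the selectors are fixed, local consistency leaves no freedom: induction in
    the order of evaluation shows that the claimed outputs are the real ones.\<close>
  have out: "outputs C e i j = (U (2 * cell_no N i j), U (2 * cell_no N i j + 1))" if "i < N" "j < N"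
      for i j
    using that
  proof (induction "i + j" arbitrary: i j rule: less_induct)
    case less
    have "outputs C e (i - 1) j = (U (2 * cell_no N (i - 1) j), U (2 * cell_no N (i - 1) j + 1))" if "i
        \<noteq> 0"
      using less.prems that by (intro less.hyps) auto
    moreover have "outputs C e i (j - 1) = (U (2 * cell_no N i (j - 1)), U (2 * cell_no N i (j - 1) +
        1))" if "j \<noteq> 0"
      using less.prems that by (intro less.hyps) auto
    moreover have "block_at C = B" "e (i, j) = U (2 * cell_no N i j)" by (simp_all add: C_def e_def)
    ultimately show ?case
      using cell_ok_output[OF ok[OF less.prems]]
      by (subst outputs.simps, cases "i = 0"; cases "j = 0") (simp_all add: B_def Let_def)
  qed
  have "grid_embedded C" "restricted_circuit C"
    using ok by (auto simp: grid_embedded_def restricted_circuit_def C_def B_def coded_block_def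
        cell_ok_def Let_def)
  moreover have "block_value C e (a, b)" using out[OF ab] v by (simp add: block_value_def)
  ultimately show ?thesis
    using x ab unfolding Restricted_Grid_Circuit_SAT_def grid_circuit_sat_instance_def
    by (intro CollectI exI[of _ C] exI[of _ "(a, b)"]) (auto simp: C_def)
qed

lemma checks_complete:
  assumes "x \<in> Restricted_Grid_Circuit_SAT"
  shows "\<exists>u N a b. length u \<le> 2 * length x \<and> checks (length x) (word_bit x) (word_bit
      u) N a b"
proof -
  from assms obtain C a b e where x: "x = instance_code C (a, b)"
    and C: "grid_embedded C" "restricted_circuit C" and ab: "a < grid_size C" "b < grid_size C"
    and v: "block_value C e (a, b)"
    unfolding Restricted_Grid_Circuit_SAT_def grid_circuit_sat_instance_def by auto
  define N where "N = grid_size C"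
  let ?h = "header_length N a b"
  define g where "g k = (let p = outputs C e (k div 2 div N) (k div 2 mod N) in if even k then fst p
      else snd p)" for k
  define u where "u = map g [0..<2 * (N * N)]"
  have n: "length x = ?h + 3 * (N * N)" by (simp add: x instance_code_eq_map N_def)
  have U: "word_bit u (2 * cell_no N i j) = fst (outputs C e i j)" "word_bit u (2 * cell_no N i j + 1)
      = snd (outputs C e i j)"
    if "i < N" "j < N" for i j
    using cell_no_less[OF that] that by (simp_all add: word_bit_def u_def g_def cell_no_div_mod)
  have X: "word_bit x k = code_symbol N a b (block_at C) k" if "k < length x" for k
    using that by (simp add: word_bit_def x instance_code_eq_map N_def)
  have hd: "word_bit x k = (k \<noteq> N \<and> k \<noteq> N + a + 1 \<and> k \<noteq> N + a + b + 2)"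
      if "k < ?h" for k
    using X[of k] that n by (simp add: code_symbol_def)
  have "cell_ok (word_bit x) (?h + 3 * cell_no N i j) (word_bit u) N i j" if ij: "i < N" "j < N" for i j
  proof -
    have c: "word_bit x (?h + 3 * cell_no N i j + r) = block_code (block_at C i j) ! r" if "r < 3" for r
      using X[of "?h + 3 * cell_no N i j + r"] cell_no_less[OF ij] that ij n
      by (simp add: code_symbol_def Let_def cell_no_div_mod)
    note c3 = c[of 0, simplified] c[of 1, simplified] c[of 2, simplified]
    have B: "block_at C i j \<in> {Conjunction, Disjunction, Fixed_Value, Selector}"
      using C(2) ij by (auto simp: restricted_circuit_def N_def)
    have F: "block_at C i j = Fixed_Value" if "i = 0 \<or> j = 0"
      using C(1) ij that by (auto simp: grid_embedded_def N_def)
    have N_in: "word_bit u (2 * cell_no N (i - 1) j + 1) = snd (outputs C e (i - 1) j)"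
      using U(2)[of "i - 1" j] ij by simp
    have W_in: "word_bit u (2 * cell_no N i (j - 1)) = fst (outputs C e i (j - 1))"
      using U(1)[of i "j - 1"] ij by simp
    show ?thesis
      using B F unfolding cell_ok_def U[OF ij] N_in W_in
      by (auto simp: c3 outputs.simps[of C e i j] Let_def)
  qed
  moreover have "word_bit u (2 * cell_no N a b)" using U(1)[of a b] ab v by (simp add: N_def
      block_value_def)
  ultimately have "checks (length x) (word_bit x) (word_bit u) N a b"
    using hd n ab by (simp add: checks_def N_def)
  moreover have "length u \<le> 2 * length x" by (simp add: u_def n)
  ultimately show ?thesis by blast
qed

text \<open>The first component of a pair is delimited by the least even position that carries a
    zero.\<close>

definition verdict :: "bool list \<Rightarrow> bool" where
  "verdict w \<longleftrightarrow> (\<exists>n<length w. \<not> word_bit w (2 * n) \<and>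
      (\<forall>k<n. word_bit w (2 * k)) \<and>
     (\<exists>N<n. \<exists>a<n. \<exists>b<n. checks n (\<lambda>k. word_bit w (2 * k + 1))
         (\<lambda>k. word_bit w (2 * n + 1 + k)) N a b))"

lemma cell_ok_cong:
  assumes "X l = X' l" "X (l + 1) = X' (l + 1)" "X (l + 2) = X' (l + 2)"
  shows "cell_ok X l U N i j = cell_ok X' l U N i j"
  using assms by (simp add: cell_ok_def)

text \<open>In a coded pair, the bits of \<open>x\<close> stand at odd positions, but the odd
  positions further on belong to the certificate. So the check must not look beyond
  \<open>n\<close>.\<close>

lemma checks_cong:
  assumes "\<And>k. k < n \<Longrightarrow> X k = X' k"
  shows "checks n X U N a b = checks n X' U N a b"
proof (cases "n = header_length N a b + 3 * (N * N)")
  case True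
  have "cell_ok X (header_length N a b + 3 * cell_no N i j) U N i j =
      cell_ok X' (header_length N a b + 3 * cell_no N i j) U N i j" if "i < N" "j < N" for i j
    using cell_no_less[OF that] by (intro cell_ok_cong assms) (auto simp: True)
  moreover have "X k = X' k" if "k < header_length N a b" for k using that True assms by simp
  ultimately show ?thesis by (simp add: checks_def)
qed (simp add: checks_def)

lemma verdict_pair_word:
  "verdict (pair_word x u) \<longleftrightarrow> (\<exists>N a b. checks (length x) (word_bit x)
      (word_bit u) N a b)"
proof -
  let ?w = "pair_word x u"
  have n: "n = length x" if "\<not> word_bit ?w (2 * n)" "\<forall>k<n. word_bit ?w (2 * k)" for n
    using that word_bit_pair_word(1)[of n x u] word_bit_pair_word(3)[of x u] by (meson linorder_neqE_nat)
  have "checks (length x) (\<lambda>k. word_bit ?w (2 * k + 1)) U N a b = checks (length x) (word_bit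
      x) U N a b" for U N a b
    by (rule checks_cong) (rule word_bit_pair_word(2))
  moreover have "(\<lambda>k. word_bit ?w (2 * length x + 1 + k)) = word_bit u" by (simp only:
      word_bit_pair_word(4))
  ultimately have eq: "checks (length x) (\<lambda>k. word_bit ?w (2 * k + 1)) (\<lambda>k. word_bit ?w
      (2 * length x + 1 + k)) N a b =
      checks (length x) (word_bit x) (word_bit u) N a b" for N a b by simp
  show ?thesis
  proof
    assume "verdict ?w"
    then show "\<exists>N a b. checks (length x) (word_bit x) (word_bit u) N a b"
      unfolding verdict_def using n eq by blast
  next
    assume "\<exists>N a b. checks (length x) (word_bit x) (word_bit u) N a b"
    then obtain N a b where c: "checks (length x) (word_bit x) (word_bit u) N a b" by blast
    then have "N < length x" "a < length x" "b < length x"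
      by (auto simp: checks_def header_length_def)
    then show "verdict ?w"
      unfolding verdict_def
      using c eq[of N a b] word_bit_pair_word(1)[of _ x u] word_bit_pair_word(3)[of x u]
      by (intro exI[of _ "length x"] exI[of _ N] exI[of _ a] exI[of _ b] conjI allI impI)
        (simp_all add: length_pair_word)
  qed
qed

text \<open>Thanks to the unary numbers in the code, size and coordinates are below the length of
  the word, so every quantifier is bounded and the predicate is built by introduction rules.\<close>

lemma elem_pred_verdict: "elem_pred (\<lambda>s. verdict (fst s))"
  unfolding verdict_def checks_def header_length_def cell_ok_def cell_no_def Let_def
  by (assumption | rule elem_intros | rule elem_fun_outer elem_pred_outer | simp only: fst_outer)+

theorem Restricted_Grid_Circuit_SAT_in_NP: "Restricted_Grid_Circuit_SAT \<in> NP"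
proof -
  define V where "V w = (if verdict w then [True] else [])" for w
  \<comment> \<open>The verdict becomes the length 1 or 0 of an output whose only possible bit is
    true.\<close>
  have "poly_time_computable (\<lambda>x. map (\<lambda>i. 1 \<noteq> (0::nat)) [0..<of_bool (verdict
      (fst (x, \<lambda>_ :: nat. 0 :: nat)))])"
    by (rule elem_fun_poly_time_computable[OF elem_fun_of_bool[OF elem_pred_verdict] elem_fun_const[of 1]])
  moreover have "(\<lambda>x. map (\<lambda>i. 1 \<noteq> (0::nat)) [0..<of_bool (verdict (fst (x,
      \<lambda>_ :: nat. 0 :: nat)))]) = V"
    by (auto simp: V_def)
  ultimately have "poly_time_computable V" by simp
  moreover have "x \<in> Restricted_Grid_Circuit_SAT \<longleftrightarrow>
      (\<exists>u. length u \<le> poly [:0, 2:] (length x) \<and> V (pair_word x u) = [True])" for x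
    using checks_complete[of x] checks_sound[of x]
    by (auto simp: V_def verdict_pair_word mult.commute)
  ultimately show ?thesis unfolding NP_def by blast
qed

section \<open>Grid circuits for propositional formulas\<close>

text \<open>A square of side 6, row by row, in the notation explained below. The signal
  \<open>s\<close> comes down column 2 and \<open>h\<close> along row 2. Products are formed at
  (1,3) (\<open>s\<close> and not \<open>q\<close>), at (2,2) (\<open>h\<close> and
  \<open>s\<close>) and at (3,1) (\<open>p\<close> and \<open>h\<close>); the disjunctions at (2,3),
  (3,2) and (3,3) collect them into the mask. The guess \<open>q\<close> turns the corner (0,5) to
  meet the mask at (3,5), and the complement of \<open>p\<close> turns the corner (5,0) to meet it
  at (5,3). Thus no two paths cross, and the masked guesses leave through row 3 and column
  3.\<close>

definition pass_tile :: "block list" where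
  "pass_tile =
    [Fixed_Value, Fixed_Value, Disjunction, Selector, Disjunction, Disjunction,
     Fixed_Value, Fixed_Value, Disjunction, Conjunction, Fixed_Value, Disjunction,
     Disjunction, Disjunction, Conjunction, Disjunction, Fixed_Value, Disjunction,
     Selector, Conjunction, Disjunction, Disjunction, Disjunction, Conjunction,
     Disjunction, Fixed_Value, Fixed_Value, Disjunction, Fixed_Value, Fixed_Value,
     Disjunction, Disjunction, Disjunction, Conjunction, Fixed_Value, Fixed_Value]"

text \<open>Entry 18 is the cell (3,0): it now passes \<open>h\<close> both east and south, so
  \<open>h\<close> replaces both outputs of the selector. Entry 33 is the cell (5,3), where
  \<open>h\<close> is added to the mask rather than intersected with it.\<close>

definition join_tile :: "block list" where
  "join_tile = pass_tile[18 := Disjunction, 33 := Disjunction]"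

definition tile_block :: "bool \<Rightarrow> nat \<Rightarrow> nat \<Rightarrow> block" where
  "tile_block b i j = (if 6 * i + j < 36
     then if b then join_tile ! (6 * i + j) else pass_tile ! (6 * i + j) else Fixed_Value)"

text \<open>Here \<open>s\<close> enters from the north and \<open>h\<close> from the west. In a
    crossing, the selector at \<open>(3, 0)\<close>
  emits the guess \<open>\<not> p\<close> for \<open>s\<close> to the south, and the one at \<open>(0,
      3)\<close> the guess \<open>q\<close> for \<open>h\<close> to the
  east; both guesses are masked by \<open>p \<and> h \<or> h \<and> s \<or> s \<and> \<not> q\<close>.
      If \<open>p\<close> is false, then this implies \<open>s\<close>;
  if \<open>q\<close> is true, then it implies \<open>h\<close>; and for the right guesses it is
      \<open>s \<or> h\<close>. The other tile
  replaces the signal to the south by the disjunction of \<open>s\<close> and \<open>h\<close>.\<close>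

lemma tile_outputs:
  assumes rec: "\<And>i j. i < 6 \<Longrightarrow> j < 6 \<Longrightarrow> f i j = block_output
      (tile_block b i j) (e i j)
      (if i = 0 then j = 2 \<and> s else snd (f (i - 1) j)) (if j = 0 then i = 2 \<and> h else fst (f i
          (j - 1)))"
  shows "snd (f 5 3) = (if b then h \<or> s \<and> \<not> e 0 3
      else \<not> e 3 0 \<and> (e 3 0 \<and> h \<or> h \<and> s \<or> s \<and> \<not> e 0 3))" (is ?S)
    and "fst (f 3 5) = (e 0 3 \<and> (if b then h \<or> s \<and> \<not> e 0 3
      else e 3 0 \<and> h \<or> h \<and> s \<or> s \<and> \<not> e 0 3))" (is ?elem_fun)
proof -
  note c = tile_block_def join_tile_def pass_tile_def
  \<comment> \<open>The east and the south output of the cell (3,0) in either tile.\<close>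
  let ?p = "if b then h else e 3 0" and ?l = "if b then h else \<not> e 3 0"
  let ?m = "?p \<and> h \<or> h \<and> s \<or> s \<and> \<not> e 0 3"
  have r0: "f 0 0 = (False, False)" "f 0 (Suc 0) = (False, False)" "f 0 2 = (s, s)"
    "f 0 3 = (e 0 3, \<not> e 0 3)" "f 0 4 = (e 0 3, e 0 3)" "f 0 5 = (e 0 3, e 0 3)"
    by (simp_all add: rec c)
  have r1: "f (Suc 0) 0 = (False, False)" "f (Suc 0) (Suc 0) = (False, False)" "f (Suc 0) 2 = (s, s)"
    "f (Suc 0) 3 = (s \<and> \<not> e 0 3, s \<and> \<not> e 0 3)" "f (Suc 0) 4 = (False, False)"
    "f (Suc 0) 5 = (e 0 3, e 0 3)"
    using r0 by (simp_all add: rec c conj_commute)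
  have r2: "f 2 0 = (h, h)" "f 2 (Suc 0) = (h, h)" "f 2 2 = (h \<and> s, h \<and> s)"
    "f 2 3 = (h \<and> s \<or> s \<and> \<not> e 0 3, h \<and> s \<or> s \<and> \<not> e 0 3)" "f 2 4 =
        (False, False)"
    "f 2 5 = (e 0 3, e 0 3)"
    using r1 by (auto simp: rec c)
  have r3: "f 3 0 = (?p, ?l)" "f 3 (Suc 0) = (?p \<and> h, ?p \<and> h)"
    "f 3 2 = (?p \<and> h \<or> h \<and> s, ?p \<and> h \<or> h \<and> s)" "f 3 3 = (?m, ?m)" "f 3 4 =
        (?m, ?m)"
    "f 3 5 = (e 0 3 \<and> ?m, e 0 3 \<and> ?m)"
    using r2 by (auto simp: rec c)
  have r4: "f 4 0 = (?l, ?l)" "f 4 (Suc 0) = (False, False)" "f 4 2 = (False, False)" "f 4 3 = (?m, ?m)"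
    using r3 by (auto simp: rec c)
  have r5: "f 5 0 = (?l, ?l)" "f 5 (Suc 0) = (?l, ?l)" "f 5 2 = (?l, ?l)"
    "snd (f 5 3) = (if b then ?l \<or> ?m else ?l \<and> ?m)"
    using r4 by (auto simp: rec c)
  show ?S ?elem_fun using r5(4) r3(6) by auto
qed

text \<open>The grid is divided into square bands. The band \<open>(I, J)\<close> with \<open>1 \<le> I
    \<le> nl\<close> and \<open>1 \<le> J \<le> nc\<close> is
  where the row of the literal \<open>I - 1\<close> meets the column of the clause \<open>J -
      1\<close>. Since a tile shifts
  a signal by one cell, its place within the band depends on \<open>I\<close> and \<open>J\<close>. The
      bands \<open>(I, 0)\<close> hold the
  selectors of the variables, and the bands \<open>(nl + 1, J)\<close> the conjunction of the
      clauses.\<close>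

definition pitch :: "nat \<Rightarrow> nat \<Rightarrow> nat" where
  "pitch nl nc = nl + nc + 10"

text \<open>A tile starts at row \<open>J\<close> and column \<open>I\<close>, so its exits in row
  \<open>J + 3\<close> and column \<open>I + 3\<close> meet the entrances of the adjacent tiles. A
  variable has a single selector: its east output is the positive literal, and its south output runs
  down column 1 into the next band, where it turns east as the negative literal. The selector in the
  band \<open>(nl + 1, 0)\<close> starts the chain of conjunctions; it stands in for the constant 1,
  which no allowed block provides.\<close>

definition band_block :: "nat \<Rightarrow> nat \<Rightarrow> (nat \<Rightarrow> nat \<Rightarrow>
    bool) \<Rightarrow> nat \<Rightarrow> nat \<Rightarrow> nat \<Rightarrow> nat \<Rightarrow> block" where
  "band_block nl nc inc I J r c =
    (if 1 \<le> I \<and> I \<le> nl \<and> J = 0 then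
       if odd I then
         if r = 3 \<and> c = 1 then Selector
         else if r = 3 \<and> 2 \<le> c \<or> 4 \<le> r \<and> c = 1 then Disjunction else Fixed_Value
       else if r \<le> 3 \<and> c = 1 \<or> r = 3 \<and> 2 \<le> c then Disjunction else Fixed_Value
     else if 1 \<le> I \<and> I \<le> nl \<and> 1 \<le> J \<and> J \<le> nc then
       if J \<le> r \<and> r < J + 6 \<and> I \<le> c \<and> c < I + 6 then tile_block (inc (J - 1) (I
           - 1)) (r - J) (c - I)
       else if r < J \<and> c = I + 2 \<or> J + 6 \<le> r \<and> c = I + 3 \<or> c < I \<and> r = J + 2
           \<or> I + 6 \<le> c \<and> r = J + 3
       then Disjunction else Fixed_Value
     else if I = nl + 1 \<and> J = 0 then
       if r = 2 \<and> c = 1 then Selector else if r = 2 \<and> 2 \<le> c then Disjunction else Fixed_Value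
     else if I = nl + 1 \<and> 1 \<le> J \<and> J \<le> nc then
       if r = 2 \<and> c = nl + 3 then Conjunction
       else if r = 2 \<or> r < 2 \<and> c = nl + 3 then Disjunction else Fixed_Value
     else Fixed_Value)"

definition formula_circuit :: "nat \<Rightarrow> nat \<Rightarrow> (nat \<Rightarrow> nat \<Rightarrow>
    bool) \<Rightarrow> grid_circuit" where
  "formula_circuit nl nc inc = (let P = pitch nl nc in
     \<lparr>grid_size = P * (nl + nc + 2),
      block_at = (\<lambda>i j. band_block nl nc inc (i div P) (j div P) (i mod P) (j mod P))\<rparr>)"

definition formula_query :: "nat \<Rightarrow> nat \<Rightarrow> nat \<times> nat" where
  "formula_query nl nc = (let P = pitch nl nc in (P * (nl + 1) + 2, P * nc + (P - 1)))"

definition literal_true :: "(nat \<Rightarrow> bool) \<Rightarrow> nat \<Rightarrow> bool" where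
  "literal_true \<alpha> l \<longleftrightarrow> \<alpha> (l div 2) = even l"

section \<open>Signals in band coordinates\<close>

context
  fixes nl nc :: nat and inc :: "nat \<Rightarrow> nat \<Rightarrow> bool" and u :: assignment
begin

private abbreviation "P \<equiv> pitch nl nc"
private abbreviation "blk \<equiv> band_block nl nc inc"
private abbreviation "C \<equiv> formula_circuit nl nc inc"

definition out :: "nat \<Rightarrow> nat \<Rightarrow> nat \<Rightarrow> nat \<Rightarrow> bool
    \<times> bool" where
  "out I J r c = outputs C u (P * I + r) (P * J + c)"

definition usel :: "nat \<Rightarrow> nat \<Rightarrow> nat \<Rightarrow> nat \<Rightarrow> bool" where
  "usel I J r c = u (P * I + r, P * J + c)"

lemma pitch_pos: "0 < P"
  by (simp add: pitch_def)

lemma out_rec: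
  assumes "r < P" "c < P"
  shows "out I J r c = block_output (blk I J r c) (usel I J r c)
     (if r = 0 then I \<noteq> 0 \<and> snd (out (I - 1) J (P - 1) c) else snd (out I J (r - 1) c))
     (if c = 0 then J \<noteq> 0 \<and> fst (out I (J - 1) r (P - 1)) else fst (out I J r (c - 1)))"
proof -
  have pred: "P * K + 0 - 1 = P * (K - 1) + (P - 1)" if "K \<noteq> 0" for K
    using that pitch_pos by (cases K) auto
  have "block_at C (P * I + r) (P * J + c) = blk I J r c"
    using assms by (simp add: formula_circuit_def Let_def)
  then show ?thesis
    unfolding out_def usel_def outputs.simps[of C u "P * I + r" "P * J + c"]
    using pred[of I] pred[of J] pitch_pos
    by (cases "r = 0"; cases "c = 0"; cases "I = 0"; cases "J = 0") simp_all
qed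

lemma out_fixed: "r < P \<Longrightarrow> c < P \<Longrightarrow> blk I J r c = Fixed_Value
    \<Longrightarrow> out I J r c = (False, False)"
  by (subst out_rec) auto

text \<open>Without signal multipliers, a wire is a column of disjunctions; a fixed-value block to
  the west of each keeps the second input at 0.\<close>

lemma vertical_wire:
  assumes "r \<le> r'" "r' < P" "1 \<le> c" "c < P"
    and "\<And>k. r < k \<Longrightarrow> k \<le> r' \<Longrightarrow> blk I J k c = Disjunction \<and>
        blk I J k (c - 1) = Fixed_Value"
  shows "snd (out I J r' c) = snd (out I J r c)"
  using assms
proof (induction r' rule: dec_induct)
  case (step k)
  have "fst (out I J (Suc k) (c - 1)) = False" using step by (subst out_fixed) auto
  moreover have "snd (out I J k c) = snd (out I J r c)" using step by auto
  moreover have "blk I J (Suc k) c = Disjunction" using step by auto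
  ultimately show ?case using step by (subst out_rec) auto
qed simp

lemma horizontal_wire:
  assumes "c \<le> c'" "c' < P" "1 \<le> r" "r < P"
    and "\<And>k. c < k \<Longrightarrow> k \<le> c' \<Longrightarrow> blk I J r k = Disjunction \<and>
        blk I J (r - 1) k = Fixed_Value"
  shows "fst (out I J r c') = fst (out I J r c)"
  using assms
proof (induction c' rule: dec_induct)
  case (step k)
  have "snd (out I J (r - 1) (Suc k)) = False" using step by (subst out_fixed) auto
  moreover have "fst (out I J r k) = fst (out I J r c)" using step by auto
  moreover have "blk I J r (Suc k) = Disjunction" using step by auto
  ultimately show ?case using step by (subst out_rec) auto
qed simp

text \<open>Signals at the borders of bands: \<open>ver I J\<close> is what the column of clause
  \<open>J - 1\<close> carries into the band \<open>(I, J)\<close>, and \<open>hor I J\<close> is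
  what the row of literal \<open>I - 1\<close> carries into it.\<close>

definition ver :: "nat \<Rightarrow> nat \<Rightarrow> bool" where
  "ver I J = snd (out (I - 1) J (P - 1) (I + 2))"

definition hor :: "nat \<Rightarrow> nat \<Rightarrow> bool" where
  "hor I J = fst (out I (J - 1) (J + 2) (P - 1))"

text \<open>Wires bring the two incoming signals to the ports of the tile and its outputs to the far
  borders, so the band acts on border signals as the tile does on its ports.\<close>

lemma tile_signals:
  assumes I: "1 \<le> I" "I \<le> nl" and J: "1 \<le> J" "J \<le> nc"
  defines "b \<equiv> inc (J - 1) (I - 1)" and "p \<equiv> usel I J (J + 3) I" and "q \<equiv> usel I J
      J (I + 3)"
    and "s \<equiv> ver I J" and "h \<equiv> hor I J"
  shows "ver (I + 1) J = (if b then h \<or> s \<and> \<not> q else \<not> p \<and> (p \<and> h \<or> h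
      \<and> s \<or> s \<and> \<not> q))" (is ?V)
    and "hor I (J + 1) = (q \<and> (if b then h \<or> s \<and> \<not> q else p \<and> h \<or> h \<and>
        s \<or> s \<and> \<not> q))" (is ?H)
proof -
  \<comment> \<open>The pitch leaves room for a tile of side 6 at every offset that occurs, with
    wires before and behind it.\<close>
  have P: "I + 9 < P" "J + 9 < P" using I J by (simp_all add: pitch_def)
  have s: "snd (out I J (J - 1) (I + 2)) = s"
  proof -
    have "snd (out I J (J - 1) (I + 2)) = snd (out I J 0 (I + 2))"
      by (rule vertical_wire) (use I J P in \<open>auto simp: band_block_def\<close>)
    also have "\<dots> = s"
    proof -
      have "out I J 0 (I + 1) = (False, False)"
        by (rule out_fixed) (use I J P in \<open>auto simp: band_block_def\<close>)
      moreover have "blk I J 0 (I + 2) = Disjunction" using I J by (auto simp: band_block_def)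
      ultimately show ?thesis using I P by (subst out_rec) (auto simp: s_def ver_def)
    qed
    finally show ?thesis .
  qed
  have h: "fst (out I J (J + 2) (I - 1)) = h"
  proof -
    have "fst (out I J (J + 2) (I - 1)) = fst (out I J (J + 2) 0)"
      by (rule horizontal_wire) (use I J P in \<open>auto simp: band_block_def\<close>)
    also have "\<dots> = h"
    proof -
      have "out I J (J + 1) 0 = (False, False)"
        by (rule out_fixed) (use I J P in \<open>auto simp: band_block_def\<close>)
      moreover have "blk I J (J + 2) 0 = Disjunction" using I J by (auto simp: band_block_def)
      ultimately show ?thesis using J P by (subst out_rec) (auto simp: h_def hor_def)
    qed
    finally show ?thesis .
  qed
  define f where "f i j = out I J (J + i) (I + j)" for i j
  have rec: "f i j = block_output (tile_block b i j) (usel I J (J + i) (I + j))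
      (if i = 0 then j = 2 \<and> s else snd (f (i - 1) j)) (if j = 0 then i = 2 \<and> h else fst (f i
          (j - 1)))"
    if ij: "i < 6" "j < 6" for i j
  proof -
    have 1: "blk I J (J + i) (I + j) = tile_block b i j"
      using I J ij by (simp add: band_block_def b_def)
    have 2: "snd (out I J (J + i - 1) (I + j)) = (if i = 0 then j = 2 \<and> s else snd (f (i - 1) j))"
    proof (cases "i = 0 \<and> j \<noteq> 2")
      case True
      then have "out I J (J - 1) (I + j) = (False, False)"
        using I J P ij by (intro out_fixed) (auto simp: band_block_def)
      with True show ?thesis by simp
    next
      case False
      then show ?thesis using s by (auto simp: f_def)
    qed
    have 3: "fst (out I J (J + i) (I + j - 1)) = (if j = 0 then i = 2 \<and> h else fst (f i (j - 1)))"
    proof (cases "j = 0 \<and> i \<noteq> 2")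
      case True
      then have "out I J (J + i) (I - 1) = (False, False)"
        using I J P ij by (intro out_fixed) (auto simp: band_block_def)
      with True show ?thesis by simp
    next
      case False
      then show ?thesis using h by (auto simp: f_def)
    qed
    have "f i j = block_output (tile_block b i j) (usel I J (J + i) (I + j))
      (snd (out I J (J + i - 1) (I + j))) (fst (out I J (J + i) (I + j - 1)))"
      unfolding f_def using I J P ij 1 by (subst out_rec) auto
    then show ?thesis by (simp only: 2 3)
  qed
  have "ver (I + 1) J = snd (out I J (P - 1) (I + 3))"
    by (simp add: ver_def eval_nat_numeral)
  also have "\<dots> = snd (out I J (J + 5) (I + 3))"
    by (rule vertical_wire) (use I J P in \<open>auto simp: band_block_def\<close>)
  also have "out I J (J + 5) (I + 3) = f 5 3" by (simp add: f_def)
  finally show ?V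
    using tile_outputs(1)[of f b "\<lambda>i j. usel I J (J + i) (I + j)" s h, OF rec] by (simp add:
        p_def q_def)
  have "hor I (J + 1) = fst (out I J (J + 3) (P - 1))"
    by (simp add: hor_def eval_nat_numeral)
  also have "\<dots> = fst (out I J (J + 3) (I + 5))"
    by (rule horizontal_wire) (use I J P in \<open>auto simp: band_block_def\<close>)
  also have "out I J (J + 3) (I + 5) = f 3 5" by (simp add: f_def)
  finally show ?H
    using tile_outputs(2)[of f b "\<lambda>i j. usel I J (J + i) (I + j)" s h, OF rec] by (simp add:
        p_def q_def)
qed

lemma ver_first: "J \<le> nc \<Longrightarrow> \<not> ver 1 J"
  unfolding ver_def by (subst out_fixed) (auto simp: pitch_def band_block_def)

text \<open>For odd \<open>l\<close> the selector lies one band higher, and its south output arrives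
  through column 1. So both literals of a variable depend on the same selector.\<close>

lemma hor_first:
  assumes "l < nl"
  shows "hor (l + 1) 1 = (usel (2 * (l div 2) + 1) 0 3 1 = even l)"
proof -
  have P: "9 < P" by (simp add: pitch_def)
  have "hor (l + 1) 1 = fst (out (l + 1) 0 3 (P - 1))"
    by (simp add: hor_def eval_nat_numeral)
  also have "\<dots> = fst (out (l + 1) 0 3 1)"
    by (rule horizontal_wire) (use assms P in \<open>auto simp: band_block_def\<close>)
  also have "\<dots> = (usel (2 * (l div 2) + 1) 0 3 1 = even l)"
  proof (cases "even l")
    case True
    then have "blk (l + 1) 0 3 1 = Selector" using assms by (simp add: band_block_def)
    then show ?thesis using True P by (subst out_rec) auto
  next
    case False
    then have l: "2 * (l div 2) + 1 = l" "l \<noteq> 0" by (auto elim: oddE)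
    have "blk (l + 1) 0 3 1 = Disjunction" using assms False by (simp add: band_block_def)
    then have "fst (out (l + 1) 0 3 1) = snd (out (l + 1) 0 3 1)" using P by (subst (1 2) out_rec) auto
    also have "\<dots> = snd (out (l + 1) 0 0 1)"
      by (rule vertical_wire) (use assms False P in \<open>auto simp: band_block_def\<close>)
    also have "\<dots> = snd (out l 0 (P - 1) 1)"
    proof -
      have "out (l + 1) 0 0 0 = (False, False)"
        by (rule out_fixed) (use assms P in \<open>auto simp: band_block_def\<close>)
      moreover have "blk (l + 1) 0 0 1 = Disjunction" using assms False by (simp add: band_block_def)
      ultimately show ?thesis using P by (subst out_rec) auto
    qed
    also have "\<dots> = snd (out l 0 3 1)"
      by (rule vertical_wire) (use assms False l P in \<open>auto simp: band_block_def\<close>)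
    also have "\<dots> = (\<not> usel l 0 3 1)"
    proof -
      have "blk l 0 3 1 = Selector" using assms False l by (simp add: band_block_def)
      then show ?thesis using P by (subst out_rec) auto
    qed
    finally show ?thesis using False l by simp
  qed
  finally show ?thesis .
qed

text \<open>The conjunction of the starting selector with the first \<open>J\<close> clauses, as it
  leaves the band \<open>(nl + 1, J)\<close>; \<open>acc nc\<close> is the queried value.\<close>

definition acc :: "nat \<Rightarrow> bool" where
  "acc J = fst (out (nl + 1) J 2 (P - 1))"

lemma acc_0: "acc 0 = usel (nl + 1) 0 2 1"
proof -
  have P: "9 < P" by (simp add: pitch_def)
  have "acc 0 = fst (out (nl + 1) 0 2 1)"
    unfolding acc_def by (rule horizontal_wire) (use P in \<open>auto simp: band_block_def\<close>)
  also have "\<dots> = usel (nl + 1) 0 2 1"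
  proof -
    have "blk (nl + 1) 0 2 1 = Selector" by (simp add: band_block_def)
    then show ?thesis using P by (subst out_rec) auto
  qed
  finally show ?thesis .
qed

lemma acc_rec:
  assumes J: "1 \<le> J" "J \<le> nc"
  shows "acc J = (acc (J - 1) \<and> ver (nl + 1) J)"
proof -
  have P: "nl + 9 < P" using J by (simp add: pitch_def)
  have "fst (out (nl + 1) J 2 (nl + 2)) = fst (out (nl + 1) J 2 0)"
    by (rule horizontal_wire) (use J P in \<open>auto simp: band_block_def\<close>)
  also have "\<dots> = acc (J - 1)"
  proof -
    have "out (nl + 1) J 1 0 = (False, False)"
      by (rule out_fixed) (use J P in \<open>auto simp: band_block_def\<close>)
    moreover have "blk (nl + 1) J 2 0 = Disjunction" using J by (auto simp: band_block_def)
    ultimately show ?thesis using J P by (subst out_rec) (auto simp: acc_def)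
  qed
  finally have w: "fst (out (nl + 1) J 2 (nl + 2)) = acc (J - 1)" .
  have "snd (out (nl + 1) J 1 (nl + 3)) = snd (out (nl + 1) J 0 (nl + 3))"
    by (rule vertical_wire) (use J P in \<open>auto simp: band_block_def\<close>)
  also have "\<dots> = ver (nl + 1) J"
  proof -
    have "out (nl + 1) J 0 (nl + 2) = (False, False)"
      by (rule out_fixed) (use J P in \<open>auto simp: band_block_def\<close>)
    moreover have "blk (nl + 1) J 0 (nl + 3) = Disjunction" using J by (auto simp: band_block_def)
    moreover have "nl + 3 - 1 = nl + 2" "nl + 1 + 2 = nl + 3" by simp_all
    ultimately show ?thesis using J P by (subst out_rec) (auto simp: ver_def numeral_3_eq_3)
  qed
  finally have n: "snd (out (nl + 1) J 1 (nl + 3)) = ver (nl + 1) J" .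
  have "acc J = fst (out (nl + 1) J 2 (nl + 3))"
    unfolding acc_def by (rule horizontal_wire) (use J P in \<open>auto simp: band_block_def\<close>)
  also have "\<dots> = (acc (J - 1) \<and> ver (nl + 1) J)"
  proof -
    have "blk (nl + 1) J 2 (nl + 3) = Conjunction" using J by (auto simp: band_block_def)
    moreover have "nl + 3 - 1 = nl + 2" "2 - 1 = (1::nat)" by simp_all
    ultimately show ?thesis using P w n by (subst out_rec) auto
  qed
  finally show ?thesis .
qed

lemma acc_iff: "J \<le> nc \<Longrightarrow> acc J \<longleftrightarrow> usel (nl + 1) 0 2 1 \<and>
    (\<forall>c<J. ver (nl + 1) (c + 1))"
proof (induction J)
  case (Suc J)
  then show ?case using acc_rec[of "Suc J"] by (auto simp: less_Suc_eq)
qed (simp add: acc_0)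

lemma block_value_formula_query:
  "block_value C u (formula_query nl nc) \<longleftrightarrow> usel (nl + 1) 0 2 1 \<and>
      (\<forall>c<nc. ver (nl + 1) (c + 1))"
  using acc_iff[of nc] by (simp add: acc_def out_def block_value_def formula_query_def Let_def)

text \<open>Whatever the guesses, the east output of a tile implies \<open>q\<close> and the mask,
  and these two together imply \<open>h\<close>. A row can only lose its signal.\<close>

lemma hor_mono:
  assumes "l < nl" "1 \<le> J" "J \<le> nc" "hor (l + 1) (J + 1)"
  shows "hor (l + 1) J"
proof -
  have "1 \<le> l + 1" "l + 1 \<le> nl" using assms by simp_all
  from tile_signals(2)[OF this assms(2,3)] assms(4) show ?thesis by (simp only: split: if_splits) blast+
qed

text \<open>In a crossing, the south output requires not \<open>p\<close> as well as the mask, which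
  leaves only summands that contain \<open>s\<close>. So a column gains a signal only from the row
  of a literal of its clause.\<close>

lemma ver_cases:
  assumes "l < nl" "1 \<le> J" "J \<le> nc" "ver (l + 2) J"
  shows "ver (l + 1) J \<or> inc (J - 1) l \<and> hor (l + 1) J"
proof -
  have l: "1 \<le> l + 1" "l + 1 \<le> nl" "l + 1 + 1 = l + 2" "l + 1 - 1 = l" using assms by simp_all
  from tile_signals(1)[OF l(1,2) assms(2,3)] assms(4) show ?thesis
    unfolding l(3,4) by (simp only: split: if_splits) blast+
qed

lemma hor_sound:
  "l < nl \<Longrightarrow> J < nc \<Longrightarrow> hor (l + 1) (J + 1) \<Longrightarrow> literal_true
      (\<lambda>k. usel (2 * k + 1) 0 3 1) l"
proof (induction J)
  case 0
  then show ?case using hor_first[of l] by (simp add: literal_true_def)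
next
  case (Suc J)
  then show ?case using hor_mono[of l "Suc J"] by simp
qed

lemma ver_sound:
  "l \<le> nl \<Longrightarrow> J < nc \<Longrightarrow> ver (l + 1) (J + 1) \<Longrightarrow>
    \<exists>k<l. inc J k \<and> literal_true (\<lambda>k. usel (2 * k + 1) 0 3 1) k"
proof (induction l)
  case 0
  then show ?case using ver_first[of "J + 1"] by simp
next
  case (Suc l)
  then have "ver (l + 1) (J + 1) \<or> inc J l \<and> hor (l + 1) (J + 1)"
    using ver_cases[of l "J + 1"] by simp
  then show ?case
  proof
    assume "ver (l + 1) (J + 1)"
    with Suc show ?thesis using less_Suc_eq by auto
  next
    assume "inc J l \<and> hor (l + 1) (J + 1)"
    with Suc.prems show ?thesis using hor_sound[of l J] by auto
  qed
qed

text \<open>The prescribed guesses are the right ones: \<open>p\<close> is the negation of the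
  disjunction collected so far and \<open>q\<close> is the literal. For them no tile loses a
  signal.\<close>

lemma signals_complete:
  assumes sel: "\<And>l. l < nl \<Longrightarrow> usel (2 * (l div 2) + 1) 0 3 1 = \<alpha> (l div 2)"
    and p: "\<And>l J. l < nl \<Longrightarrow> J < nc \<Longrightarrow>
      usel (l + 1) (J + 1) (J + 1 + 3) (l + 1) = (\<forall>k<l. \<not> (inc J k \<and> literal_true
          \<alpha> k))"
    and q: "\<And>l J. l < nl \<Longrightarrow> J < nc \<Longrightarrow> usel (l + 1) (J + 1) (J + 1)
        (l + 1 + 3) = literal_true \<alpha> l"
  shows "l \<le> nl \<Longrightarrow> J < nc \<Longrightarrow> ver (l + 1) (J + 1) = (\<exists>k<l. inc
      J k \<and> literal_true \<alpha> k)"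
proof (induction l arbitrary: J)
  case 0
  then show ?case using ver_first[of "J + 1"] by simp
next
  case (Suc l)
  define Q where "Q J = (\<exists>k<l. inc J k \<and> literal_true \<alpha> k)" for J
  have l: "1 \<le> l + 1" "l + 1 \<le> nl" "l < nl" "l + 1 - 1 = l" using Suc.prems by simp_all
  have ver: "ver (l + 1) (J + 1) = Q J" if "J < nc" for J
    using Suc.IH[of J] l that by (simp add: Q_def)
  have p': "usel (l + 1) (J + 1) (J + 1 + 3) (l + 1) = (\<not> Q J)" if "J < nc" for J
    unfolding p[OF l(3) that] Q_def by blast
  \<comment> \<open>Following the row of \<open>l\<close> through all clauses requires the column
    signals above this row for every clause; hence the outer induction keeps \<open>J\<close>
    arbitrary.\<close>
  have hor: "hor (l + 1) (J + 1) = literal_true \<alpha> l" if "J < nc" for J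
    using that
  proof (induction J)
    case 0
    then show ?case using hor_first[of l] sel[of l] l by (simp add: literal_true_def)
  next
    case (Suc J)
    then have J: "1 \<le> J + 1" "J + 1 \<le> nc" "J < nc" "J + 1 - 1 = J" "Suc J = J + 1" by simp_all
    show ?case
      using tile_signals(2)[OF l(1,2) J(1,2)]
      unfolding Suc.IH[OF J(3)] ver[OF J(3)] p'[OF J(3)] q[OF l(3) J(3)] J(4,5) l(4)
      by (simp only: split: if_splits) blast+
  qed
  have J: "1 \<le> J + 1" "J + 1 \<le> nc" "J + 1 - 1 = J" using Suc.prems by simp_all
  have "ver (l + 1 + 1) (J + 1) = (Q J \<or> inc J l \<and> literal_true \<alpha> l)"
    using tile_signals(1)[OF l(1,2) J(1,2)]
    unfolding hor[OF Suc.prems(2)] ver[OF Suc.prems(2)] p'[OF Suc.prems(2)] q[OF l(3) Suc.prems(2)]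
        J(3) l(4)
    by (simp only: split: if_splits) blast+
  then have "ver (Suc l + 1) (J + 1) = (Q J \<or> inc J l \<and> literal_true \<alpha> l)" by simp
  then show ?case by (auto simp: less_Suc_eq Q_def)
qed

end

theorem formula_circuit_satisfiable:
  "(\<exists>u. block_value (formula_circuit nl nc inc) u (formula_query nl nc)) \<longleftrightarrow>
   (\<exists>\<alpha>. \<forall>c<nc. \<exists>l<nl. inc c l \<and> literal_true \<alpha> l)"
proof
  assume "\<exists>u. block_value (formula_circuit nl nc inc) u (formula_query nl nc)"
  then obtain u where u: "block_value (formula_circuit nl nc inc) u (formula_query nl nc)" by blast
  show "\<exists>\<alpha>. \<forall>c<nc. \<exists>l<nl. inc c l \<and> literal_true \<alpha> l"
    using u ver_sound[of nl nl _ nc inc u] unfolding block_value_formula_query by blast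
next
  let ?P = "pitch nl nc"
  assume "\<exists>\<alpha>. \<forall>c<nc. \<exists>l<nl. inc c l \<and> literal_true \<alpha> l"
  then obtain \<alpha> where \<alpha>: "\<forall>c<nc. \<exists>l<nl. inc c l \<and> literal_true
      \<alpha> l" by blast
  \<comment> \<open>Bands with \<open>J = 0\<close> hold the variables and the starting selector of
    the conjunction, which has to be true. Inside a tile, the column offset \<open>I + 3\<close>
    marks the guess for the row; the other selector guesses for the column.\<close>
  define u where "u = (\<lambda>(i, j). let I = i div ?P; J = j div ?P; c = j mod ?P in
     if J = 0 then I = nl + 1 \<or> \<alpha> ((I - 1) div 2)
     else if c = I + 3 then literal_true \<alpha> (I - 1)
     else \<forall>k<I - 1. \<not> (inc (J - 1) k \<and> literal_true \<alpha> k))"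
  have "block_value (formula_circuit nl nc inc) u (formula_query nl nc)"
    unfolding block_value_formula_query
  proof (intro conjI allI impI)
    have P: "nl + nc + 9 < ?P" by (simp add: pitch_def)
    have usel: "usel nl nc u I J r c = (if J = 0 then I = nl + 1 \<or> \<alpha> ((I - 1) div 2)
       else if c = I + 3 then literal_true \<alpha> (I - 1)
       else \<forall>k<I - 1. \<not> (inc (J - 1) k \<and> literal_true \<alpha> k))" if "r < ?P" "c <
           ?P" for I J r c
      using that by (simp add: usel_def u_def)
    show "usel nl nc u (nl + 1) 0 2 1" using P by (subst usel) auto
    fix c assume c: "c < nc"
    have "ver nl nc inc u (nl + 1) (c + 1) = (\<exists>k<nl. inc c k \<and> literal_true \<alpha> k)"
    proof (rule signals_complete)
      show "usel nl nc u (2 * (l div 2) + 1) 0 3 1 = \<alpha> (l div 2)" if "l < nl" for l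
      proof -
        have "2 * (l div 2) \<noteq> nl" using that by linarith
        then show ?thesis using P by (subst usel) auto
      qed
    next
      show "usel nl nc u (l + 1) (J + 1) (J + 1 + 3) (l + 1) = (\<forall>k<l. \<not> (inc J k \<and>
          literal_true \<alpha> k))"
        "usel nl nc u (l + 1) (J + 1) (J + 1) (l + 1 + 3) = literal_true \<alpha> l"
        if "l < nl" "J < nc" for l J
        using that P by (subst usel; simp)+
    qed (use c in simp_all)
    then show "ver nl nc inc u (nl + 1) (c + 1)" using \<alpha> c by simp
  qed
  then show "\<exists>u. block_value (formula_circuit nl nc inc) u (formula_query nl nc)" by blast
qed

lemma formula_circuit_embedded: "grid_embedded (formula_circuit nl nc inc)"
  by (auto simp: grid_embedded_def formula_circuit_def Let_def band_block_def)

lemma tile_block_restricted: "tile_block b i j \<in> {Conjunction, Disjunction, Fixed_Value, Selector}"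
proof -
  have "length join_tile = 36" "length pass_tile = 36"
    by (simp_all add: join_tile_def pass_tile_def)
  then have "6 * i + j < 36 \<Longrightarrow> join_tile ! (6 * i + j) \<in> set join_tile"
    "6 * i + j < 36 \<Longrightarrow> pass_tile ! (6 * i + j) \<in> set pass_tile"
    by simp_all
  moreover have "set join_tile \<subseteq> {Conjunction, Disjunction, Fixed_Value, Selector}"
    "set pass_tile \<subseteq> {Conjunction, Disjunction, Fixed_Value, Selector}"
    by (simp_all add: join_tile_def pass_tile_def)
  ultimately show ?thesis unfolding tile_block_def by (cases "6 * i + j < 36"; cases b) auto
qed

lemma formula_circuit_restricted: "restricted_circuit (formula_circuit nl nc inc)"
proof -
  let ?X = "{Conjunction, Disjunction, Fixed_Value, Selector}"
  have if_mem: "(if Q then x else y) \<in> ?X" if "Q \<Longrightarrow> x \<in> ?X" "\<not> Q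
      \<Longrightarrow> y \<in> ?X" for Q x y
    using that by simp
  have "band_block nl nc inc I J r c \<in> ?X" for I J r c
    unfolding band_block_def by (intro if_mem tile_block_restricted) auto
  then show ?thesis by (simp add: restricted_circuit_def formula_circuit_def Let_def)
qed

lemma formula_query_less:
  "fst (formula_query nl nc) < grid_size (formula_circuit nl nc inc)"
  "snd (formula_query nl nc) < grid_size (formula_circuit nl nc inc)"
proof -
  let ?P = "pitch nl nc"
  have P: "2 < ?P" by (simp add: pitch_def)
  have le: "?P * (nl + 1) + ?P \<le> ?P * (nl + nc + 2)" "?P * nc + ?P \<le> ?P * (nl + nc + 2)"
    using mult_le_mono2[of "nl + 2" "nl + nc + 2" ?P] mult_le_mono2[of "nc + 1" "nl + nc + 2" ?P]
    by simp_all
  have "?P * (nl + 1) + 2 < ?P * (nl + nc + 2)" using le(1) P by linarith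
  then show "fst (formula_query nl nc) < grid_size (formula_circuit nl nc inc)"
    by (simp only: formula_query_def formula_circuit_def Let_def fst_conv grid_circuit.simps)
  have "?P * nc + (?P - 1) < ?P * (nl + nc + 2)" using le(2) P by linarith
  then show "snd (formula_query nl nc) < grid_size (formula_circuit nl nc inc)"
    by (simp only: formula_query_def formula_circuit_def Let_def snd_conv grid_circuit.simps)
qed

section \<open>Generating the circuit in polynomial time\<close>

lemma elem_pred_table: "elem_fun f \<Longrightarrow> elem_pred (\<lambda>s. f s < n \<and> h (f s))"
proof -
  assume "elem_fun f"
  then have "elem_fun (\<lambda>s. if f s < n then of_bool (h (f s)) else 0)" by (rule elem_fun_table)
  moreover have "(\<lambda>s. if f s < n then of_bool (h (f s)) else 0 :: nat) = (\<lambda>s. of_bool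
      (f s < n \<and> h (f s)))"
    by auto
  ultimately show ?thesis by (simp add: elem_pred_def)
qed

text \<open>Blocks are not numbers, so it is the equations with a fixed block \<open>b\<close> that
  are shown to be elementary; this rule pushes such an equation through a conditional.\<close>

lemma elem_pred_block_if:
  "elem_pred P \<Longrightarrow> elem_pred (\<lambda>s. x s = b) \<Longrightarrow> elem_pred
      (\<lambda>s. y s = b) \<Longrightarrow> elem_pred (\<lambda>s. (if P s then x s else y s) = b)"
  for x :: "state \<Rightarrow> block"
  unfolding if_distrib[of "\<lambda>z. z = b"] by (rule elem_pred_if)

lemma elem_pred_tile_block:
  assumes "elem_pred Q" "elem_fun i" "elem_fun j"
  shows "elem_pred (\<lambda>s. tile_block (Q s) (i s) (j s) = b)"
proof -
  define n where "n s = 6 * i s + j s" for s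
  have n: "elem_fun n" unfolding n_def by (intro elem_fun.Add elem_fun_mult elem_fun_const assms)
  have "tile_block (Q s) (i s) (j s) = b \<longleftrightarrow>
      (if Q s then n s < 36 \<and> join_tile ! n s = b else n s < 36 \<and> pass_tile ! n s = b) \<or>
      \<not> n s < 36 \<and> Fixed_Value = b" for s
    by (auto simp: tile_block_def n_def)
  moreover have "elem_pred (\<lambda>s. (if Q s then n s < 36 \<and> join_tile ! n s = b else n s < 36
      \<and> pass_tile ! n s = b) \<or>
      \<not> n s < 36 \<and> Fixed_Value = b)"
    by (rule elem_pred_disj elem_pred_if elem_pred_table elem_pred_conj elem_pred_not elem_pred_less
        elem_pred_const elem_fun_const n assms)+
  ultimately show ?thesis by simp
qed

lemma elem_pred_odd: "elem_fun f \<Longrightarrow> elem_pred (\<lambda>s. odd (f s))"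
  unfolding odd_iff_mod_2_eq_one by (intro elem_pred_eq elem_fun_mod elem_fun_const)

context
  fixes nl nc :: "bool list \<Rightarrow> nat" and inc :: "bool list \<Rightarrow> nat \<Rightarrow>
      nat \<Rightarrow> bool"
  assumes nl: "elem_fun (\<lambda>s. nl (fst s))" and nc: "elem_fun (\<lambda>s. nc (fst s))"
    and inc: "\<And>f g. elem_fun f \<Longrightarrow> elem_fun g \<Longrightarrow> elem_pred
        (\<lambda>s. inc (fst s) (f s) (g s))"
begin

lemma elem_pred_band_block:
  assumes "elem_fun I" "elem_fun J" "elem_fun r" "elem_fun c"
  shows "elem_pred (\<lambda>s. band_block (nl (fst s)) (nc (fst s)) (inc (fst s)) (I s) (J s) (r s) (c
      s) = b)"
  unfolding band_block_def
  by (rule elem_pred_block_if elem_pred_tile_block elem_pred_odd elem_pred_const elem_fun_const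
      elem_fun.Add elem_fun.Diff elem_fun_mult elem_pred_not elem_pred_conj elem_pred_disj
      elem_pred_le elem_pred_less elem_pred_eq inc nl nc assms)+

lemma elem_fun_pitch: "elem_fun (\<lambda>s. pitch (nl (fst s)) (nc (fst s)))"
  unfolding pitch_def by (intro elem_fun.Add nl nc elem_fun_const)

lemma elem_pred_formula_block:
  assumes "elem_fun i" "elem_fun j"
  shows "elem_pred (\<lambda>s. block_at (formula_circuit (nl (fst s)) (nc (fst s)) (inc (fst s))) (i
      s) (j s) = b)"
  unfolding formula_circuit_def Let_def grid_circuit.simps
  by (intro elem_pred_band_block elem_fun_div elem_fun_mod elem_fun_pitch assms)

lemma block_code_nth:
  assumes "b \<in> {Conjunction, Disjunction, Fixed_Value, Selector}" "r < 3"
  shows "block_code b ! r \<longleftrightarrow> r = 0 \<and> b = Selector \<or> r = 1 \<and> (b =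
      Selector \<or> b = Fixed_Value) \<or>
    r = 2 \<and> (b = Fixed_Value \<or> b = Disjunction)"
proof -
  have "r = 0 \<or> r = 1 \<or> r = 2" using assms(2) by linarith
  then show ?thesis using assms(1) by auto
qed

lemma formula_reduction:
  "poly_time_computable (\<lambda>x. instance_code (formula_circuit (nl x) (nc x) (inc x))
      (formula_query (nl x) (nc x)))"
proof -
  define C where "C x = formula_circuit (nl x) (nc x) (inc x)" for x
  define N where "N x = grid_size (C x)" for x
  define a where "a x = fst (formula_query (nl x) (nc x))" for x
  define b where "b x = snd (formula_query (nl x) (nc x))" for x
  define len where "len s = header_length (N (fst s)) (a (fst s)) (b (fst s)) + 3 * (N (fst s) * N (fst s))"
    for s :: state
  define h where "h s = header_length (N (fst s)) (a (fst s)) (b (fst s))" for s :: state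
  define l where "l s = bound_var s - h s" for s
  define B where "B s = block_at (C (fst s)) (l s div 3 div N (fst s)) (l s div 3 mod N (fst s))" for s
  have N: "elem_fun (\<lambda>s. N (fst s))" unfolding N_def C_def formula_circuit_def Let_def
      grid_circuit.simps
    by (intro elem_fun.Add nl nc elem_fun_pitch elem_fun_mult elem_fun_const)
  have a: "elem_fun (\<lambda>s. a (fst s))" and b: "elem_fun (\<lambda>s. b (fst s))"
    unfolding a_def b_def formula_query_def Let_def fst_conv snd_conv
    by (intro elem_fun.Add elem_fun.Diff nl nc elem_fun_pitch elem_fun_mult elem_fun_const)+
  have h: "elem_fun h" unfolding h_def header_length_def by (intro elem_fun.Add N a b elem_fun_const)
  have len: "elem_fun len" unfolding len_def header_length_def by (intro elem_fun.Add N a b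
      elem_fun_const elem_fun_mult)
  have l: "elem_fun l" unfolding l_def by (intro elem_fun.Diff elem_fun_bound_var h)
  have B: "elem_pred (\<lambda>s. B s = d)" for d
    unfolding B_def C_def by (rule elem_pred_formula_block elem_fun_div elem_fun_mod l N elem_fun_const)+
  \<comment> \<open>The bits of \<open>block_code\<close> are expressed by equations with fixed
    blocks. They agree for the four allowed blocks, so the proof relies on the formula circuit being
    restricted.\<close>
  define symbol where "symbol s = (if bound_var s < h s
      then bound_var s \<noteq> N (fst s) \<and> bound_var s \<noteq> N (fst s) + a (fst s) + 1 \<and>
          bound_var s \<noteq> N (fst s) + a (fst s) + b (fst s) + 2
      else l s mod 3 = 0 \<and> B s = Selector \<or> l s mod 3 = 1 \<and> (B s = Selector \<or> B s =
          Fixed_Value) \<or>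
        l s mod 3 = 2 \<and> (B s = Fixed_Value \<or> B s = Disjunction))" for s
  have symbol: "elem_pred symbol"
    unfolding symbol_def by (rule elem_pred_if elem_pred_less elem_pred_conj elem_pred_disj
        elem_pred_not elem_pred_eq B elem_fun.Add elem_fun_mod h l elem_fun_bound_var N a b elem_fun_const)+
  have "map (\<lambda>i. of_bool (symbol (x, (\<lambda>_. 0)(0 := i))) \<noteq> (0 :: nat)) [0..<len
      (x, \<lambda>_. 0)] =
      instance_code (C x) (a x, b x)" for x
    unfolding instance_code_eq_map
  proof (rule map_cong)
    fix i
    assume "i \<in> set [0..<header_length (grid_size (C x)) (a x) (b x) + 3 * (grid_size (C x) *
        grid_size (C x))]"
    then have i: "i < header_length (N x) (a x) (b x) + 3 * (N x * N x)" by (simp add: N_def)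
    let ?s = "(x, (\<lambda>_. 0)(0 := i))"
    show "(of_bool (symbol ?s) \<noteq> (0::nat)) = code_symbol (grid_size (C x)) (a x) (b x) (block_at
        (C x)) i"
    proof (cases "i < h ?s")
      case True
      then show ?thesis
        by (simp add: symbol_def code_symbol_def h_def bound_var_def N_def)
    next
      case False
      have "l ?s < N x * N x * 3" using i False by (simp add: l_def h_def bound_var_def)
      then have "l ?s div 3 < N x * N x" by (rule less_mult_imp_div_less)
      moreover from this have "0 < N x" by (cases "N x") auto
      ultimately have "l ?s div 3 div N x < N x" "l ?s div 3 mod N x < N x"
        by (auto simp: less_mult_imp_div_less)
      then have "B ?s \<in> {Conjunction, Disjunction, Fixed_Value, Selector}"
        using formula_circuit_restricted[of "nl x" "nc x" "inc x"]
        by (simp add: restricted_circuit_def B_def C_def N_def)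
      from block_code_nth[OF this, of "l ?s mod 3"] False show ?thesis
        by (simp add: symbol_def code_symbol_def h_def bound_var_def N_def l_def B_def Let_def)
    qed
  qed (simp add: len_def N_def)
  moreover have "poly_time_computable
      (\<lambda>x. map (\<lambda>i. of_bool (symbol (x, (\<lambda>_. 0)(0 := i))) \<noteq> (0 :: nat))
          [0..<len (x, \<lambda>_. 0)])"
    by (rule elem_fun_poly_time_computable[OF len elem_fun_of_bool[OF symbol]])
  ultimately show ?thesis by (simp add: C_def a_def b_def)
qed

end

lemma formula_instance_iff:
  "instance_code (formula_circuit nl nc inc) (formula_query nl nc) \<in> Restricted_Grid_Circuit_SAT
      \<longleftrightarrow>
   (\<exists>\<alpha>. \<forall>c<nc. \<exists>l<nl. inc c l \<and> literal_true \<alpha> l)"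
proof -
  let ?C = "formula_circuit nl nc inc" and ?v = "formula_query nl nc"
  have "instance_code ?C ?v \<in> Restricted_Grid_Circuit_SAT \<longleftrightarrow> (\<exists>u.
      block_value ?C u ?v)"
  proof
    assume "\<exists>u. block_value ?C u ?v"
    then show "instance_code ?C ?v \<in> Restricted_Grid_Circuit_SAT"
      using formula_circuit_embedded formula_circuit_restricted formula_query_less
      unfolding Restricted_Grid_Circuit_SAT_def grid_circuit_sat_instance_def by blast
  next
    assume "instance_code ?C ?v \<in> Restricted_Grid_Circuit_SAT"
    then obtain C v u where eq: "instance_code ?C ?v = instance_code C v"
      and C: "grid_circuit_sat_instance C v" and u: "block_value C u v"
      unfolding Restricted_Grid_Circuit_SAT_def by blast
    note inj = instance_code_inject[OF eq]
    \<comment> \<open>The code may stem from a circuit that differs outside the grid, but outputs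
      inside the grid depend only on blocks inside it.\<close>
    have "outputs ?C u i j = outputs C u i j" if "i < grid_size ?C" "j < grid_size ?C" for i j
      using that
    proof (induction "i + j" arbitrary: i j rule: less_induct)
      case less
      then have "i \<noteq> 0 \<Longrightarrow> outputs ?C u (i - 1) j = outputs C u (i - 1) j"
        "j \<noteq> 0 \<Longrightarrow> outputs ?C u i (j - 1) = outputs C u i (j - 1)" by auto
      then show ?case
        using inj(3)[OF less.prems]
        unfolding outputs.simps[of ?C u i j] outputs.simps[of C u i j]
        by (cases "i = 0"; cases "j = 0") simp_all
    qed
    with u C inj(1,2) show "\<exists>u. block_value ?C u ?v"
      unfolding block_value_def grid_circuit_sat_instance_def by (intro exI[of _ u]) simp
  qed
  then show ?thesis by (simp only: formula_circuit_satisfiable)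
qed

section \<open>Computations as formulas\<close>

text \<open>A binary function on a finite rectangle, flattened to a unary table so that
  \<open>elem_fun_table\<close> applies.\<close>

definition table2 :: "nat \<Rightarrow> nat \<Rightarrow> (nat \<Rightarrow> nat \<Rightarrow> nat)
    \<Rightarrow> nat \<Rightarrow> nat \<Rightarrow> nat" where
  "table2 m n h a b = (if a * n + b < m * n then h ((a * n + b) div n) ((a * n + b) mod n) else 0)"

lemma table2_eq: "a < m \<Longrightarrow> b < n \<Longrightarrow> table2 m n h a b = h a b"
proof -
  assume "a < m" "b < n"
  then have "a * n + b < m * n" using mult_le_mono1[of "Suc a" m n] by simp
  then show ?thesis using \<open>b < n\<close> by (simp add: table2_def)
qed

lemma elem_fun_table2: "elem_fun f \<Longrightarrow> elem_fun g \<Longrightarrow> elem_fun (\<lambda>s.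
    table2 m n h (f s) (g s))"
  unfolding table2_def
  by (rule elem_fun_table[of "\<lambda>s. f s * n + g s" "m * n" "\<lambda>c. h (c div n) (c mod n)"])
    (intro elem_fun.Add elem_fun_mult elem_fun_const)

text \<open>The arguments are digits in base \<open>B\<close>, so that facts are numbered and
  decoded by elementary arithmetic.\<close>

definition fact_no :: "nat \<Rightarrow> nat \<Rightarrow> nat \<Rightarrow> nat \<Rightarrow> nat
    \<Rightarrow> nat \<Rightarrow> nat" where
  "fact_no B tag t j p s = (((tag * B + t) * B + j) * B + p) * B + s"

lemma fact_no_less:
  assumes "tag < 3" "t < B" "j < B" "p < B" "s < B"
  shows "fact_no B tag t j p s < 3 * B ^ 4"
proof -
  have step: "x * B + y < m * B" if "x < m" "y < B" for x y m
    using mult_le_mono1[of "Suc x" m B] that by simp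
  have "fact_no B tag t j p s < 3 * B * B * B * B"
    unfolding fact_no_def by (intro step assms)
  then show ?thesis by (simp add: power4_eq_xxxx mult.assoc)
qed

lemma elem_fun_fact_no:
  assumes "elem_fun B" "elem_fun f" "elem_fun t" "elem_fun j" "elem_fun p" "elem_fun g"
  shows "elem_fun (\<lambda>s. fact_no (B s) (f s) (t s) (j s) (p s) (g s))"
  unfolding fact_no_def by (intro elem_fun.Add elem_fun_mult assms)

lemma literal_true_double: "literal_true \<alpha> (2 * v) = \<alpha> v" "literal_true \<alpha> (Suc (2
    * v)) = (\<not> \<alpha> v)"
  by (simp_all add: literal_true_def)

section \<open>Clauses that describe a computation\<close>

context
  fixes M :: tm and p\<^sub>u p\<^sub>t :: "nat poly"
begin

text \<open>This exceeds the codes of all lists that consist of a state and the symbols scanned on the first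
  tapes.\<close>

definition codes :: nat where
  "codes = Suc (Max (to_nat ` {ys :: nat list. set ys \<subseteq> {..num_states M + num_symbols M}
      \<and> length ys \<le> Suc (num_tapes M)}))"

text \<open>In the halting state the machine stands still and rewrites what it scans, so that the
  clauses can follow it for a fixed number of steps.\<close>

definition transition :: "nat list \<Rightarrow> nat \<times> (nat \<times> move) list" where
  "transition ys = (if hd ys < num_states M then trans M (hd ys) (tl ys)
     else (hd ys, map (\<lambda>s. (s, Stay)) (tl ys)))"

text \<open>Keeps the entries of the tables within range at all arguments, so that a fact about an
  entry always has a number below the bound.\<close>

definition capped :: "nat \<Rightarrow> nat \<Rightarrow> nat" where
  "capped m n = (if n < m then n else 0)"

text \<open>A code stands for the list of the state and the symbols scanned so far; scanning one
  more tape appends a symbol.\<close>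

definition scan :: "nat \<Rightarrow> nat \<Rightarrow> nat" where
  "scan = table2 codes (num_symbols M) (\<lambda>a s. capped codes (to_nat (from_nat a @ [s])))"

definition next_state :: "nat \<Rightarrow> nat" where
  "next_state a = table2 codes 1 (\<lambda>a _. capped codes (to_nat [fst (transition (from_nat a))])) a 0"

definition written :: "nat \<Rightarrow> nat \<Rightarrow> nat" where
  "written = table2 codes (num_tapes M) (\<lambda>a j. capped (num_symbols M) (fst (snd (transition
      (from_nat a)) ! j)))"

text \<open>The displacement of a head, increased by one.\<close>

definition shift :: "nat \<Rightarrow> nat \<Rightarrow> nat" where
  "shift = table2 codes (num_tapes M) (\<lambda>a j. case snd (snd (transition (from_nat a)) ! j) of
     Move_Left \<Rightarrow> 0 | Stay \<Rightarrow> 1 | Move_Right \<Rightarrow> 2)"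

definition cert_length :: "bool list \<Rightarrow> nat" where
  "cert_length x = poly p\<^sub>u (length x)"

text \<open>The running time on the longest relevant input, a pair with a certificate of maximal
  length.\<close>

definition time :: "bool list \<Rightarrow> nat" where
  "time x = poly p\<^sub>t (2 * length x + 1 + cert_length x)"

text \<open>The position 0 of a tape has the number \<open>origin x\<close>.\<close>

definition origin :: "bool list \<Rightarrow> nat" where
  "origin x = time x + 1"

text \<open>Exceeds the times, tape numbers, positions, codes and symbols of the computation, with
  slack for successors, so that all of them can be digits.\<close>

definition base :: "bool list \<Rightarrow> nat" where
  "base x = 2 * time x + 2 * length x + cert_length x + codes + num_symbols M + num_tapes M + 10"

text \<open>The part of the verifier's input that \<open>x\<close> determines: in the pair code, the
  even positions hold the bit 1 (symbol 2), the odd ones the bits of \<open>x\<close>, and a bit 0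
  (symbol 1) stands before the certificate.\<close>

definition known_symbol :: "bool list \<Rightarrow> nat \<Rightarrow> nat" where
  "known_symbol x i = (if i < 2 * length x then if even i then 2 else if word_bit x (i div 2) then 2 else 1
     else if i = 2 * length x then 1 else 0)"

text \<open>At time \<open>t\<close>, the number \<open>a\<close> codes the state and the symbols
  scanned on the first \<open>j\<close> tapes; \<open>j = num_tapes M\<close> gives the full
  argument of the transition.\<close>

definition state_fact :: "bool list \<Rightarrow> nat \<Rightarrow> nat \<Rightarrow> nat \<Rightarrow>
    nat" where
  "state_fact x t j a = fact_no (base x) 0 t j 0 a"

definition head_fact :: "bool list \<Rightarrow> nat \<Rightarrow> nat \<Rightarrow> nat \<Rightarrow>
    nat" where
  "head_fact x t j p = fact_no (base x) 1 t j p 0"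

definition cell_fact :: "bool list \<Rightarrow> nat \<Rightarrow> nat \<Rightarrow> nat \<Rightarrow>
    nat \<Rightarrow> nat" where
  "cell_fact x t j p s = fact_no (base x) 2 t j p s"

definition guessed :: "bool list \<Rightarrow> nat \<Rightarrow> nat \<Rightarrow> bool" where
  "guessed x j p \<longleftrightarrow> j = 0 \<and> origin x + 2 * length x < p \<and> p \<le> origin x
      + 2 * length x + cert_length x"

text \<open>Family 0 collects the symbols scanned at time \<open>t\<close> tape by tape, since a clause
    for the whole
  transition would need a literal for every tape; in family 4, \<open>a\<close> is the position of a
      cell away
  from the head. Clauses with indices out of range contain all literals.\<close>

definition clause :: "bool list \<Rightarrow> nat \<Rightarrow> nat \<Rightarrow> nat \<Rightarrow> nat
    \<Rightarrow> nat \<Rightarrow> nat \<Rightarrow> nat \<Rightarrow> bool" where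
  "clause x fam t j p a s l = (
     if fam = 0 then t < time x \<and> j < num_tapes M \<and> a < codes \<and> s < num_symbols M
         \<longrightarrow>
       l = 2 * state_fact x t j a + 1 \<or> l = 2 * head_fact x t j p + 1 \<or> l = 2 * cell_fact x t j
           p s + 1 \<or>
       l = 2 * state_fact x t (j + 1) (scan a s)
     else if fam = 1 then t < time x \<and> a < codes \<longrightarrow>
       l = 2 * state_fact x t (num_tapes M) a + 1 \<or> l = 2 * state_fact x (t + 1) 0 (next_state a)
     else if fam = 2 then t < time x \<and> j < num_tapes M \<and> a < codes \<and> p + 2 < base x
         \<longrightarrow>
       l = 2 * state_fact x t (num_tapes M) a + 1 \<or> l = 2 * head_fact x t j p + 1 \<or>
       l = 2 * head_fact x (t + 1) j (p + shift a j - 1)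
     else if fam = 3 then t < time x \<and> j < num_tapes M \<and> a < codes \<longrightarrow>
       l = 2 * state_fact x t (num_tapes M) a + 1 \<or> l = 2 * head_fact x t j p + 1 \<or>
       l = 2 * cell_fact x (t + 1) j p (written a j)
     else if fam = 4 then t < time x \<and> j < num_tapes M \<and> p \<noteq> a \<and> s < num_symbols
         M \<longrightarrow>
       l = 2 * head_fact x t j p + 1 \<or> l = 2 * cell_fact x t j a s + 1 \<or> l = 2 * cell_fact x (t
           + 1) j a s
     else if fam = 5 then l = 2 * state_fact x 0 0 (to_nat [0 :: nat])
     else if fam = 6 then j < num_tapes M \<longrightarrow> l = 2 * head_fact x 0 j (origin x)
     else if fam = 7 then j < num_tapes M \<longrightarrow>
       (if guessed x j p
        then l = 2 * cell_fact x 0 j p 0 \<or> l = 2 * cell_fact x 0 j p 1 \<or> l = 2 * cell_fact x 0 j p 2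
        else l = 2 * cell_fact x 0 j p (if j = 0 \<and> origin x \<le> p then known_symbol x (p -
            origin x) else 0))
     else if fam = 8 then guessed x 0 p \<and> guessed x 0 (p + 1) \<longrightarrow>
       l = 2 * cell_fact x 0 0 p 0 + 1 \<or> l = 2 * cell_fact x 0 0 (p + 1) 0
     else if fam = 9 then s < num_symbols M \<and> s \<noteq> 2 \<longrightarrow> l = 2 * cell_fact x
         (time x) (num_tapes M - 1) (origin x) s + 1
     else s < num_symbols M \<and> s \<noteq> 0 \<longrightarrow> l = 2 * cell_fact x (time x)
         (num_tapes M - 1) (origin x + 1) s + 1)"

text \<open>The clauses read as implications. Families 0 to 4 describe a step: scanning, next state,
  head movement, writing, persistence of the other cells. Families 5 to 7 describe the start, where
  a certificate cell offers three symbols. Family 8 spreads blanks to the right, so that the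
  certificate is a word. The last two exclude every output but the symbol 2 followed by a
  blank.\<close>

definition rule_holds :: "bool list \<Rightarrow> (nat \<Rightarrow> bool) \<Rightarrow> nat
    \<Rightarrow> nat \<Rightarrow> nat \<Rightarrow> nat \<Rightarrow> nat \<Rightarrow> nat
    \<Rightarrow> bool" where
  "rule_holds x \<alpha> fam t j p a s = (
     if fam = 0 then t < time x \<and> j < num_tapes M \<and> a < codes \<and> s < num_symbols M
         \<longrightarrow>
       \<alpha> (state_fact x t j a) \<longrightarrow> \<alpha> (head_fact x t j p) \<longrightarrow>
           \<alpha> (cell_fact x t j p s) \<longrightarrow>
       \<alpha> (state_fact x t (j + 1) (scan a s))
     else if fam = 1 then t < time x \<and> a < codes \<longrightarrow>
       \<alpha> (state_fact x t (num_tapes M) a) \<longrightarrow> \<alpha> (state_fact x (t + 1) 0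
           (next_state a))
     else if fam = 2 then t < time x \<and> j < num_tapes M \<and> a < codes \<and> p + 2 < base x
         \<longrightarrow>
       \<alpha> (state_fact x t (num_tapes M) a) \<longrightarrow> \<alpha> (head_fact x t j p)
           \<longrightarrow> \<alpha> (head_fact x (t + 1) j (p + shift a j - 1))
     else if fam = 3 then t < time x \<and> j < num_tapes M \<and> a < codes \<longrightarrow>
       \<alpha> (state_fact x t (num_tapes M) a) \<longrightarrow> \<alpha> (head_fact x t j p)
           \<longrightarrow> \<alpha> (cell_fact x (t + 1) j p (written a j))
     else if fam = 4 then t < time x \<and> j < num_tapes M \<and> p \<noteq> a \<and> s < num_symbols
         M \<longrightarrow>
       \<alpha> (head_fact x t j p) \<longrightarrow> \<alpha> (cell_fact x t j a s) \<longrightarrow>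
           \<alpha> (cell_fact x (t + 1) j a s)
     else if fam = 5 then \<alpha> (state_fact x 0 0 (to_nat [0 :: nat]))
     else if fam = 6 then j < num_tapes M \<longrightarrow> \<alpha> (head_fact x 0 j (origin x))
     else if fam = 7 then j < num_tapes M \<longrightarrow>
       (if guessed x j p
        then \<alpha> (cell_fact x 0 j p 0) \<or> \<alpha> (cell_fact x 0 j p 1) \<or> \<alpha>
            (cell_fact x 0 j p 2)
        else \<alpha> (cell_fact x 0 j p (if j = 0 \<and> origin x \<le> p then known_symbol x (p -
            origin x) else 0)))
     else if fam = 8 then guessed x 0 p \<and> guessed x 0 (p + 1) \<longrightarrow>
       \<alpha> (cell_fact x 0 0 p 0) \<longrightarrow> \<alpha> (cell_fact x 0 0 (p + 1) 0)
     else if fam = 9 then s < num_symbols M \<and> s \<noteq> 2 \<longrightarrow> \<not> \<alpha>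
         (cell_fact x (time x) (num_tapes M - 1) (origin x) s)
     else s < num_symbols M \<and> s \<noteq> 0 \<longrightarrow> \<not> \<alpha> (cell_fact x (time x)
         (num_tapes M - 1) (origin x + 1) s))"

definition num_literals :: "bool list \<Rightarrow> nat" where
  "num_literals x = 6 * base x ^ 4"

text \<open>Each of the eleven families gets five indices, so a clause number is a numeral of six
  digits, which \<open>member\<close> recovers.\<close>

definition num_clauses :: "bool list \<Rightarrow> nat" where
  "num_clauses x = 11 * base x ^ 5"

definition member :: "bool list \<Rightarrow> nat \<Rightarrow> nat \<Rightarrow> bool" where
  "member x c l = (let B = base x; c1 = c div B; c2 = c1 div B; c3 = c2 div B; c4 = c3 div B
     in clause x (c4 div B) (c4 mod B) (c3 mod B) (c2 mod B) (c1 mod B) (c mod B) l)"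

lemma base_bounds:
  "codes < base x" "(num_symbols M) < base x" "(num_tapes M) < base x" "2 * time x + 4 < base x" "time
      x + 4 < base x"
  "origin x + 2 * length x + cert_length x + 5 < base x" "origin x + 5 < base x" "0 < base x"
  by (simp_all add: base_def origin_def)

lemma codes_pos: "0 < codes"
  by (simp add: codes_def)

lemma table_bounds:
  "scan a s < codes" "next_state a < codes" "0 < num_symbols M \<Longrightarrow> written a j <
      num_symbols M" "shift a j \<le> 2"
  using codes_pos by (simp_all add: scan_def next_state_def written_def shift_def table2_def capped_def
      split: move.splits)

text \<open>A clause with a false guard contains every literal, in particular both literals of
  variable 0, one of which is true.\<close>

lemma satisfied_guard:
  assumes "2 \<le> n"
  shows "(\<exists>l<n. (G \<longrightarrow> Q l) \<and> literal_true \<alpha> l) \<longleftrightarrow>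
      (G \<longrightarrow> (\<exists>l<n. Q l \<and> literal_true \<alpha> l))"
proof (cases G)
  case False
  define l where "l = (if \<alpha> 0 then 0 else 1 :: nat)"
  have "literal_true \<alpha> l" "l < n" using assms by (simp_all add: literal_true_def l_def)
  then have "\<exists>l<n. (G \<longrightarrow> Q l) \<and> literal_true \<alpha> l" using False by
      (intro exI[of _ l]) simp
  then show ?thesis using False by simp
qed simp

text \<open>The point is that each literal named under a true guard lies below
  \<open>num_literals\<close>. To this end table entries are capped and head movements are guarded
  by \<open>p + 2 < base x\<close>.\<close>

lemma clause_satisfied:
  assumes M: "3 \<le> num_symbols M" "1 \<le> num_tapes M" and fam: "t < base x" "j < base x" "p < base
      x" "a < base x" "s < base x"
  shows "(\<exists>l<num_literals x. clause x fam t j p a s l \<and> literal_true \<alpha> l)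
      \<longleftrightarrow> rule_holds x \<alpha> fam t j p a s"
proof -
  let ?n = "num_literals x"
  have n: "2 \<le> ?n" using base_bounds(8)[of x] by (simp add: num_literals_def Suc_le_eq)
  have v: "2 * fact_no (base x) tag t j p s < ?n" "Suc (2 * fact_no (base x) tag t j p s) < ?n"
    if "tag < 3" "t < base x" "j < base x" "p < base x" "s < base x" for tag t j p s
    using fact_no_less[OF that] by (simp_all add: num_literals_def)
  have st: "2 * state_fact x t j a < ?n" "Suc (2 * state_fact x t j a) < ?n"
    if "t \<le> time x" "j \<le> num_tapes M" "a < codes" for t j a
    using that base_bounds[of x] unfolding state_fact_def by (auto intro!: v)
  have hd: "2 * head_fact x t j p < ?n" "Suc (2 * head_fact x t j p) < ?n"
    if "t \<le> time x" "j < num_tapes M" "p < base x" for t j p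
    using that base_bounds[of x] unfolding head_fact_def by (auto intro!: v)
  have ce: "2 * cell_fact x t j p s < ?n" "Suc (2 * cell_fact x t j p s) < ?n"
    if "t \<le> time x" "j < num_tapes M" "p < base x" "s < num_symbols M" for t j p s
    using that base_bounds[of x] unfolding cell_fact_def by (auto intro!: v)
  have one: "(\<exists>l<?n. (l = a \<or> Q l) \<and> literal_true \<alpha> l) \<longleftrightarrow>
      literal_true \<alpha> a \<or> (\<exists>l<?n. Q l \<and> literal_true \<alpha> l)"
    "(\<exists>l<?n. l = a \<and> literal_true \<alpha> l) \<longleftrightarrow> literal_true \<alpha>
        a" if "a < ?n" for a Q
    using that by blast+
  have zero: "to_nat [0 :: nat] < codes"
  proof -
    have "to_nat [0 :: nat] \<in> to_nat ` {ys :: nat list. set ys \<subseteq> {..num_states M +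
        num_symbols M} \<and> length ys \<le> Suc (num_tapes M)}"
      by (intro imageI) simp
    then show ?thesis unfolding codes_def less_Suc_eq_le by (intro Max_ge finite_imageI
        finite_lists_length_le) simp_all
  qed
  have ks: "known_symbol x i < num_symbols M" for i using M by (simp add: known_symbol_def)
  note facts = satisfied_guard[OF n] one st hd ce literal_true_double table_bounds
  have "p + shift a j - Suc 0 < base x" if "Suc (Suc p) < base x" for a j
    using that table_bounds(4)[of a j] by linarith
  note facts = facts this
  have "fam = 0 \<or> fam = 1 \<or> fam = 2 \<or> fam = 3 \<or> fam = 4 \<or> fam = 5 \<or> fam = 6
      \<or> fam = 7 \<or>
    fam = 8 \<or> fam = 9 \<or> 9 < fam" by presburger
  then consider "fam = 0" | "fam = 1" | "fam = 2" | "fam = 3" | "fam = 4" | "fam = 5" | "fam = 6" |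
      "fam = 7" |
    "fam = 8" | "fam = 9" | "9 < fam" by blast
  then show ?thesis
  proof cases
    case 1
    then show ?thesis using M fam by (simp add: clause_def rule_holds_def facts; blast)
  next
    case 2
    then show ?thesis using M fam by (simp add: clause_def rule_holds_def facts; blast)
  next
    case 3
    then show ?thesis using M fam by (simp add: clause_def rule_holds_def facts; blast)
  next
    case 4
    then show ?thesis using M fam by (simp add: clause_def rule_holds_def facts; blast)
  next
    case 5
    then show ?thesis using M fam by (simp add: clause_def rule_holds_def facts; blast)
  next
    case 6
    then show ?thesis using M fam zero by (simp add: clause_def rule_holds_def facts)
  next
    case 7
    then show ?thesis using M fam base_bounds[of x] by (simp add: clause_def rule_holds_def facts)
  next
    case 8
    then show ?thesis using M fam ks
      by (cases "guessed x j p") (simp_all add: clause_def rule_holds_def facts)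
  next
    case 9
    have "p + 1 < base x" if "guessed x 0 (p + 1)"
      using that base_bounds(6)[of x] by (simp add: guessed_def)
    with 9 show ?thesis using M fam by (simp add: clause_def rule_holds_def facts; blast)
  next
    case 10
    then show ?thesis using M fam base_bounds[of x] by (simp add: clause_def rule_holds_def facts)
  next
    case 11
    then show ?thesis using M fam base_bounds[of x] by (simp add: clause_def rule_holds_def facts)
  qed
qed

lemma num_clauses_eq: "num_clauses x = 11 * base x * base x * base x * base x * base x"
proof -
  have "base x ^ 5 = base x * base x * base x * base x * base x" by (simp add: eval_nat_numeral)
  then show ?thesis by (simp only: num_clauses_def mult.assoc)
qed

lemma member_satisfied:
  assumes M: "3 \<le> num_symbols M" "1 \<le> num_tapes M"
  shows "(\<forall>c<num_clauses x. \<exists>l<num_literals x. member x c l \<and> literal_true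
      \<alpha> l) \<longleftrightarrow>
    (\<forall>fam<11. \<forall>t<base x. \<forall>j<base x. \<forall>p<base x. \<forall>a<base x.
        \<forall>s<base x. rule_holds x \<alpha> fam t j p a s)"
    (is "?L \<longleftrightarrow> ?R")
proof
  let ?B = "base x"
  have B: "0 < ?B" by (rule base_bounds)
  assume L: ?L
  show ?R
  proof (intro allI impI)
    fix fam t j p a s :: nat
    assume d: "fam < 11" "t < ?B" "j < ?B" "p < ?B" "a < ?B" "s < ?B"
    define c where "c = ((((fam * ?B + t) * ?B + j) * ?B + p) * ?B + a) * ?B + s"
    have step: "x * ?B + y < m * ?B" if "x < m" "y < ?B" for x y m
      using mult_le_mono1[of "Suc x" m ?B] that by simp
    have "c < 11 * ?B * ?B * ?B * ?B * ?B" unfolding c_def by (intro step d)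
    then have "c < num_clauses x" by (simp only: num_clauses_eq)
    then have "\<exists>l<num_literals x. member x c l \<and> literal_true \<alpha> l" using L by blast
    moreover have "member x c l = clause x fam t j p a s l" for l
      using d by (simp add: member_def c_def Let_def)
    ultimately show "rule_holds x \<alpha> fam t j p a s" using clause_satisfied[OF M d(2-)] by simp
  qed
next
  let ?B = "base x"
  have B: "0 < ?B" by (rule base_bounds)
  assume R: ?R
  show ?L
  proof (intro allI impI)
    fix c assume "c < num_clauses x"
    then have "c < 11 * ?B * ?B * ?B * ?B * ?B" by (simp only: num_clauses_eq)
    then have "c div ?B div ?B div ?B div ?B div ?B < 11" by (intro less_mult_imp_div_less)
    then show "\<exists>l<num_literals x. member x c l \<and> literal_true \<alpha> l"
      unfolding member_def Let_def using R B by (subst clause_satisfied[OF M]) simp_all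
  qed
qed

section \<open>The clauses as an elementary predicate\<close>

lemma elem_fun_codes: "elem_fun f \<Longrightarrow> elem_fun g \<Longrightarrow> elem_fun (\<lambda>s.
    scan (f s) (g s))" "elem_fun f \<Longrightarrow> elem_fun (\<lambda>s. next_state (f s))"
  "elem_fun f \<Longrightarrow> elem_fun g \<Longrightarrow> elem_fun (\<lambda>s. written (f s) (g
      s))" "elem_fun f \<Longrightarrow> elem_fun g \<Longrightarrow> elem_fun (\<lambda>s. shift (f s)
      (g s))"
  unfolding scan_def next_state_def written_def shift_def
  by (rule elem_fun_table2 elem_fun_const | assumption)+

lemma elem_fun_time: "elem_fun (\<lambda>s. cert_length (fst s))" "elem_fun (\<lambda>s. time (fst s))"
    "elem_fun (\<lambda>s. origin (fst s))" "elem_fun (\<lambda>s. base (fst s))"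
  unfolding base_def origin_def time_def cert_length_def
  by (rule elem_fun_poly elem_fun.Add elem_fun_mult elem_fun_const elem_fun.Len)+

lemma elem_pred_even: "elem_fun f \<Longrightarrow> elem_pred (\<lambda>s. even (f s))"
  using elem_pred_not[OF elem_pred_odd, of f] by simp

lemma elem_fun_known_symbol: "elem_fun f \<Longrightarrow> elem_fun (\<lambda>s. known_symbol (fst s)
    (f s))"
  unfolding known_symbol_def
  by (rule elem_fun_if elem_pred_less elem_pred_eq elem_pred_even elem_pred_bit elem_fun_div
      elem_fun.Add elem_fun_mult elem_fun_const elem_fun.Len | assumption)+

lemma elem_fun_facts:
  "elem_fun t \<Longrightarrow> elem_fun j \<Longrightarrow> elem_fun g \<Longrightarrow> elem_fun
      (\<lambda>s. state_fact (fst s) (t s) (j s) (g s))"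
  "elem_fun t \<Longrightarrow> elem_fun j \<Longrightarrow> elem_fun p \<Longrightarrow> elem_fun
      (\<lambda>s. head_fact (fst s) (t s) (j s) (p s))"
  "elem_fun t \<Longrightarrow> elem_fun j \<Longrightarrow> elem_fun p \<Longrightarrow> elem_fun g
      \<Longrightarrow> elem_fun (\<lambda>s. cell_fact (fst s) (t s) (j s) (p s) (g s))"
  unfolding state_fact_def head_fact_def cell_fact_def by (rule elem_fun_fact_no elem_fun_time
      elem_fun_const | assumption)+

lemma elem_pred_guessed: "elem_fun j \<Longrightarrow> elem_fun p \<Longrightarrow> elem_pred
    (\<lambda>s. guessed (fst s) (j s) (p s))"
  unfolding guessed_def by (intro elem_pred_conj elem_pred_eq elem_pred_less elem_pred_le elem_fun.Add
      elem_fun_mult elem_fun_const elem_fun.Len elem_fun_time)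

lemma elem_pred_clause:
  assumes "elem_fun fam" "elem_fun t" "elem_fun j" "elem_fun p" "elem_fun a" "elem_fun g" "elem_fun l"
  shows "elem_pred (\<lambda>s. clause (fst s) (fam s) (t s) (j s) (p s) (a s) (g s) (l s))"
  unfolding clause_def
  by (rule elem_pred_if elem_pred_imp elem_pred_conj elem_pred_disj elem_pred_not elem_pred_eq
      elem_pred_less elem_pred_le elem_pred_guessed elem_fun_facts elem_fun_codes elem_fun_time
      elem_fun_known_symbol elem_fun_if elem_fun.Add elem_fun.Diff elem_fun_mult elem_fun_const assms)+

lemma elem_pred_member: "elem_fun f \<Longrightarrow> elem_fun g \<Longrightarrow> elem_pred
    (\<lambda>s. member (fst s) (f s) (g s))"
  unfolding member_def Let_def by (rule elem_pred_clause elem_fun_div elem_fun_mod elem_fun_time |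
      assumption)+

lemma elem_fun_num: "elem_fun (\<lambda>s. num_literals (fst s))" "elem_fun (\<lambda>s. num_clauses
    (fst s))"
  unfolding num_literals_def num_clauses_def by (rule elem_fun_mult elem_fun_power elem_fun_const
      elem_fun_time)+

lemma tableau_reduction:
  "poly_time_computable (\<lambda>x. instance_code
     (formula_circuit (num_literals x) (num_clauses x) (member x)) (formula_query (num_literals x)
         (num_clauses x)))"
  by (rule formula_reduction[OF elem_fun_num elem_pred_member])

end

section \<open>The actual computation as a set of facts\<close>

context
  fixes M :: tm and p\<^sub>u p\<^sub>t :: "nat poly" and x :: "bool list"
  assumes M: "valid_tm M"
begin

private abbreviation "k \<equiv> num_tapes M"
private abbreviation "S \<equiv> num_symbols M"
private abbreviation "Z \<equiv> origin p\<^sub>u p\<^sub>t x"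
private abbreviation "T \<equiv> time p\<^sub>u p\<^sub>t x"
private abbreviation "B \<equiv> base M p\<^sub>u p\<^sub>t x"

private abbreviation "holds \<equiv> rule_holds M p\<^sub>u p\<^sub>t x"
private abbreviation "stf \<equiv> state_fact M p\<^sub>u p\<^sub>t x"
private abbreviation "hdf \<equiv> head_fact M p\<^sub>u p\<^sub>t x"
private abbreviation "cef \<equiv> cell_fact M p\<^sub>u p\<^sub>t x"

lemma bounds:
  "codes M < B" "S < B" "k < B" "2 * T + 4 < B" "T + 4 < B"
  "Z + 2 * length x + cert_length p\<^sub>u x + 5 < B" "Z + 5 < B" "0 < B"
  by (rule base_bounds)+

lemma tapes_symbols: "1 \<le> k" "3 \<le> S"
  using M by (auto simp: valid_tm_def)

lemma transition_valid:
  assumes "q \<le> num_states M" "length xs = k" "set xs \<subseteq> {..<S}"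
  shows "fst (transition M (q # xs)) \<le> num_states M" "length (snd (transition M (q # xs))) = k"
    "j < k \<Longrightarrow> fst (snd (transition M (q # xs)) ! j) < S"
proof -
  have "fst (transition M (q # xs)) \<le> num_states M \<and> length (snd (transition M (q # xs))) = k
      \<and>
      fst ` set (snd (transition M (q # xs))) \<subseteq> {..<S}"
  proof (cases "q < num_states M")
    case True
    then show ?thesis using M assms by (auto simp: transition_def valid_tm_def)
  next
    case False
    then show ?thesis using assms by (auto simp: transition_def)
  qed
  then show "fst (transition M (q # xs)) \<le> num_states M" "length (snd (transition M (q # xs))) = k"
    "j < k \<Longrightarrow> fst (snd (transition M (q # xs)) ! j) < S"
    by (auto simp: image_subset_iff)
qed

context
  fixes w :: "bool list"
begin

definition config_at :: "nat \<Rightarrow> config" where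
  "config_at t = (step M ^^ t) (init_config M w)"

definition state_at :: "nat \<Rightarrow> nat" where
  "state_at t = fst (config_at t)"

definition tape_at :: "nat \<Rightarrow> nat \<Rightarrow> tape" where
  "tape_at t j = snd (config_at t) ! j"

definition symbols_at :: "nat \<Rightarrow> nat list" where
  "symbols_at t = map scanned (snd (config_at t))"

lemma config_at_Suc: "config_at (Suc t) = (fst (transition M (state_at t # symbols_at t)),
  map2 act (snd (transition M (state_at t # symbols_at t))) (snd (config_at t)))"
proof (cases "config_at t")
  case (Pair q ts)
  have "map2 act (map (\<lambda>s. (s, Stay)) (map scanned ts)) ts = ts"
    by (rule nth_equalityI) auto
  then show ?thesis using Pair
    by (simp add: config_at_def state_at_def symbols_at_def step_def transition_def case_prod_beta)
qed

lemma symbols_at_eq: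
  "length (snd (config_at t)) = k \<Longrightarrow> symbols_at t = map (\<lambda>j. scanned (tape_at t
      j)) [0..<k]"
  by (rule nth_equalityI) (simp_all add: symbols_at_def tape_at_def)

lemma config_at_valid:
  "state_at t \<le> num_states M \<and> length (snd (config_at t)) = k \<and> (\<forall>j<k.
      \<forall>z. fst (tape_at t j) z < S)"
proof (induction t)
  case 0
  show ?case using tapes_symbols
    by (auto simp: state_at_def tape_at_def config_at_def init_config_def nth_Cons' word_tape_def
        bit_symbol_def)
next
  case (Suc t)
  have "scanned (tape_at t j) < S" if "j < k" for j using Suc that by (cases "tape_at t j") force
  then have "length (symbols_at t) = k" "set (symbols_at t) \<subseteq> {..<S}"
    using Suc by (auto simp: symbols_at_eq simp del: scanned.simps)
  note tr = transition_valid[OF _ this, of "state_at t"]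
  have "fst (tape_at (Suc t) j) z < S" if j: "j < k" for j z
  proof -
    have "tape_at (Suc t) j = act (snd (transition M (state_at t # symbols_at t)) ! j) (tape_at t j)"
      using j Suc tr by (simp add: tape_at_def config_at_Suc)
    then show ?thesis using tr(3)[OF _ j] Suc j
      by (cases "tape_at t j"; cases "snd (transition M (state_at t # symbols_at t)) ! j") force
  qed
  then show ?case using tr Suc by (auto simp: state_at_def config_at_Suc)
qed

lemma symbols_at_valid: "length (symbols_at t) = k" "set (symbols_at t) \<subseteq> {..<S}"
  "j < k \<Longrightarrow> symbols_at t ! j = scanned (tape_at t j)"
proof -
  have "scanned (tape_at t j) < S" if "j < k" for j
    using config_at_valid[of t] that by (cases "tape_at t j") force
  then show "length (symbols_at t) = k" "set (symbols_at t) \<subseteq> {..<S}"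
    "j < k \<Longrightarrow> symbols_at t ! j = scanned (tape_at t j)"
    using config_at_valid[of t] by (auto simp: symbols_at_eq simp del: scanned.simps)
qed

abbreviation "transition_at t \<equiv> transition M (state_at t # symbols_at t)"

lemma transition_at_valid:
  "fst (transition_at t) \<le> num_states M" "length (snd (transition_at t)) = k"
  "j < k \<Longrightarrow> fst (snd (transition_at t) ! j) < S"
  using transition_valid[OF _ symbols_at_valid(1,2)] config_at_valid by blast+

lemma tape_at_Suc: "j < k \<Longrightarrow> tape_at (Suc t) j = act (snd (transition_at t) ! j)
    (tape_at t j)"
  using config_at_valid[of t] transition_at_valid(2)[of t] by (simp add: tape_at_def config_at_Suc)

lemma tape_at_0: "j < k \<Longrightarrow> tape_at 0 j = (if j = 0 then word_tape w else (\<lambda>_. 0), 0)"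
  using tapes_symbols by (simp add: tape_at_def config_at_def init_config_def nth_Cons')

definition head_at :: "nat \<Rightarrow> nat \<Rightarrow> nat" where
  "head_at t j = nat (snd (tape_at t j) + int Z)"

definition cell_at :: "nat \<Rightarrow> nat \<Rightarrow> nat \<Rightarrow> nat" where
  "cell_at t j p = fst (tape_at t j) (int p - int Z)"

lemma head_at_bounds: "j < k \<Longrightarrow> \<bar>snd (tape_at t j)\<bar> \<le> int t"
proof (induction t)
  case (Suc t)
  then show ?case
    by (cases "tape_at t j"; cases "snd (transition_at t) ! j") (auto simp: tape_at_Suc split: move.splits)
qed (simp add: tape_at_0)

text \<open>Within \<open>T\<close> steps a head stays at distance at most \<open>T\<close> from 0,
  so the offset \<open>T + 1\<close> keeps its number positive. Hence neither \<open>nat\<close> nor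
  the subtraction of 1 in the rule for head movements truncates.\<close>

lemma int_head_at:
  assumes "j < k" "t \<le> T"
  shows "int (head_at t j) = snd (tape_at t j) + int Z" "1 \<le> head_at t j" "head_at t j + 2 < B"
proof -
  have "0 \<le> snd (tape_at t j) + int T" "snd (tape_at t j) \<le> int T"
    using head_at_bounds[OF assms(1), of t] assms(2) by linarith+
  then show "int (head_at t j) = snd (tape_at t j) + int Z" "1 \<le> head_at t j" "head_at t j + 2 < B"
    by (auto simp: head_at_def origin_def base_def)
qed

lemma cell_at_head: "j < k \<Longrightarrow> t \<le> T \<Longrightarrow> cell_at t j (head_at t j) =
    symbols_at t ! j"
  by (cases "tape_at t j") (use int_head_at[of j t] in \<open>simp add: cell_at_def
      symbols_at_valid(3)\<close>)

lemma cell_at_less: "j < k \<Longrightarrow> cell_at t j p < S"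
  using config_at_valid[of t] by (simp add: cell_at_def)

lemma cell_at_Suc:
  assumes "j < k" "t \<le> T"
  shows "cell_at (Suc t) j p = (if p = head_at t j then fst (snd (transition_at t) ! j) else cell_at t j p)"
  using int_head_at(1)[OF assms] assms(1)
  by (cases "tape_at t j"; cases "snd (transition_at t) ! j") (auto simp: cell_at_def tape_at_Suc)

lemma head_at_Suc:
  assumes "j < k" "t < T"
  shows "head_at (Suc t) j = head_at t j +
    (case snd (snd (transition_at t) ! j) of Move_Left \<Rightarrow> 0 | Stay \<Rightarrow> 1 |
        Move_Right \<Rightarrow> 2) - 1"
proof -
  have "int (head_at (Suc t) j) = snd (tape_at (Suc t) j) + int Z" "int (head_at t j) = snd (tape_at t
      j) + int Z"
    "1 \<le> head_at t j" using int_head_at[of j "Suc t"] int_head_at[of j t] assms by auto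
  then show ?thesis
    using assms(1)
    by (cases "tape_at t j"; cases "snd (transition_at t) ! j") (auto simp: tape_at_Suc split: move.splits)
qed

definition code_at :: "nat \<Rightarrow> nat \<Rightarrow> nat" where
  "code_at t j = to_nat (state_at t # take j (symbols_at t))"

lemma less_codes: "set ys \<subseteq> {..num_states M + S} \<Longrightarrow> length ys \<le> Suc k
    \<Longrightarrow> to_nat ys < codes M"
  for ys :: "nat list"
  unfolding codes_def less_Suc_eq_le
  by (intro Max_ge finite_imageI finite_lists_length_le imageI) simp_all

lemma code_at_less: "code_at t j < codes M"
proof -
  have q: "state_at t \<le> num_states M" using config_at_valid[of t] by (rule conjunct1)
  have "set (take j (symbols_at t)) \<subseteq> {..<S}"
    by (rule subset_trans[OF set_take_subset symbols_at_valid(2)])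
  also have "\<dots> \<subseteq> {..num_states M + S}" by auto
  finally have "set (state_at t # take j (symbols_at t)) \<subseteq> {..num_states M + S}"
    using q by simp
  moreover have "length (state_at t # take j (symbols_at t)) \<le> Suc k"
    using symbols_at_valid(1)[of t] by simp
  ultimately show ?thesis unfolding code_at_def by (rule less_codes)
qed

lemma scan_code_at:
  assumes "j < k"
  shows "scan M (code_at t j) (symbols_at t ! j) = code_at t (Suc j)"
proof -
  have "symbols_at t ! j < S"
    using symbols_at_valid(1,2)[of t] assms by (metis lessThan_iff nth_mem subsetD)
  moreover have "to_nat (from_nat (code_at t j) @ [symbols_at t ! j]) = code_at t (Suc j)"
    using symbols_at_valid(1)[of t] assms by (simp add: code_at_def take_Suc_conv_app_nth)
  ultimately show ?thesis
    using code_at_less[of t j] code_at_less[of t "Suc j"]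
    unfolding scan_def by (subst table2_eq) (simp_all add: capped_def)
qed

lemma code_at_all: "from_nat (code_at t k) = state_at t # symbols_at t"
  using symbols_at_valid(1)[of t] by (simp add: code_at_def)

lemma next_state_code_at: "next_state M (code_at t k) = code_at (Suc t) 0"
proof -
  have "to_nat [fst (transition_at t)] < codes M"
    using transition_at_valid(1)[of t] by (intro less_codes) auto
  then show ?thesis
    using code_at_less[of t k] unfolding next_state_def
    by (subst table2_eq) (simp_all add: code_at_all capped_def, simp add: code_at_def state_at_def
        config_at_Suc)
qed

lemma written_code_at: "j < k \<Longrightarrow> written M (code_at t k) j = fst (snd (transition_at t) ! j)"
  using code_at_less[of t k] transition_at_valid(3)[of j t]
  unfolding written_def by (subst table2_eq) (simp_all add: code_at_all capped_def)

lemma shift_code_at: "j < k \<Longrightarrow> shift M (code_at t k) j =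
    (case snd (snd (transition_at t) ! j) of Move_Left \<Rightarrow> 0 | Stay \<Rightarrow> 1 |
        Move_Right \<Rightarrow> 2)"
  using code_at_less[of t k] unfolding shift_def by (subst table2_eq) (simp_all add: code_at_all)

text \<open>Unit propagation: the true facts at time \<open>t\<close> trigger the rules whose
  conclusions are the facts at \<open>t + 1\<close>. Further facts may hold under \<alpha> as well.
  The initial cells are assumed, since this is where the certificate enters.\<close>

lemma facts_forced:
  assumes rules: "\<And>fam t j p a s. fam < 11 \<Longrightarrow> t < B \<Longrightarrow> j < B
      \<Longrightarrow> p < B \<Longrightarrow> a < B \<Longrightarrow> s < B \<Longrightarrow>
      holds \<alpha> fam t j p a s"
    and init: "\<And>j p. j < k \<Longrightarrow> p < B \<Longrightarrow> \<alpha> (cef 0 j p (cell_at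
        0 j p))"
  shows "t \<le> T \<Longrightarrow> \<alpha> (stf t 0 (code_at t 0)) \<and> (\<forall>j<k. \<alpha>
      (hdf t j (head_at t j))) \<and>
    (\<forall>j<k. \<forall>p<B. \<alpha> (cef t j p (cell_at t j p)))"
proof (induction t)
  case 0
  have "\<alpha> (stf 0 0 (code_at 0 0))"
    using rules[of 5 0 0 0 0 0] bounds(8)
    by (simp add: rule_holds_def code_at_def state_at_def config_at_def init_config_def)
  moreover have "\<alpha> (hdf 0 j (head_at 0 j))" if "j < k" for j
    using rules[of 6 0 j 0 0 0] bounds that
    by (simp add: rule_holds_def head_at_def tape_at_0)
  ultimately show ?case using init by blast
next
  case (Suc t)
  then have t: "t < T" "t \<le> T" "t < B" using bounds(5) by simp_all
  have IH: "\<alpha> (stf t 0 (code_at t 0))" "\<And>j. j < k \<Longrightarrow> \<alpha> (hdf t j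
      (head_at t j))"
    "\<And>j p. j < k \<Longrightarrow> p < B \<Longrightarrow> \<alpha> (cef t j p (cell_at t j p))"
    using Suc.IH t by auto
  have B: "codes M < B" "S < B" "k < B" "0 < B" using bounds by simp_all
  have a: "code_at t j < B" for j using code_at_less[of t j] B by simp
  have h: "head_at t j < B" if "j < k" for j using int_head_at(3)[OF that t(2)] by simp
  \<comment> \<open>Within a step, an inner induction collects the scanned symbols tape by
    tape.\<close>
  have code: "j \<le> k \<Longrightarrow> \<alpha> (stf t j (code_at t j))" for j
  proof (induction j)
    case 0
    then show ?case using IH(1) by simp
  next
    case (Suc j)
    then have j: "j < k" "j < B" using B by simp_all
    have s: "symbols_at t ! j < S" using cell_at_head[OF j(1) t(2)] cell_at_less[OF j(1)] by metis
    have "\<alpha> (cef t j (head_at t j) (symbols_at t ! j))"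
      using IH(3)[OF j(1) h[OF j(1)]] cell_at_head[OF j(1) t(2)] by simp
    then have "\<alpha> (stf t (j + 1) (scan M (code_at t j) (symbols_at t ! j)))"
      using rules[of 0 t j "head_at t j" "code_at t j" "symbols_at t ! j"] Suc j t a h s B
        code_at_less[of t j] IH(2)[OF j(1)] by (simp add: rule_holds_def)
    then show ?case using scan_code_at[OF j(1)] by simp
  qed
  have all: "\<alpha> (stf t k (code_at t k))" using code by simp
  have "\<alpha> (stf (Suc t) 0 (code_at (Suc t) 0))"
    using rules[of 1 t 0 0 "code_at t k" 0] all t a B code_at_less[of t k]
    by (simp add: rule_holds_def next_state_code_at)
  moreover have "\<alpha> (hdf (Suc t) j (head_at (Suc t) j))" if j: "j < k" for j
    using rules[of 2 t j "head_at t j" "code_at t k" 0] all t a B code_at_less[of t k] h[OF j] j IH(2)[OF j]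
      int_head_at(3)[OF j t(2)]
    by (simp add: rule_holds_def shift_code_at head_at_Suc)
  moreover have "\<alpha> (cef (Suc t) j p (cell_at (Suc t) j p))" if j: "j < k" and p: "p < B" for j p
  proof (cases "p = head_at t j")
    case True
    then show ?thesis
      using rules[of 3 t j p "code_at t k" 0] all t a B code_at_less[of t k] p j IH(2)[OF j]
      by (simp add: rule_holds_def written_code_at cell_at_Suc)
  next
    case False
    then show ?thesis
      using rules[of 4 t j "head_at t j" p "cell_at t j p"] t B h[OF j] p j IH(2,3)[OF j]
          cell_at_less[OF j, of t p]
      by (simp add: rule_holds_def cell_at_Suc)
  qed
  ultimately show ?case by simp
qed

text \<open>The canonical assignment for the computation on \<open>w\<close>: a fact number is
  decoded into digits and the fact compared with the real value.\<close>

definition true_facts :: "nat \<Rightarrow> bool" where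
  "true_facts v = (let s = v mod B; v1 = v div B; p = v1 mod B; v2 = v1 div B; j = v2 mod B; v3 = v2 div B;
     t = v3 mod B; tag = v3 div B
   in if tag = 0 then s = code_at t j else if tag = 1 then p = head_at t j else s = cell_at t j p)"

lemma true_facts:
  assumes "t < B" "j < B"
  shows "a < B \<Longrightarrow> true_facts (stf t j a) \<longleftrightarrow> a = code_at t j"
    "p < B \<Longrightarrow> true_facts (hdf t j p) \<longleftrightarrow> p = head_at t j"
    "p < B \<Longrightarrow> s < B \<Longrightarrow> true_facts (cef t j p s) \<longleftrightarrow> s =
        cell_at t j p"
  using assms bounds(8)
  by (simp_all add: true_facts_def state_fact_def head_fact_def cell_fact_def fact_no_def Let_def)

end

section \<open>Certificates and satisfying assignments\<close>

lemma word_tape_pair_word: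
  "word_tape (pair_word x u) (int i) = (if i \<le> 2 * length x then known_symbol x i
     else if i - (2 * length x + 1) < length u then bit_symbol (u ! (i - (2 * length x + 1))) else 0)"
proof -
  have *: "word_tape (pair_word x u) (int i) =
      (if i < 2 * length x + 1 + length u then bit_symbol (pair_word x u ! i) else 0)"
    by (simp add: word_tape_def length_pair_word)
  consider "i < 2 * length x" "even i" | "i < 2 * length x" "odd i" | "i = 2 * length x" | "2 * length
      x < i"
    by linarith
  then show ?thesis
  proof cases
    case 1
    then show ?thesis using pair_word_nth(1)[of "i div 2" x u]
      by (auto simp: * known_symbol_def bit_symbol_def)
  next
    case 2
    then have i: "i = 2 * (i div 2) + 1" "i div 2 < length x" by (auto elim: oddE)
    show ?thesis using pair_word_nth(2)[OF i(2), of u] 2 i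
      by (auto simp: * known_symbol_def bit_symbol_def word_bit_def)
  next
    case 3
    then show ?thesis using pair_word_nth_end(1)[of x u]
      unfolding * by (auto simp: known_symbol_def bit_symbol_def)
  next
    case 4
    then show ?thesis using pair_word_nth_end(2)[of x u "i - (2 * length x + 1)"]
      by (auto simp: *)
  qed
qed

text \<open>Two cells at the fixed time \<open>T\<close> are what purely negative clauses can speak
  about; \<open>accepts_iff\<close> relates them to halting with an output.\<close>

definition accepts :: "bool list \<Rightarrow> bool" where
  "accepts w \<longleftrightarrow> cell_at w T (k - 1) Z = 2 \<and> cell_at w T (k - 1) (Z + 1) = 0"

lemma initial_cell:
  assumes "j < k"
  shows "cell_at w 0 j p = (if j = 0 \<and> Z \<le> p then word_tape w (int (p - Z)) else 0)"
  using assms unfolding cell_at_def tape_at_0[OF assms] by (auto simp: word_tape_def of_nat_diff)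

lemma initial_cell_pair_word:
  assumes "j < k" "length u \<le> cert_length p\<^sub>u x"
  shows "cell_at (pair_word x u) 0 j p = (if guessed p\<^sub>u p\<^sub>t x j p
      then let i = p - (Z + 2 * length x + 1) in if i < length u then bit_symbol (u ! i) else 0
      else if j = 0 \<and> Z \<le> p then known_symbol x (p - Z) else 0)"
proof (cases "j = 0 \<and> Z \<le> p")
  case True
  have e: "p - Z - (2 * length x + 1) = p - (Z + 2 * length x + 1)" by simp
  show ?thesis
    using True assms(2)
    unfolding initial_cell[OF assms(1)] word_tape_pair_word e guessed_def
    by (auto simp: Let_def known_symbol_def)
next
  case False
  then show ?thesis using assms by (auto simp: initial_cell guessed_def)
qed

text \<open>The clauses allow several symbols in one certificate cell, so a certificate has to be
  chosen: it is cut at the first cell where the blank is allowed and has the bit 1 wherever the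
  symbol 2 is allowed. Its initial cells are then true facts, and propagation does the rest.\<close>

lemma satisfying_accepts:
  assumes rules: "\<And>fam t j p a s. fam < 11 \<Longrightarrow> t < B \<Longrightarrow> j < B
      \<Longrightarrow> p < B \<Longrightarrow> a < B \<Longrightarrow> s < B \<Longrightarrow>
      holds \<alpha> fam t j p a s"
  shows "\<exists>u. length u \<le> cert_length p\<^sub>u x \<and> accepts (pair_word x u)"
proof -
  note bounds = base_bounds[where M = M and p\<^sub>u = p\<^sub>u and p\<^sub>t = p\<^sub>t and x = x]
  define n where "n = cert_length p\<^sub>u x"
  define o' where "o' = Z + 2 * length x + 1"
  define c where "c i s = \<alpha> (cell_fact M p\<^sub>u p\<^sub>t x 0 0 (o' + i) s)" for i s
  have o': "o' + i < B" if "i < n" for i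
    using bounds(6) that by (simp add: o'_def n_def)
  have g: "guessed p\<^sub>u p\<^sub>t x 0 (o' + i)" if "i < n" for i
    using that by (simp add: guessed_def o'_def n_def)
  have k: "1 \<le> k" "3 \<le> S" using tapes_symbols by simp_all
  have c: "c i 0 \<or> c i 1 \<or> c i 2" if "i < n" for i
    using rules[of 7 0 0 "o' + i" 0 0] g[OF that] o'[OF that] bounds(8) k
    by (simp add: rule_holds_def c_def)
  have c0: "c i 0 \<Longrightarrow> Suc i < n \<Longrightarrow> c (Suc i) 0" for i
    using rules[of 8 0 0 "o' + i" 0 0] g[of i] g[of "Suc i"] o'[of i] bounds(8)
    by (simp add: rule_holds_def c_def)
  \<comment> \<open>The alternative \<open>i = n\<close> covers a certificate of full length without
    a blank.\<close>
  define m where "m = (LEAST i. i = n \<or> c i 0)"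
  have m1: "m \<le> n" unfolding m_def by (rule Least_le) simp
  have m2: "m = n \<or> c m 0" unfolding m_def by (rule LeastI[of _ n]) simp
  have m3: "\<not> c i 0" if "i < m" for i using not_less_Least[OF that[unfolded m_def]] by simp
  note m = m1 m2 m3
  have blank: "c i 0" if "m \<le> i" "i < n" for i
    using that
  proof (induction i rule: dec_induct)
    case base
    then show ?case using m(2) by simp
  next
    case (step i)
    then show ?case using c0 by simp
  qed
  define u where "u = map (\<lambda>i. c i 2) [0..<m]"
  have u: "length u \<le> n" using m by (simp add: u_def)
  have "\<alpha> (cell_fact M p\<^sub>u p\<^sub>t x 0 j p (cell_at (pair_word x u) 0 j p))" if j: "j <
      k" and p: "p < B" for j p
  proof (cases "guessed p\<^sub>u p\<^sub>t x j p")
    case True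
    define i where "i = p - o'"
    have i: "i < n" "p = o' + i" "j = 0" using True by (auto simp: guessed_def i_def o'_def n_def)
    have "cell_at (pair_word x u) 0 j p = (if i < m then bit_symbol (c i 2) else 0)"
      using initial_cell_pair_word[OF j, of u p] True u by (simp add: n_def i_def o'_def u_def Let_def)
    \<comment> \<open>Before \<open>m\<close> the blank is excluded, so a bit symbol is allowed;
      from \<open>m\<close> on the blank is allowed by family 8.\<close>
    moreover have "c i (if i < m then bit_symbol (c i 2) else 0)"
      using c[OF i(1)] m(3)[of i] blank[of i] i(1) by (auto simp: bit_symbol_def)
    ultimately show ?thesis unfolding c_def i(2,3) by (simp add: i)
  next
    case False
    then show ?thesis
      using rules[of 7 0 j p 0 0] bounds j p u initial_cell_pair_word[OF j, of u p]
      by (simp add: rule_holds_def n_def)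
  qed
  note forced = facts_forced[of \<alpha>, OF rules this, of T]
  let ?w = "pair_word x u"
  have f: "\<alpha> (cell_fact M p\<^sub>u p\<^sub>t x T (k - 1) p (cell_at ?w T (k - 1) p))" if "p <
      B" for p
    using forced that k by simp
  have less: "cell_at ?w T (k - 1) p < S" for p using cell_at_less k by simp
  have "cell_at ?w T (k - 1) Z = 2"
  proof (rule ccontr)
    assume "cell_at ?w T (k - 1) Z \<noteq> 2"
    then show False
      using rules[of 9 0 0 0 0 "cell_at ?w T (k - 1) Z"] f[of Z] less[of Z] bounds
      by (simp add: rule_holds_def)
  qed
  moreover have "cell_at ?w T (k - 1) (Z + 1) = 0"
  proof (rule ccontr)
    assume "cell_at ?w T (k - 1) (Z + 1) \<noteq> 0"
    then show False
      using rules[of 10 0 0 0 0 "cell_at ?w T (k - 1) (Z + 1)"] f[of "Z + 1"] less[of "Z + 1"] bounds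
      by (simp add: rule_holds_def)
  qed
  ultimately show ?thesis using u by (auto simp: accepts_def n_def)
qed

text \<open>Under the canonical assignment the premises pin the indices to the real values, so each
  rule becomes a statement about the computation itself; the rules on initial cells use the bound on
  \<open>u\<close>, the last two use acceptance.\<close>

lemma accepts_satisfying:
  assumes u: "length u \<le> cert_length p\<^sub>u x" and acc: "accepts (pair_word x u)"
    and fam: "t < B" "j < B" "p < B" "a < B" "s < B"
  shows "holds (true_facts (pair_word x u)) fam t j p a s"
proof -
  note bounds = base_bounds[where M = M and p\<^sub>u = p\<^sub>u and p\<^sub>t = p\<^sub>t and x = x]
  let ?w = "pair_word x u"
  note tf = true_facts
  have k: "1 \<le> k" "3 \<le> S" using tapes_symbols by simp_all
  have B: "S < B" "k < B" "codes M < B" "T + 4 < B" "0 < B" "Z + 5 < B" using bounds by simp_all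
  have "code_at ?w t j < B" for t j using code_at_less[of ?w t j] B by linarith
  note code = this
  have head: "head_at ?w t j < B" if "j < k" "t \<le> T" for t j
  proof -
    have "head_at ?w t j + 2 < B" by (rule int_head_at(3)[OF that])
    then show ?thesis by simp
  qed
  have cell: "cell_at ?w t j p < B" if "j < k" for t j p
  proof -
    have "cell_at ?w t j p < S" by (rule cell_at_less[OF that])
    then show ?thesis using B by simp
  qed
  have moved: "head_at ?w t j + shift M (code_at ?w t k) j - Suc 0 = head_at ?w (Suc t) j"
    if "j < k" "t < T" for t j
    using that by (simp add: shift_code_at head_at_Suc)
  have wrote: "written M (code_at ?w t k) j = cell_at ?w (Suc t) j (head_at ?w t j)"
    if "j < k" "t < T" for t j
    using that by (simp add: written_code_at cell_at_Suc)
  have "fam = 0 \<or> fam = 1 \<or> fam = 2 \<or> fam = 3 \<or> fam = 4 \<or> fam = 5 \<or> fam = 6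
      \<or> fam = 7 \<or>
    fam = 8 \<or> fam = 9 \<or> 9 < fam" by presburger
  then consider "fam = 0" | "fam = 1" | "fam = 2" | "fam = 3" | "fam = 4" | "fam = 5" | "fam = 6" |
      "fam = 7" |
    "fam = 8" | "fam = 9" | "9 < fam" by blast
  then show ?thesis
  proof cases
    case 1
    then show ?thesis using B fam by (auto simp: rule_holds_def tf code scan_code_at cell_at_head)
  next
    case 2
    then show ?thesis using B fam by (auto simp: rule_holds_def tf code next_state_code_at)
  next
    case 3
    then show ?thesis using B fam by (auto simp: rule_holds_def tf code moved head)
  next
    case 4
    then show ?thesis using B fam by (auto simp: rule_holds_def tf code wrote cell)
  next
    case 5
    then show ?thesis using B fam by (auto simp: rule_holds_def tf cell_at_Suc)
  next
    case 6
    have "to_nat [0 :: nat] = code_at ?w 0 0"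
      by (simp add: code_at_def state_at_def config_at_def init_config_def)
    then show ?thesis using B fam 6 code by (auto simp: rule_holds_def tf)
  next
    case 7
    have "head_at ?w 0 j = Z" if "j < k" using that by (simp add: head_at_def tape_at_0)
    then show ?thesis using B fam 7 by (auto simp: rule_holds_def tf)
  next
    case 8
    have ks: "known_symbol x i < B" for i using B k by (simp add: known_symbol_def)
    have "2 < B" using B k by simp
    then show ?thesis using B fam 8 ks initial_cell_pair_word[OF _ u, of j p]
      by (auto simp: rule_holds_def tf Let_def bit_symbol_def)
  next
    case 9
    have "Suc p < B" if "guessed p\<^sub>u p\<^sub>t x 0 (Suc p)"
      using that bounds(6) by (simp add: guessed_def)
    then show ?thesis using B fam 9 k initial_cell_pair_word[OF _ u, of 0 p] initial_cell_pair_word[OF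
        _ u, of 0 "Suc p"]
      by (auto simp: rule_holds_def tf Let_def bit_symbol_def guessed_def split: if_splits)
  next
    case 10
    then show ?thesis using B fam acc by (auto simp: rule_holds_def tf accepts_def)
  next
    case 11
    then show ?thesis using B fam acc by (auto simp: rule_holds_def tf accepts_def)
  qed
qed

lemma formula_satisfiable_iff:
  "(\<exists>\<alpha>. \<forall>c<num_clauses M p\<^sub>u p\<^sub>t x. \<exists>l<num_literals M
      p\<^sub>u p\<^sub>t x. member M p\<^sub>u p\<^sub>t x c l \<and> literal_true \<alpha> l)
      \<longleftrightarrow>
   (\<exists>u. length u \<le> cert_length p\<^sub>u x \<and> accepts (pair_word x u))"
proof -
  note sat = member_satisfied[OF tapes_symbols(2,1), of p\<^sub>u p\<^sub>t x]
  show ?thesis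
    unfolding sat
  proof (intro iffI; elim exE conjE)
    fix \<alpha>
    assume "\<forall>fam<11. \<forall>t<B. \<forall>j<B. \<forall>p<B. \<forall>a<B. \<forall>s<B.
        holds \<alpha> fam t j p a s"
    then show "\<exists>u. length u \<le> cert_length p\<^sub>u x \<and> accepts (pair_word x u)"
      by (intro satisfying_accepts[of \<alpha>]) simp
  next
    fix u
    assume "length u \<le> cert_length p\<^sub>u x" "accepts (pair_word x u)"
    then show "\<exists>\<alpha>. \<forall>fam<11. \<forall>t<B. \<forall>j<B. \<forall>p<B.
        \<forall>a<B. \<forall>s<B. holds \<alpha> fam t j p a s"
      by (intro exI[of _ "true_facts (pair_word x u)"] allI impI accepts_satisfying)
  qed
qed

text \<open>A halted configuration never changes, so the cells at time \<open>T\<close> show the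
  output. Bits are not written as blanks, so the symbol 2 followed by a blank can only be the output
  \<open>[True]\<close>.\<close>

lemma accepts_iff:
  assumes "halts_with M w t y" "t \<le> T"
  shows "accepts w \<longleftrightarrow> y = [True]"
proof -
  obtain ts where ts: "(step M ^^ t) (init_config M w) = (num_states M, ts)" and y: "tape_output (last
      ts) y"
    using assms(1) by (auto simp: halts_with_def)
  have "(step M ^^ d) (num_states M, ts) = (num_states M, ts)" for d
    by (induction d) (simp_all add: step_def)
  then have cf: "config_at w T = (num_states M, ts)"
    using ts assms(2) funpow_add[of "T - t" t "step M"] by (simp add: config_at_def)
  have "length ts = k" using config_at_valid[of w T] cf by simp
  then have last: "tape_at w T (k - 1) = last ts"
    using tapes_symbols cf by (subst last_conv_nth) (auto simp: tape_at_def)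
  have c: "cell_at w T (k - 1) (Z + i) = fst (last ts) (int i)" for i
    using last by (simp add: cell_at_def)
  have sym: "fst (last ts) (int i) \<noteq> 0" if "i < length y" for i
    using y that by (simp add: tape_output_def bit_symbol_def)
  show ?thesis
  proof
    assume "accepts w"
    then have a: "fst (last ts) (int 0) = 2" "fst (last ts) (int 1) = 0"
      using c[of 0] c[of 1] by (simp_all add: accepts_def)
    have "\<not> 1 < length y" using a sym[of 1] by auto
    moreover have "length y \<noteq> 0" using a y by (auto simp: tape_output_def)
    ultimately have "length y = 1" by linarith
    moreover from this have "bit_symbol (y ! 0) = 2" using a y by (auto simp: tape_output_def)
    ultimately show "y = [True]" by (cases y) (auto simp: bit_symbol_def split: if_splits)
  next
    assume "y = [True]"
    then show "accepts w" using y c[of 0] c[of 1] by (simp add: tape_output_def accepts_def bit_symbol_def)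
  qed
qed

end

theorem Restricted_Grid_Circuit_SAT_hard:
  assumes "L \<in> NP"
  shows "L \<le>\<^sub>p Restricted_Grid_Circuit_SAT"
proof -
  obtain V p\<^sub>u where V: "poly_time_computable V"
    and L: "\<And>x. x \<in> L \<longleftrightarrow> (\<exists>u. length u \<le> poly p\<^sub>u (length
        x) \<and> V (pair_word x u) = [True])"
    using assms unfolding NP_def by blast
  obtain M p\<^sub>t where M: "valid_tm M" and halts: "\<And>w. \<exists>t \<le> poly p\<^sub>t (length
      w). halts_with M w t (V w)"
    using V unfolding poly_time_computable_def by blast
  let ?f = "\<lambda>x. instance_code
     (formula_circuit (num_literals M p\<^sub>u p\<^sub>t x) (num_clauses M p\<^sub>u p\<^sub>t x)
         (member M p\<^sub>u p\<^sub>t x))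
     (formula_query (num_literals M p\<^sub>u p\<^sub>t x) (num_clauses M p\<^sub>u p\<^sub>t x))"
  have "x \<in> L \<longleftrightarrow> ?f x \<in> Restricted_Grid_Circuit_SAT" for x
  proof -
    have "accepts M p\<^sub>u p\<^sub>t x (pair_word x u) \<longleftrightarrow> V (pair_word x u) = [True]"
      if "length u \<le> cert_length p\<^sub>u x" for u
    proof -
      obtain t where t: "t \<le> poly p\<^sub>t (length (pair_word x u))" "halts_with M (pair_word x u)
          t (V (pair_word x u))"
        using halts by blast
      \<comment> \<open>Certificates are no longer than \<open>cert_length\<close> and polynomials
        over the naturals are monotone, so one time bound covers all of them.\<close>
      have "poly p\<^sub>t (length (pair_word x u)) \<le> time p\<^sub>u p\<^sub>t x"
        unfolding time_def using that by (intro poly_mono_nat) (simp add: length_pair_word)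
      then show ?thesis using t by (intro accepts_iff[OF M t(2)]) simp
    qed
    then show ?thesis
      unfolding formula_instance_iff formula_satisfiable_iff[OF M] L cert_length_def[symmetric] by blast
  qed
  then show ?thesis
    unfolding poly_time_reducible_def using tableau_reduction by blast
qed

theorem theorem5: "NP_complete Restricted_Grid_Circuit_SAT"
  unfolding NP_complete_def using Restricted_Grid_Circuit_SAT_in_NP Restricted_Grid_Circuit_SAT_hard by
      blast

end
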